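(* Let $\kappa,a,\beta>0$, and let $\mathbf H$ be the classical lattice physical Hamiltonian defined in the context with the Giesel-Thiemann Lorentzian constraint $C_v=C_{0,v}+\frac{1+\beta^2}{2}C_{L,v}$. Define, for $\theta\in\mathbb R$, $p>0$, $$\mathbf H[\theta,p]=\begin{cases}-\frac{4a|V(\gamma)|}{\kappa}\sqrt{2\beta p}\left[\sin^2\theta-\frac49\frac{1+\beta^2}{\beta^2}\sin^2(2\theta)\right]&\text{for }\mathbf H=\mathbf H_{dust}\ (\text{Brown-Kuchař or Gaussian}),\\[4pt]\frac{\sqrt2\,a^2|V(\gamma)|}{\sqrt\kappa}\,\beta p\,\sqrt{-\sin^2\theta+\frac49\frac{1+\beta^2}{\beta^2}\sin^2(2\theta)}&\text{for }\mathbf H=\mathbf H_{scalar}.\end{cases}$$ Then, in each of these models, for differentiable functions $\theta(\tau)\in\mathbb R$, $p(\tau)>0$ with $\mathbf H[\theta,p]>0$, the cosmological evolution equations $$\frac{d\theta}{d\tau}=-\frac{\kappa}{a^2}\frac{\partial \mathbf H}{\partial\,\delta p_\parallel(e_I(v))}\Big|_{\delta\theta=\delta p=0},\qquad \frac{dp}{d\tau}=\frac{\kappa}{a^2}\frac{\partial \mathbf H}{\partial\,\delta \theta_\parallel(e_I(v))}\Big|_{\delta\theta=\delta p=0}\qquad\text{for all } I, v$$ are equivalent to $$\frac{d\theta}{d\tau}=-\frac{\kappa}{a^2}\frac{\partial}{\partial p}\left[\frac{1}{3|V(\gamma)|}\mathbf H[\theta,p]\right],\qquad \frac{dp}{d\tau}=\frac{\kappa}{a^2}\frac{\partial}{\partial\theta}\left[\frac{1}{3|V(\gamma)|}\mathbf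 H[\theta,p]\right],$$ and the constraint equations $$\frac{\partial \mathbf H}{\partial\,\delta p^b_\bot(e_I(v))}\Big|_{\delta\theta=\delta p=0}=0,\qquad \frac{\partial \mathbf H}{\partial\,\delta \theta^b_\bot(e_I(v))}\Big|_{\delta\theta=\delta p=0}=0\qquad\text{for all } I,v\text{ and } b\neq I$$ are satisfied automatically.
   Context: Conventions: $\tau^a=\tau_a=-i\sigma^a$ ($\sigma^a$ Pauli matrices, $a=1,2,3$), $\tau_0=1_{2\times2}$; repeated su(2) indices are summed. Lattice: $\gamma$ is the periodic cubic lattice with vertex set $V(\gamma)=(\mathbb Z/L)^3$ ($L\ge2$, so the six edges at a vertex are distinct), $|V(\gamma)|=L^3$, oriented edges $e_I(v)$ from $v$ to $v+\hat I$, $I=1,2,3$. Write $e_{v;I+}=e_I(v)$ and $e_{v;I-}=e_I(v-\hat I)^{-1}$ (both start at $v$). Phase space: each edge $e$ carries $h(e)\in SU(2)$ and $p(e)=(p^a(e))\in\mathbb R^3$, with Poisson brackets $\{h(e),h(e')\}=0$, $\{p^a(e),h(e')\}=\frac{\kappa}{a^2}\delta_{e,e'}\frac{\tau^a}{2}h(e')$, $\{p^a(e),p^b(e')\}=-\frac{\kappa}{a^2}\delta_{e,e'}\epsilon_{abc}p^c(e')$. For reversed edges $h(e^{-1})=h(e)^{-1}$, $p^a(e^{-1})=\frac12\mathrm{Tr}[\tau^a h(e)^{-1}p^b(e)\tau^b h(e)]$. For signs $s,s'=\pm1$ and $I\ne J$, the square-loop holonomy is $h(\alpha_{v;Is,Js'})=h(e_{v;Is})\,h(e_{v+s\hat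 I;Js'})\,h(e_{v+s'\hat J;Is})^{-1}\,h(e_{v;Js'})^{-1}$. Volume: $V_v=|Q_v|^{1/2}$, $Q_v=\left(\frac{\beta a^2}{2}\right)^3\epsilon_{abc}X_1^aX_2^bX_3^c$, $X_I^a=\frac12\left(p^a(e_{v;I+})-p^a(e_{v;I-})\right)$. Constraints, for $\mu=0,1,2,3$ (with $j$ denoting $\mu=1,2,3$): $$C_{\mu,v}=-\frac{8}{3\beta\kappa^2}\sum_{s_1,s_2,s_3=\pm1}\ \sum_{I_1,I_2,I_3}s_1s_2s_3\,\epsilon^{I_1I_2I_3}\,\mathrm{Tr}\Big(\tau_\mu\,h(\alpha_{v;I_1s_1,I_2s_2})\,h(e_{v;I_3s_3})\{h(e_{v;I_3s_3})^{-1},V_v\}\Big).$$ Lorentzian part: $K=-\frac{1}{\beta^2}\big\{\sum_vC_{0,v},\sum_vV_v\big\}$ and, writing $h_k=h(e_{v;I_ks_k})$, $$C_{L,v}=\frac{128}{3\beta^3\kappa^4}\sum_{s_1,s_2,s_3=\pm1}\ \sum_{I_1,I_2,I_3}s_1s_2s_3\,\epsilon^{I_1I_2I_3}\,\mathrm{Tr}\Big(h_1\{h_1^{-1},K\}\,h_2\{h_2^{-1},K\}\,h_3\{h_3^{-1},V_v\}\Big).$$ Physical Hamiltonians built from $C_v$: $\mathbf H_{dust}=\sum_{v}\big|C_v^2-\frac{\alpha}{4}\sum_{j=1}^3C_{j,v}^2\big|^{1/2}$ with $\alpha=1$ (Brown-Kuchař dust) or $\alpha=0$ (Gaussian dust),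 and $\mathbf H_{scalar}=\sum_v|V_vC_v|^{1/2}$ (gravity coupled to a massless scalar). Perturbed homogeneous isotropic data: given constants $\theta\in\mathbb R$, $p>0$, $\mathbf H$ is regarded as a function of independent real perturbations by evaluating it at $p^b(e_I(v))=[p+\delta p_\parallel(e_I(v))]\delta^b_I+\delta p_\bot^b(e_I(v))$ and $h(e_I(v))=e^{\theta^b(e_I(v))\tau^b/2}$ with $\theta^b(e_I(v))=[\theta+\delta\theta_\parallel(e_I(v))]\delta^b_I+\delta\theta^b_\bot(e_I(v))$, where $\delta p_\bot^I(e_I(v))=\delta\theta_\bot^I(e_I(v))=0$. "$\delta\theta=\delta p=0$" means all perturbations vanish. *)

theory Defs
  imports
    "HOL-Analysis.Analysis"
    "Berlekamp_Zassenhaus.Finite_Field"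
begin

section \<open>Matrices, SU(2)\<close>

type_synonym cmat2 = "complex^2^2"

definition pauli :: "3 \<Rightarrow> cmat2" where
  "pauli i =
     (if i = 1 then vector [vector [0, 1], vector [1, 0]]
      else if i = 2 then vector [vector [0, - \<i>], vector [\<i>, 0]]
      else vector [vector [1, 0], vector [0, - 1]])"

definition tau :: "3 \<Rightarrow> cmat2" where
  "tau i = map_matrix (\<lambda>z. - \<i> * z) (pauli i)"

definition eps :: "3 \<Rightarrow> 3 \<Rightarrow> 3 \<Rightarrow> real" where
  "eps i j k =
     (if (i, j, k) \<in> {(1, 2, 3), (2, 3, 1), (3, 1, 2)} then 1
      else if (i, j, k) \<in> {(1, 3, 2), (3, 2, 1), (2, 1, 3)} then - 1
      else 0)"

definition adj :: "cmat2 \<Rightarrow> cmat2" where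
  "adj A = map_matrix cnj (transpose A)"

text \<open>The library product on \<open>complex^2^2\<close> written \<open>*\<close> is componentwise, so the generic \<open>exp\<close> is
  not available; the exponential series is formed with the matrix product.\<close>

definition mexp :: "cmat2 \<Rightarrow> cmat2" where
  "mexp A = (\<Sum>n. (((**) A) ^^ n) (mat 1) /\<^sub>R fact n)"

typedef su2 = "{U :: cmat2. U ** adj U = mat 1 \<and> det U = 1}" morphisms su2_mat Abs_su2
proof
  show "mat 1 \<in> {U :: cmat2. U ** adj U = mat 1 \<and> det U = 1}"
    by (simp add: adj_def vec_eq_iff matrix_matrix_mult_def forall_2 sum_2 transpose_def mat_def det_2)
qed

setup_lifting type_definition_su2

lift_definition su2_times :: "su2 \<Rightarrow> su2 \<Rightarrow> su2" is "(**)"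
proof -
  fix A B :: cmat2
  assume A: "A ** adj A = mat 1 \<and> det A = 1" and B: "B ** adj B = mat 1 \<and> det B = 1"
  have "adj (A ** B) = adj B ** adj A"
    by (simp add: adj_def vec_eq_iff matrix_matrix_mult_def transpose_def mult.commute)
  then have "(A ** B) ** adj (A ** B) = A ** (B ** adj B) ** adj A"
    by (simp add: matrix_mul_assoc)
  then show "(A ** B) ** adj (A ** B) = mat 1 \<and> det (A ** B) = 1"
    using A B by (simp add: det_mul)
qed

definition su2_algebra :: "real^3 \<Rightarrow> cmat2" where
  "su2_algebra x = (\<Sum>i\<in>UNIV. (x $ i / 2) *\<^sub>R tau i)"

lemma su2_algebra_entries:
  "su2_algebra x $ 1 $ 1 = Complex 0 (- x$3 / 2)"
  "su2_algebra x $ 1 $ 2 = Complex (- x$2 / 2) (- x$1 / 2)"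
  "su2_algebra x $ 2 $ 1 = Complex (x$2 / 2) (- x$1 / 2)"
  "su2_algebra x $ 2 $ 2 = Complex 0 (x$3 / 2)"
  by (simp_all add: su2_algebra_def sum_3 tau_def pauli_def complex_eq_iff)

lemma su2_algebra_square:
  "su2_algebra x ** su2_algebra x = (- (norm x / 2)\<^sup>2) *\<^sub>R mat 1"
proof -
  have n: "(norm x)\<^sup>2 = (x$1)\<^sup>2 + (x$2)\<^sup>2 + (x$3)\<^sup>2"
    by (simp add: norm_vec_def L2_set_def sum_3)
  show ?thesis
    by (simp add: vec_eq_iff forall_2 matrix_matrix_mult_def sum_2 su2_algebra_entries
        complex_eq_iff mat_def power_divide n)
      (simp add: field_simps power2_eq_square)
qed

lemma matrix_mul_scaleR_right: "(A::cmat2) ** (c *\<^sub>R B) = c *\<^sub>R (A ** B)"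
  by (simp add: vec_eq_iff matrix_matrix_mult_def scaleR_sum_right)

lemma su2_algebra_powers:
  fixes x :: "real^3"
  defines "A \<equiv> su2_algebra x" and "r \<equiv> norm x / 2"
  shows "(((**) A) ^^ (2 * n)) (mat 1) = ((- 1) ^ n * r ^ (2 * n)) *\<^sub>R mat 1"
    and "(((**) A) ^^ (2 * n + 1)) (mat 1) = ((- 1) ^ n * r ^ (2 * n)) *\<^sub>R A"
proof -
  have sq: "A ** A = (- r\<^sup>2) *\<^sub>R mat 1"
    unfolding A_def r_def by (rule su2_algebra_square)
  show e: "(((**) A) ^^ (2 * n)) (mat 1) = ((- 1) ^ n * r ^ (2 * n)) *\<^sub>R mat 1" for n
  proof (induction n)
    case (Suc n)
    then show ?case
      by (simp add: matrix_mul_scaleR_right sq power2_eq_square mult_ac)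
  qed simp
  show "(((**) A) ^^ (2 * n + 1)) (mat 1) = ((- 1) ^ n * r ^ (2 * n)) *\<^sub>R A"
    by (simp add: e matrix_mul_scaleR_right)
qed

lemma mexp_su2_algebra:
  "mexp (su2_algebra x) = cos (norm x / 2) *\<^sub>R mat 1
     + (sin (norm x / 2) / (norm x / 2)) *\<^sub>R su2_algebra x"
proof -
  define A r where "A = su2_algebra x" and "r = norm x / 2"
  have A0: "A = 0" if "r = 0"
    using that by (simp add: A_def r_def su2_algebra_def)
  have "(((**) A) ^^ n) (mat 1) /\<^sub>R fact n
      = (cos_coeff n * r ^ n) *\<^sub>R mat 1 + (sin_coeff n * r ^ n / r) *\<^sub>R A" for n
  proof (cases "even n")
    case True
    then obtain k where k: "n = 2 * k" by blast
    show ?thesis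
      using su2_algebra_powers(1)[of k x]
      by (simp add: k cos_coeff_def sin_coeff_def A_def r_def field_simps)
  next
    case False
    then obtain k where k: "n = 2 * k + 1" by (blast elim: oddE)
    show ?thesis
    proof (cases "r = 0")
      case True
      with A0 show ?thesis by (simp add: k cos_coeff_def)
    next
      case nz: False
      have "sin_coeff n * r ^ n / r = (- 1) ^ k * r ^ (2 * k) / fact n"
        using nz by (simp add: k sin_coeff_def del: fact_Suc)
      moreover have "cos_coeff n = 0"
        by (simp add: k cos_coeff_def)
      moreover have "(((**) A) ^^ n) (mat 1) = ((- 1) ^ k * r ^ (2 * k)) *\<^sub>R A"
        unfolding k A_def r_def by (rule su2_algebra_powers(2))
      ultimately show ?thesis
        by (simp only: mult_zero_left scaleR_zero_left add_0_left scaleR_scaleR)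
          (simp add: divide_inverse mult.commute)
    qed
  qed
  moreover have "(\<lambda>n. (cos_coeff n * r ^ n) *\<^sub>R mat 1 + (sin_coeff n * r ^ n / r) *\<^sub>R A)
      sums (cos r *\<^sub>R mat 1 + (sin r / r) *\<^sub>R A)"
    using cos_converges[of r] sin_converges[of r]
    by (intro sums_add sums_scaleR_left sums_divide) simp_all
  ultimately have "(\<lambda>n. (((**) A) ^^ n) (mat 1) /\<^sub>R fact n)
      sums (cos r *\<^sub>R mat 1 + (sin r / r) *\<^sub>R A)"
    by simp
  then show ?thesis
    unfolding mexp_def A_def r_def by (rule sums_unique[symmetric])
qed

lift_definition su2_exp :: "real^3 \<Rightarrow> su2" is "\<lambda>x. mexp (su2_algebra x)"
proof -
  fix x :: "real^3"
  define r c s where "r = norm x / 2" and "c = cos r" and "s = sin r / r"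
  have n: "(norm x)\<^sup>2 = (x$1)\<^sup>2 + (x$2)\<^sup>2 + (x$3)\<^sup>2"
    by (simp add: norm_vec_def L2_set_def sum_3)
  have "(s * r)\<^sup>2 = (sin r)\<^sup>2" by (cases "r = 0") (simp_all add: s_def)
  then have "c\<^sup>2 + (s * r)\<^sup>2 = 1" by (simp add: c_def)
  then have one: "c\<^sup>2 + s\<^sup>2 * ((x$1)\<^sup>2 + (x$2)\<^sup>2 + (x$3)\<^sup>2) / 4 = 1"
    by (simp add: r_def power_mult_distrib power_divide n)
  have E: "mexp (su2_algebra x) = c *\<^sub>R mat 1 + s *\<^sub>R su2_algebra x"
    by (simp add: mexp_su2_algebra c_def s_def r_def)
  show "mexp (su2_algebra x) ** adj (mexp (su2_algebra x)) = mat 1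
      \<and> det (mexp (su2_algebra x)) = 1"
    unfolding E using one
    by (simp add: vec_eq_iff forall_2 matrix_matrix_mult_def sum_2 su2_algebra_entries
        complex_eq_iff mat_def adj_def transpose_def det_2)
      (simp add: field_simps power2_eq_square)
qed


section \<open>Lattice and phase space\<close>

text \<open>The side length is \<open>L = CARD('l)\<close>; the class \<open>nontriv\<close> says \<open>CARD('l) > 1\<close>, so
  \<open>'l mod_ring\<close> is the ring of integers modulo \<open>L \<ge> 2\<close>. The pair \<open>(v, I)\<close> is the
  oriented edge \<open>e\<^sub>I(v)\<close>. Directions and su(2) indices range over the type \<open>3\<close>, whose elements
  are \<open>1\<close>, \<open>2\<close> and \<open>3 = 0\<close>.\<close>

type_synonym 'l vertex = "('l mod_ring)^3"
type_synonym 'l edge = "'l vertex \<times> 3"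
type_synonym 'l phase = "('l edge \<Rightarrow> su2) \<times> ('l edge \<Rightarrow> real^3)"

definition shift :: "'l::nontriv vertex \<Rightarrow> 3 \<Rightarrow> int \<Rightarrow> 'l vertex" where
  "shift v I s = v + axis I (of_int s)"


section \<open>Poisson bracket\<close>

definition flux_deriv :: "'l::nontriv edge \<Rightarrow> 3 \<Rightarrow> ('l phase \<Rightarrow> 'b::real_normed_vector) \<Rightarrow> 'l phase \<Rightarrow> 'b" where
  "flux_deriv e i F = (\<lambda>(h, p).
     vector_derivative (\<lambda>t. F (h, p(e := p e + t *\<^sub>R axis i 1))) (at 0))"

definition hol_deriv :: "'l::nontriv edge \<Rightarrow> 3 \<Rightarrow> ('l phase \<Rightarrow> 'b::real_normed_vector) \<Rightarrow> 'l phase \<Rightarrow> 'b" where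
  "hol_deriv e i F = (\<lambda>(h, p).
     vector_derivative (\<lambda>t. F (h(e := su2_times (su2_exp (t *\<^sub>R axis i 1)) (h e)), p)) (at 0))"

text \<open>The biderivation extending the elementary brackets between holonomies and fluxes (see the
  lemmas below). The first argument may be vector valued, so that brackets of matrices of
  functions are taken entrywise.\<close>

definition poisson ::
  "real \<Rightarrow> real \<Rightarrow> ('l::nontriv phase \<Rightarrow> 'b::real_normed_vector) \<Rightarrow> ('l phase \<Rightarrow> real) \<Rightarrow> 'l phase \<Rightarrow> 'b" where
  "poisson \<kappa> a F G x = (\<kappa> / a\<^sup>2) *\<^sub>R (\<Sum>e\<in>UNIV.
      (\<Sum>i\<in>UNIV. hol_deriv e i G x *\<^sub>R flux_deriv e i F x
              - flux_deriv e i G x *\<^sub>R hol_deriv e i F x)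
      - (\<Sum>i\<in>UNIV. \<Sum>j\<in>UNIV. \<Sum>k\<in>UNIV.
           (eps i j k * snd x e $ k * flux_deriv e j G x) *\<^sub>R flux_deriv e i F x))"

lemma flux_deriv_hol: "flux_deriv e i (\<lambda>x. F (fst x)) x = 0"
  by (simp add: flux_deriv_def split: prod.splits)

lemma hol_deriv_flux: "hol_deriv e i (\<lambda>x. F (snd x)) x = 0"
  by (simp add: hol_deriv_def split: prod.splits)

lemma flux_deriv_flux:
  "flux_deriv e i (\<lambda>x. snd x e' $ j) x = (if e = e' \<and> i = j then 1 else (0::real))"
proof -
  have "((\<lambda>t. snd x e' $ j + t * (if e = e' \<and> i = j then 1 else 0))
      has_vector_derivative (if e = e' \<and> i = j then 1 else (0::real))) (at 0)"
    by (auto intro!: derivative_eq_intros simp: has_real_derivative_iff_has_vector_derivative[symmetric])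
  moreover have "((snd x)(e := snd x e + t *\<^sub>R axis i 1)) e' $ j
      = snd x e' $ j + t * (if e = e' \<and> i = j then 1 else 0)" for t
    by (auto simp: axis_def)
  ultimately show ?thesis
    by (simp only: flux_deriv_def split_beta fst_conv snd_conv vector_derivative_at)
qed

lemma hol_deriv_hol:
  "hol_deriv e i (\<lambda>x. su2_mat (fst x e')) x
     = (if e = e' then (1 / 2) *\<^sub>R (tau i ** su2_mat (fst x e)) else 0)"
proof -
  let ?h = "su2_mat (fst x e)"
  have lin: "su2_algebra (t *\<^sub>R axis i 1) = (t / 2) *\<^sub>R tau i" for t
  proof -
    have "su2_algebra (t *\<^sub>R axis i 1) = (\<Sum>j\<in>UNIV. if j = i then (t / 2) *\<^sub>R tau i else 0)"
      unfolding su2_algebra_def by (rule sum.cong) (auto simp: axis_def)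
    then show ?thesis by simp
  qed
  have E: "su2_mat (su2_exp (t *\<^sub>R axis i 1)) = cos (t / 2) *\<^sub>R mat 1 + sin (t / 2) *\<^sub>R tau i" for t
    unfolding su2_exp.rep_eq mexp_su2_algebra
    by (cases "t = 0") (simp_all add: lin abs_if)
  have distr: "(A + B) ** C = A ** C + B ** C" for A B C :: cmat2
    by (simp add: vec_eq_iff matrix_matrix_mult_def sum.distrib distrib_right)
  have D: "((\<lambda>t. cos (t / 2) *\<^sub>R ?h + sin (t / 2) *\<^sub>R (tau i ** ?h))
      has_vector_derivative (1 / 2) *\<^sub>R (tau i ** ?h)) (at 0)"
    by (auto intro!: derivative_eq_intros simp: has_real_derivative_iff_has_vector_derivative[symmetric])
  have "su2_mat (su2_times (su2_exp (t *\<^sub>R axis i 1)) (fst x e))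
      = cos (t / 2) *\<^sub>R ?h + sin (t / 2) *\<^sub>R (tau i ** ?h)" for t
    by (simp add: su2_times.rep_eq E distr scalar_matrix_assoc[symmetric])
  then show ?thesis
    using vector_derivative_at[OF D] by (auto simp: hol_deriv_def split_beta)
qed

lemma poisson_hol_hol: "poisson \<kappa> a (\<lambda>x. F (fst x)) (\<lambda>x. G (fst x)) x = 0"
  by (simp add: poisson_def flux_deriv_hol)

lemma poisson_hol_flux:
  "poisson \<kappa> a (\<lambda>x. su2_mat (fst x e')) (\<lambda>x. snd x e $ i) x
     = - (\<kappa> / a\<^sup>2) *\<^sub>R (if e = e' then (1 / 2) *\<^sub>R (tau i ** su2_mat (fst x e')) else 0)"
proof -
  let ?X = "(1 / 2) *\<^sub>R (tau i ** su2_mat (fst x e'))"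
  have "(\<Sum>j\<in>UNIV. hol_deriv d j (\<lambda>x. snd x e $ i) x *\<^sub>R flux_deriv d j (\<lambda>x. su2_mat (fst x e')) x
        - flux_deriv d j (\<lambda>x. snd x e $ i) x *\<^sub>R hol_deriv d j (\<lambda>x. su2_mat (fst x e')) x)
      = (if d = e then if e = e' then - ?X else 0 else 0)" for d
  proof -
    have "hol_deriv d j (\<lambda>x. snd x e $ i) x *\<^sub>R flux_deriv d j (\<lambda>x. su2_mat (fst x e')) x
        - flux_deriv d j (\<lambda>x. snd x e $ i) x *\<^sub>R hol_deriv d j (\<lambda>x. su2_mat (fst x e')) x
        = (if j = i then if d = e then if e = e' then - ?X else 0 else 0 else 0)" for j
      using flux_deriv_hol[of d j "\<lambda>h. su2_mat (h e')" x] by (simp add: flux_deriv_flux hol_deriv_hol)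
    then show ?thesis by simp
  qed
  then show ?thesis
    using flux_deriv_hol[of _ _ "\<lambda>h. su2_mat (h e')" x] by (simp add: poisson_def)
qed

lemma poisson_flux_flux:
  "poisson \<kappa> a (\<lambda>x. snd x e $ i) (\<lambda>x. snd x e' $ j) x
     = - (\<kappa> / a\<^sup>2) * (if e = e' then \<Sum>k\<in>UNIV. eps i j k * snd x e $ k else 0)"
proof -
  have "(\<Sum>i'\<in>UNIV. \<Sum>j'\<in>UNIV. \<Sum>k\<in>UNIV.
          (eps i' j' k * snd x d $ k * flux_deriv d j' (\<lambda>x. snd x e' $ j) x)
            *\<^sub>R flux_deriv d i' (\<lambda>x. snd x e $ i) x)
      = (if d = e then if e = e' then \<Sum>k\<in>UNIV. eps i j k * snd x e $ k else 0 else 0)" for d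
  proof -
    have "(\<Sum>k\<in>UNIV. (eps i' j' k * snd x d $ k * flux_deriv d j' (\<lambda>x. snd x e' $ j) x)
            *\<^sub>R flux_deriv d i' (\<lambda>x. snd x e $ i) x)
        = (if j' = j then if i' = i then if d = e then if e = e'
            then \<Sum>k\<in>UNIV. eps i j k * snd x e $ k else 0 else 0 else 0 else 0)" for i' j'
      by (simp add: flux_deriv_flux)
    then show ?thesis by simp
  qed
  then show ?thesis
    using hol_deriv_flux[of _ _ "\<lambda>p. p e $ i" x] hol_deriv_flux[of _ _ "\<lambda>p. p e' $ j" x]
    by (simp add: poisson_def sum_negf)
qed


section \<open>Holonomies, fluxes, volume, constraints\<close>

text \<open>\<open>hol x v I s\<close> and \<open>flux x v I s\<close> belong to the edge \<open>e\<^bsub>v;Is\<^esub>\<close> starting at \<open>v\<close>, with \<open>s \<in> {1, -1}\<close>.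
  The traces in \<open>flux\<close> and in the constraints below are taken of elements of the real span of
  \<open>1, \<tau>\<^sub>1, \<tau>\<^sub>2, \<tau>\<^sub>3\<close> and are therefore real; \<open>Re\<close> only changes the type.\<close>

definition hol :: "'l::nontriv phase \<Rightarrow> 'l vertex \<Rightarrow> 3 \<Rightarrow> int \<Rightarrow> cmat2" where
  "hol x v I s = (if s = 1 then su2_mat (fst x (v, I))
                  else matrix_inv (su2_mat (fst x (shift v I (- 1), I))))"

definition flux :: "'l::nontriv phase \<Rightarrow> 'l vertex \<Rightarrow> 3 \<Rightarrow> int \<Rightarrow> 3 \<Rightarrow> real" where
  "flux x v I s i =
     (if s = 1 then snd x (v, I) $ i
      else let e = (shift v I (- 1), I); h = su2_mat (fst x e) in
        1 / 2 * Re (trace (tau i ** matrix_inv h ** (\<Sum>j\<in>UNIV. (snd x e $ j) *\<^sub>R tau j) ** h)))"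

definition loop :: "'l::nontriv phase \<Rightarrow> 'l vertex \<Rightarrow> 3 \<Rightarrow> int \<Rightarrow> 3 \<Rightarrow> int \<Rightarrow> cmat2" where
  "loop x v I s J s' =
     hol x v I s ** hol x (shift v I s) J s'
       ** matrix_inv (hol x (shift v J s') I s) ** matrix_inv (hol x v J s')"

definition avg_flux :: "'l::nontriv phase \<Rightarrow> 'l vertex \<Rightarrow> 3 \<Rightarrow> 3 \<Rightarrow> real" where
  "avg_flux x v I i = 1 / 2 * (flux x v I 1 i - flux x v I (- 1) i)"

definition Q :: "real \<Rightarrow> real \<Rightarrow> 'l::nontriv vertex \<Rightarrow> 'l phase \<Rightarrow> real" where
  "Q \<beta> a v x = (\<beta> * a\<^sup>2 / 2) ^ 3 *
     (\<Sum>i\<in>UNIV. \<Sum>j\<in>UNIV. \<Sum>k\<in>UNIV.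
        eps i j k * avg_flux x v 1 i * avg_flux x v 2 j * avg_flux x v 3 k)"

definition Vol :: "real \<Rightarrow> real \<Rightarrow> 'l::nontriv vertex \<Rightarrow> 'l phase \<Rightarrow> real" where
  "Vol \<beta> a v x = sqrt \<bar>Q \<beta> a v x\<bar>"

text \<open>\<open>hol_bracket \<kappa> a v I s F\<close> is \<open>h {h\<^sup>-\<^sup>1, F}\<close> for \<open>h = h(e\<^bsub>v;Is\<^esub>)\<close>.\<close>

definition hol_bracket ::
  "real \<Rightarrow> real \<Rightarrow> 'l::nontriv vertex \<Rightarrow> 3 \<Rightarrow> int \<Rightarrow> ('l phase \<Rightarrow> real) \<Rightarrow> 'l phase \<Rightarrow> cmat2" where
  "hol_bracket \<kappa> a v I s F x =
     hol x v I s ** poisson \<kappa> a (\<lambda>y. matrix_inv (hol y v I s)) F x"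

text \<open>The constraint \<open>C\<^bsub>\<mu>,v\<^esub>\<close> with the matrix \<open>\<tau>\<^sub>\<mu>\<close> as argument \<open>t\<close>: \<open>t = mat 1\<close> for \<open>\<mu> = 0\<close>
  and \<open>t = tau j\<close> for \<open>\<mu> = j\<close>.\<close>

definition constr ::
  "real \<Rightarrow> real \<Rightarrow> real \<Rightarrow> cmat2 \<Rightarrow> 'l::nontriv vertex \<Rightarrow> 'l phase \<Rightarrow> real" where
  "constr \<kappa> a \<beta> t v x = - (8 / (3 * \<beta> * \<kappa>\<^sup>2)) *
     (\<Sum>s1\<in>{1, - 1}. \<Sum>s2\<in>{1, - 1}. \<Sum>s3\<in>{1, - 1}. \<Sum>I1\<in>UNIV. \<Sum>I2\<in>UNIV. \<Sum>I3\<in>UNIV.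
        of_int (s1 * s2 * s3) * eps I1 I2 I3 *
        Re (trace (t ** loop x v I1 s1 I2 s2 ** hol_bracket \<kappa> a v I3 s3 (Vol \<beta> a v) x)))"

definition Kext :: "real \<Rightarrow> real \<Rightarrow> real \<Rightarrow> 'l::nontriv phase \<Rightarrow> real" where
  "Kext \<kappa> a \<beta> x = - (1 / \<beta>\<^sup>2) *
     poisson \<kappa> a (\<lambda>y. \<Sum>v\<in>UNIV. constr \<kappa> a \<beta> (mat 1) v y) (\<lambda>y. \<Sum>v\<in>UNIV. Vol \<beta> a v y) x"

definition constr_L :: "real \<Rightarrow> real \<Rightarrow> real \<Rightarrow> 'l::nontriv vertex \<Rightarrow> 'l phase \<Rightarrow> real" where
  "constr_L \<kappa> a \<beta> v x = 128 / (3 * \<beta> ^ 3 * \<kappa> ^ 4) *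
     (\<Sum>s1\<in>{1, - 1}. \<Sum>s2\<in>{1, - 1}. \<Sum>s3\<in>{1, - 1}. \<Sum>I1\<in>UNIV. \<Sum>I2\<in>UNIV. \<Sum>I3\<in>UNIV.
        of_int (s1 * s2 * s3) * eps I1 I2 I3 *
        Re (trace (hol_bracket \<kappa> a v I1 s1 (Kext \<kappa> a \<beta>) x
                   ** hol_bracket \<kappa> a v I2 s2 (Kext \<kappa> a \<beta>) x
                   ** hol_bracket \<kappa> a v I3 s3 (Vol \<beta> a v) x)))"

definition constr_GT :: "real \<Rightarrow> real \<Rightarrow> real \<Rightarrow> 'l::nontriv vertex \<Rightarrow> 'l phase \<Rightarrow> real" where
  "constr_GT \<kappa> a \<beta> v x =
     constr \<kappa> a \<beta> (mat 1) v x + (1 + \<beta>\<^sup>2) / 2 * constr_L \<kappa> a \<beta> v x"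


section \<open>Physical Hamiltonians\<close>

datatype model = Brown_Kuchar_Dust | Gaussian_Dust | Scalar

definition H_dust :: "real \<Rightarrow> real \<Rightarrow> real \<Rightarrow> real \<Rightarrow> 'l::nontriv phase \<Rightarrow> real" where
  "H_dust \<alpha> \<kappa> a \<beta> x = (\<Sum>v\<in>UNIV.
     sqrt \<bar>(constr_GT \<kappa> a \<beta> v x)\<^sup>2 - \<alpha> / 4 * (\<Sum>j\<in>UNIV. (constr \<kappa> a \<beta> (tau j) v x)\<^sup>2)\<bar>)"

definition H_scalar :: "real \<Rightarrow> real \<Rightarrow> real \<Rightarrow> 'l::nontriv phase \<Rightarrow> real" where
  "H_scalar \<kappa> a \<beta> x = (\<Sum>v\<in>UNIV. sqrt \<bar>Vol \<beta> a v x * constr_GT \<kappa> a \<beta> v x\<bar>)"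

fun H_phys :: "model \<Rightarrow> real \<Rightarrow> real \<Rightarrow> real \<Rightarrow> 'l::nontriv phase \<Rightarrow> real" where
  "H_phys Brown_Kuchar_Dust \<kappa> a \<beta> x = H_dust 1 \<kappa> a \<beta> x"
| "H_phys Gaussian_Dust \<kappa> a \<beta> x = H_dust 0 \<kappa> a \<beta> x"
| "H_phys Scalar \<kappa> a \<beta> x = H_scalar \<kappa> a \<beta> x"

text \<open>\<open>N\<close> is the number of vertices.\<close>

definition H_cosm_dust :: "real \<Rightarrow> real \<Rightarrow> real \<Rightarrow> real \<Rightarrow> real \<Rightarrow> real \<Rightarrow> real" where
  "H_cosm_dust N \<kappa> a \<beta> \<theta> p = - (4 * a * N / \<kappa>) * sqrt (2 * \<beta> * p) *
     ((sin \<theta>)\<^sup>2 - 4 / 9 * ((1 + \<beta>\<^sup>2) / \<beta>\<^sup>2) * (sin (2 * \<theta>))\<^sup>2)"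

definition H_cosm_scalar :: "real \<Rightarrow> real \<Rightarrow> real \<Rightarrow> real \<Rightarrow> real \<Rightarrow> real \<Rightarrow> real" where
  "H_cosm_scalar N \<kappa> a \<beta> \<theta> p = sqrt 2 * a\<^sup>2 * N / sqrt \<kappa> * \<beta> * p *
     sqrt (- (sin \<theta>)\<^sup>2 + 4 / 9 * ((1 + \<beta>\<^sup>2) / \<beta>\<^sup>2) * (sin (2 * \<theta>))\<^sup>2)"

fun H_cosm :: "model \<Rightarrow> real \<Rightarrow> real \<Rightarrow> real \<Rightarrow> real \<Rightarrow> real \<Rightarrow> real \<Rightarrow> real" where
  "H_cosm Brown_Kuchar_Dust N \<kappa> a \<beta> \<theta> p = H_cosm_dust N \<kappa> a \<beta> \<theta> p"
| "H_cosm Gaussian_Dust N \<kappa> a \<beta> \<theta> p = H_cosm_dust N \<kappa> a \<beta> \<theta> p"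
| "H_cosm Scalar N \<kappa> a \<beta> \<theta> p = H_cosm_scalar N \<kappa> a \<beta> \<theta> p"


section \<open>Perturbed homogeneous isotropic data\<close>

text \<open>Transversal perturbations are admissible if their component along the direction of the edge
  vanishes. All those used below are admissible.\<close>

definition perturbed ::
  "real \<Rightarrow> real \<Rightarrow> ('l::nontriv edge \<Rightarrow> real) \<Rightarrow> ('l edge \<Rightarrow> real^3) \<Rightarrow>
   ('l edge \<Rightarrow> real) \<Rightarrow> ('l edge \<Rightarrow> real^3) \<Rightarrow> 'l phase" where
  "perturbed \<theta> p \<delta>\<theta>par \<delta>\<theta>perp \<delta>ppar \<delta>pperp =
     (\<lambda>(v, I). su2_exp ((\<theta> + \<delta>\<theta>par (v, I)) *\<^sub>R axis I 1 + \<delta>\<theta>perp (v, I)),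
      \<lambda>(v, I). (p + \<delta>ppar (v, I)) *\<^sub>R axis I 1 + \<delta>pperp (v, I))"

text \<open>\<open>has_partial_\<dots> H \<theta> p \<dots> D\<close>: the partial derivative of \<open>H\<close> with respect to the indicated
  perturbation exists at \<open>\<delta>\<theta> = \<delta>p = 0\<close> and equals \<open>D\<close>.\<close>

definition has_partial_theta_par ::
  "('l::nontriv phase \<Rightarrow> real) \<Rightarrow> real \<Rightarrow> real \<Rightarrow> 'l edge \<Rightarrow> real \<Rightarrow> bool" where
  "has_partial_theta_par H \<theta> p e D \<longleftrightarrow>
     ((\<lambda>t. H (perturbed \<theta> p ((\<lambda>_. 0)(e := t)) (\<lambda>_. 0) (\<lambda>_. 0) (\<lambda>_. 0)))
        has_real_derivative D) (at 0)"

definition has_partial_theta_perp ::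
  "('l::nontriv phase \<Rightarrow> real) \<Rightarrow> real \<Rightarrow> real \<Rightarrow> 'l edge \<Rightarrow> 3 \<Rightarrow> real \<Rightarrow> bool" where
  "has_partial_theta_perp H \<theta> p e b D \<longleftrightarrow>
     ((\<lambda>t. H (perturbed \<theta> p (\<lambda>_. 0) ((\<lambda>_. 0)(e := axis b t)) (\<lambda>_. 0) (\<lambda>_. 0)))
        has_real_derivative D) (at 0)"

definition has_partial_p_par ::
  "('l::nontriv phase \<Rightarrow> real) \<Rightarrow> real \<Rightarrow> real \<Rightarrow> 'l edge \<Rightarrow> real \<Rightarrow> bool" where
  "has_partial_p_par H \<theta> p e D \<longleftrightarrow>
     ((\<lambda>t. H (perturbed \<theta> p (\<lambda>_. 0) (\<lambda>_. 0) ((\<lambda>_. 0)(e := t)) (\<lambda>_. 0)))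
        has_real_derivative D) (at 0)"

definition has_partial_p_perp ::
  "('l::nontriv phase \<Rightarrow> real) \<Rightarrow> real \<Rightarrow> real \<Rightarrow> 'l edge \<Rightarrow> 3 \<Rightarrow> real \<Rightarrow> bool" where
  "has_partial_p_perp H \<theta> p e b D \<longleftrightarrow>
     ((\<lambda>t. H (perturbed \<theta> p (\<lambda>_. 0) (\<lambda>_. 0) (\<lambda>_. 0) ((\<lambda>_. 0)(e := axis b t))))
        has_real_derivative D) (at 0)"

definition lattice_evolution ::
  "('l::nontriv phase \<Rightarrow> real) \<Rightarrow> real \<Rightarrow> real \<Rightarrow> (real \<Rightarrow> real) \<Rightarrow> (real \<Rightarrow> real) \<Rightarrow> real \<Rightarrow> bool" where
  "lattice_evolution H \<kappa> a \<theta> p \<tau> \<longleftrightarrow>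
     (\<forall>v I. \<exists>Dp D\<theta>. has_partial_p_par H (\<theta> \<tau>) (p \<tau>) (v, I) Dp
        \<and> has_partial_theta_par H (\<theta> \<tau>) (p \<tau>) (v, I) D\<theta>
        \<and> (\<theta> has_real_derivative - (\<kappa> / a\<^sup>2) * Dp) (at \<tau>)
        \<and> (p has_real_derivative \<kappa> / a\<^sup>2 * D\<theta>) (at \<tau>))"

definition reduced_evolution ::
  "(real \<Rightarrow> real \<Rightarrow> real) \<Rightarrow> real \<Rightarrow> real \<Rightarrow> real \<Rightarrow> (real \<Rightarrow> real) \<Rightarrow> (real \<Rightarrow> real) \<Rightarrow> real \<Rightarrow> bool" where
  "reduced_evolution Hc N \<kappa> a \<theta> p \<tau> \<longleftrightarrow>
     (\<exists>Dp D\<theta>. ((\<lambda>q. 1 / (3 * N) * Hc (\<theta> \<tau>) q) has_real_derivative Dp) (at (p \<tau>))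
        \<and> ((\<lambda>u. 1 / (3 * N) * Hc u (p \<tau>)) has_real_derivative D\<theta>) (at (\<theta> \<tau>))
        \<and> (\<theta> has_real_derivative - (\<kappa> / a\<^sup>2) * Dp) (at \<tau>)
        \<and> (p has_real_derivative \<kappa> / a\<^sup>2 * D\<theta>) (at \<tau>))"

definition transversal_constraints ::
  "('l::nontriv phase \<Rightarrow> real) \<Rightarrow> real \<Rightarrow> real \<Rightarrow> bool" where
  "transversal_constraints H \<theta> p \<longleftrightarrow>
     (\<forall>v I b. b \<noteq> I \<longrightarrow> has_partial_p_perp H \<theta> p (v, I) b 0
                      \<and> has_partial_theta_perp H \<theta> p (v, I) b 0)"

end

theory Submission
  imports Defs
begin

text \<open>
  All building blocks of the Hamiltonian are functions of the phase space point that are smooth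
  where every \<open>Q\<^sub>v\<close> is positive, and they are invariant (or equivariant) under the orientation
  preserving automorphisms of the lattice, acting together with an arbitrary global rotation of the
  su(2) indices; edges may be reversed, so the invariance of the Poisson bracket needs
  the chain rule. Translations, the cyclic permutation of the axes and the rotations by \<open>\<pi>\<close> about
  the axes, each with a suitable su(2) rotation, fix the homogeneous isotropic data. Hence the gradient
  of an invariant function there consists of one number \<open>c\<close> for all parallel fluxes, one number \<open>d\<close>
  for all parallel angles, and zero in all transversal directions; and \<open>c\<close>, \<open>d\<close> are \<open>1/(3|V(\<gamma>)|)\<close>
  times the derivatives of the function restricted to homogeneous data. This is applied to
  \<open>\<Sum>\<^sub>v V\<^sub>v\<close> and \<open>\<Sum>\<^sub>v C\<^sub>0\<^sub>,\<^sub>v\<close> in order to evaluate \<open>K\<close>, to \<open>K\<close> in order to evaluate \<open>C\<^sub>L\<^sub>,\<^sub>v\<close>, and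
  finally to the Hamiltonian itself.
\<close>

text \<open>The brackets rest on \<open>vector_derivative\<close>, which is unspecified at functions
  that are not differentiable, and K is a bracket that is differentiated once more inside
  \<open>constr_L\<close>. So differentiability has to survive the formation of brackets; pointwise
  differentiability does not, an inductively generated class of functions does. K is computed at
  homogeneous data only, whereas \<open>constr_L\<close> needs its gradient there. A direct
  computation would need K at perturbed data; invariance yields the gradient from the homogeneous
  values alone. The number 3|V| is the number of edges: varying p or \<theta> homogeneously moves
  all of them at once, each contributing the same partial derivative. For the Hamiltonian itself the
  obstacle is the absolute value under the root. Positivity of the reduced Hamiltonian means
  \<open>bracket < 0\<close>, hence C_v < 0 at homogeneous data; so the expressions under the roots
  keep their sign along curves through such data, and \<theta> is not 0, which the transversal
  angles use. SU(2) is treated as the unit quaternions, so that products, traces and conjugations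
  become dot and cross products in R^3.\<close>

unbundle cross3_syntax

section \<open>Unit quaternions\<close>

definition tv :: "real^3 \<Rightarrow> cmat2" where
  "tv y = (\<Sum>i\<in>UNIV. (y $ i) *\<^sub>R tau i)"

text \<open>The real span of 1 and the \<open>tau i\<close> is the quaternion algebra;
  \<open>w\<close> is the scalar part and \<open>y\<close> the vector part.\<close>

definition quat :: "real \<Rightarrow> real^3 \<Rightarrow> cmat2" where
  "quat w y = w *\<^sub>R mat 1 + tv y"

lemma tv_entries:
  "tv y $ 1 $ 1 = Complex 0 (- y$3)" "tv y $ 1 $ 2 = Complex (- y$2) (- y$1)"
  "tv y $ 2 $ 1 = Complex (y$2) (- y$1)" "tv y $ 2 $ 2 = Complex 0 (y$3)"
  by (simp_all add: tv_def sum_3 tau_def pauli_def complex_eq_iff)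

lemma quat_entries:
  "quat w y $ 1 $ 1 = Complex w (- y$3)" "quat w y $ 1 $ 2 = Complex (- y$2) (- y$1)"
  "quat w y $ 2 $ 1 = Complex (y$2) (- y$1)" "quat w y $ 2 $ 2 = Complex w (y$3)"
  by (simp_all add: quat_def tv_entries mat_def complex_eq_iff)

lemma cmat2_eqI:
  fixes A B :: cmat2
  assumes "A$1$1 = B$1$1" "A$1$2 = B$1$2" "A$2$1 = B$2$1" "A$2$2 = B$2$2"
  shows "A = B"
  using assms by (simp add: vec_eq_iff forall_2)

lemma tv_quat: "tv y = quat 0 y"
  by (simp add: quat_def)

lemma mat1_quat: "mat 1 = quat 1 0"
  by (simp add: quat_def tv_def)

text \<open>Hamilton's product; the cross product enters with a plus sign because
  \<open>tau 1 ** tau 2 = tau 3\<close>.\<close>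

lemma quat_mult: "quat w y ** quat w' y' = quat (w * w' - y \<bullet> y') (w *\<^sub>R y' + w' *\<^sub>R y + y \<times> y')"
  by (rule cmat2_eqI)
    (simp_all add: quat_entries matrix_matrix_mult_def sum_2 complex_eq_iff cross3_def
      inner_vec_def sum_3 algebra_simps)

lemma quat_eq_iff: "quat w y = quat w' y' \<longleftrightarrow> w = w' \<and> y = y'"
  by (auto simp: vec_eq_iff forall_2 forall_3 quat_entries)

lemma quat_add: "quat w y + quat w' y' = quat (w + w') (y + y')"
  by (rule cmat2_eqI) (simp_all add: quat_entries complex_eq_iff)

lemma quat_scaleR: "c *\<^sub>R quat w y = quat (c * w) (c *\<^sub>R y)"
  by (rule cmat2_eqI) (simp_all add: quat_entries complex_eq_iff)

lemma adj_quat: "adj (quat w y) = quat w (- y)"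
  by (rule cmat2_eqI) (simp_all add: quat_entries adj_def transpose_def complex_eq_iff)

lemma trace_quat: "trace (quat w y) = of_real (2 * w)"
  by (simp add: trace_def sum_2 quat_entries complex_eq_iff)

lemma tau_quat: "tau i = quat 0 (axis i 1)"
proof -
  have "tv (axis i 1) = (\<Sum>j\<in>UNIV. if j = i then tau i else 0)"
    unfolding tv_def by (rule sum.cong) (auto simp: axis_def)
  then show ?thesis by (simp add: tv_quat)
qed

lemma tv_axis: "tv (axis i 1) = tau i"
  by (simp add: tau_quat tv_quat)

lemma tv_add: "tv (y + z) = tv y + tv z"
  by (simp add: tv_quat quat_add)

lemma tv_scaleR: "tv (c *\<^sub>R y) = c *\<^sub>R tv y"
  by (simp add: tv_quat quat_scaleR)

lemma tv_uminus: "tv (- y) = - tv y"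
  using tv_scaleR[of "-1" y] by simp

lemma tv_inject: "tv y = tv z \<longleftrightarrow> y = z"
  by (simp add: tv_quat quat_eq_iff)

lemma tv_0 [simp]: "tv 0 = 0"
  by (simp add: tv_def)

lemma su2_algebra_tv: "su2_algebra x = (1 / 2) *\<^sub>R tv x"
  by (simp add: su2_algebra_def tv_def scaleR_sum_right)

lemma matrix_add_mult: "((A :: cmat2) + B) ** C = A ** C + B ** C"
  by (simp add: vec_eq_iff matrix_matrix_mult_def sum.distrib distrib_right)

lemma matrix_mult_add: "C ** ((A :: cmat2) + B) = C ** A + C ** B"
  by (simp add: vec_eq_iff matrix_matrix_mult_def sum.distrib distrib_left)

lemma matrix_scaleR_mult: "(c *\<^sub>R (A :: cmat2)) ** B = c *\<^sub>R (A ** B)"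
  by (simp add: vec_eq_iff matrix_matrix_mult_def scaleR_sum_right)

lemma matrix_uminus_mult: "(- (A :: cmat2)) ** B = - (A ** B)"
  and matrix_mult_uminus: "A ** (- B) = - ((A :: cmat2) ** B)"
  using matrix_scaleR_mult[of "-1" A B] matrix_mul_scaleR_right[of A "-1" B] by simp_all

lemma matrix_diff_mult: "((A :: cmat2) - B) ** C = A ** C - B ** C"
  and matrix_mult_diff: "C ** (A - B) = C ** A - C ** (B :: cmat2)"
  using matrix_add_mult[of A "- B" C] matrix_mult_add[of C A "- B"]
  by (simp_all add: matrix_uminus_mult matrix_mult_uminus)

lemma cross_inner: "(y \<times> p) \<bullet> f = y \<bullet> (p \<times> f)"
  by (simp add: cross3_simps)

lemma bounded_bilinear_cmat2_mult: "bounded_bilinear ((**) :: cmat2 \<Rightarrow> cmat2 \<Rightarrow> cmat2)"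
proof -
  have "bilinear ((**) :: cmat2 \<Rightarrow> cmat2 \<Rightarrow> cmat2)"
    unfolding bilinear_def
    by (auto intro!: linearI simp: matrix_add_mult matrix_mult_add matrix_scaleR_mult
        matrix_mul_scaleR_right)
  then show ?thesis
    by (simp add: bilinear_conv_bounded_bilinear)
qed

lemma bounded_linear_tv: "bounded_linear tv"
  by (rule linear_conv_bounded_linear[THEN iffD1], rule linearI) (simp_all add: tv_add tv_scaleR)

lemma bounded_linear_adj: "bounded_linear adj"
  by (rule linear_conv_bounded_linear[THEN iffD1], rule linearI)
    (simp_all add: adj_def transpose_def vec_eq_iff complex_eq_iff)

lemma adj_mult: "adj (A ** B) = adj B ** adj A" for A B :: cmat2
  by (simp add: adj_def vec_eq_iff matrix_matrix_mult_def transpose_def mult.commute)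

lemma adj_scaleR: "adj (c *\<^sub>R A) = c *\<^sub>R adj A"
  by (simp add: adj_def transpose_def vec_eq_iff complex_eq_iff)

lemma adj_tv: "adj (tv y) = - tv y"
  using tv_uminus[of y] by (simp add: tv_quat adj_quat)

lemma trace_scaleR: "trace (c *\<^sub>R (A :: cmat2)) = c *\<^sub>R trace A"
  by (simp add: trace_def scaleR_sum_right)

lemma trace_conj:
  fixes g k A :: cmat2
  assumes "k ** g = mat 1"
  shows "trace (g ** A ** k) = trace A"
proof -
  have "trace (g ** A ** k) = trace (k ** (g ** A))"
    by (rule trace_mul_sym)
  also have "\<dots> = trace A"
    by (simp add: matrix_mul_assoc assms)
  finally show ?thesis .
qed

lemma quat_mult_adj: "quat w y ** adj (quat w y) = quat (w\<^sup>2 + y \<bullet> y) 0"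
  by (simp add: adj_quat quat_mult quat_eq_iff power2_eq_square)

lemma det_quat: "det (quat w y) = of_real (w\<^sup>2 + y \<bullet> y)"
  by (simp add: det_2 quat_entries complex_eq_iff inner_vec_def sum_3 power2_eq_square algebra_simps)

lemma su2_mat_unit: "su2_mat h ** adj (su2_mat h) = mat 1" "det (su2_mat h) = 1"
  using su2_mat[of h] by auto

lemma su2_mat_unit': "adj (su2_mat h) ** su2_mat h = mat 1"
  using su2_mat_unit(1) matrix_left_right_inverse by blast

lemma su2_quat_ex: "w\<^sup>2 + y \<bullet> y = 1 \<Longrightarrow> \<exists>h. su2_mat h = quat w y"
  by (rule exI[of _ "Abs_su2 (quat w y)"], rule Abs_su2_inverse)
    (simp add: quat_mult_adj det_quat mat1_quat)

text \<open>For determinant 1 the inverse is the adjugate \<open>B\<close>, for a unitary matrix it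
  is the adjoint. Equating the two leaves four real parameters.\<close>

lemma su2_quat:
  obtains w y where "su2_mat h = quat w y" "w\<^sup>2 + y \<bullet> y = 1"
proof -
  define A where "A = su2_mat h"
  have U: "adj A ** A = mat 1" "det A = 1"
    by (simp_all add: A_def su2_mat_unit su2_mat_unit')
  define B :: cmat2 where "B = vector [vector [A$2$2, - A$1$2], vector [- A$2$1, A$1$1]]"
  have AB: "A ** B = mat 1"
    using U(2) by (intro cmat2_eqI) (simp_all add: B_def matrix_matrix_mult_def sum_2 det_2 mat_def mult.commute)
  have "adj A = adj A ** (A ** B)"
    by (simp add: AB)
  also have "\<dots> = B"
    by (simp add: matrix_mul_assoc U)
  finally have E: "adj A = B" .
  have e: "cnj (A$1$1) = A$2$2" "cnj (A$2$1) = - A$1$2" "cnj (A$1$2) = - A$2$1"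
    using E by (auto simp: vec_eq_iff forall_2 adj_def transpose_def B_def)
  define w y where "w = Re (A$1$1)" and "y = (vector [- Im (A$1$2), Re (A$2$1), Im (A$2$2)] :: real^3)"
  have A: "A = quat w y"
    using e by (intro cmat2_eqI) (simp_all add: quat_entries w_def y_def complex_eq_iff)
  moreover have "w\<^sup>2 + y \<bullet> y = 1"
    using U(2) unfolding A det_quat of_real_eq_1_iff .
  ultimately show ?thesis
    using that by (simp add: A_def)
qed

section \<open>The group SU(2)\<close>

lift_definition su2_inv :: "su2 \<Rightarrow> su2" is adj
proof -
  fix A :: cmat2
  assume A: "A ** adj A = mat 1 \<and> det A = 1"
  have "adj (adj A) = A"
    by (simp add: adj_def transpose_def vec_eq_iff)
  moreover have "adj A ** A = mat 1"
    using A matrix_left_right_inverse by blast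
  moreover from this have "det (adj A) * det A = 1"
    by (metis det_I det_mul)
  ultimately show "adj A ** adj (adj A) = mat 1 \<and> det (adj A) = 1"
    using A by simp
qed

lift_definition su2_one :: su2 is "mat 1"
  by (simp add: adj_def vec_eq_iff matrix_matrix_mult_def forall_2 sum_2 transpose_def mat_def det_2)

lemma su2_mat_inv: "su2_mat (su2_inv h) = matrix_inv (su2_mat h)"
proof -
  have "\<exists>B. su2_mat h ** B = mat 1 \<and> B ** su2_mat h = mat 1"
    using su2_mat_unit su2_mat_unit' by blast
  then have I: "su2_mat h ** matrix_inv (su2_mat h) = mat 1"
    unfolding matrix_inv_def by (rule someI2_ex) blast
  have "adj (su2_mat h) = adj (su2_mat h) ** (su2_mat h ** matrix_inv (su2_mat h))"
    by (simp add: I)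
  also have "\<dots> = matrix_inv (su2_mat h)"
    by (simp add: matrix_mul_assoc su2_mat_unit')
  finally show ?thesis
    by (simp add: su2_inv.rep_eq)
qed

lemma matrix_inv_su2: "matrix_inv (su2_mat h) = adj (su2_mat h)"
  by (simp add: su2_inv.rep_eq flip: su2_mat_inv)

lemma adj_adj_su2: "adj (adj (su2_mat h)) = su2_mat h"
  by (simp add: adj_def transpose_def vec_eq_iff)

lemma su2_eqI: "su2_mat g = su2_mat h \<Longrightarrow> g = h"
  by (simp add: su2_mat_inject)

lemma su2_mult_assoc: "su2_times (su2_times g h) k = su2_times g (su2_times h k)"
  by (rule su2_eqI) (simp add: su2_times.rep_eq matrix_mul_assoc)

lemma su2_one [simp]: "su2_times su2_one h = h" "su2_times h su2_one = h"
  by (rule su2_eqI, simp add: su2_times.rep_eq su2_one.rep_eq)+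

lemma su2_inv [simp]: "su2_times (su2_inv h) h = su2_one" "su2_times h (su2_inv h) = su2_one"
  by (rule su2_eqI, simp add: su2_times.rep_eq su2_one.rep_eq su2_inv.rep_eq su2_mat_unit su2_mat_unit')+

lemma su2_inv_left [simp]: "su2_times (su2_inv h) (su2_times h k) = k" "su2_times h (su2_times (su2_inv h) k) = k"
  by (simp_all flip: su2_mult_assoc)

lemma su2_inv_unique: "su2_times g h = su2_one \<Longrightarrow> su2_inv h = g"
  by (metis su2_inv(2) su2_mult_assoc su2_one)

lemma su2_inv_inv [simp]: "su2_inv (su2_inv h) = h"
  by (rule su2_inv_unique) simp

lemma su2_inv_times: "su2_inv (su2_times g h) = su2_times (su2_inv h) (su2_inv g)"
  by (rule su2_inv_unique) (simp add: su2_mult_assoc)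

subsection \<open>The adjoint representation\<close>

text \<open>The factor -1/2 undoes Tr(tau_i tau_j) = -2 delta_ij, so the components of the
  conjugated matrix in the basis \<open>tau\<close> are read off.\<close>

definition Ad :: "su2 \<Rightarrow> real^3 \<Rightarrow> real^3" where
  "Ad h y = (\<chi> i. - 1 / 2 * Re (trace (tau i ** su2_mat h ** tv y ** adj (su2_mat h))))"

lemma tv_Ad: "tv (Ad h y) = su2_mat h ** tv y ** adj (su2_mat h)"
proof -
  obtain w v where h: "su2_mat h = quat w v" "w\<^sup>2 + v \<bullet> v = 1"
    by (rule su2_quat)
  obtain r z where rz: "su2_mat h ** tv y ** adj (su2_mat h) = quat r z"
    by (simp add: h tv_quat adj_quat quat_mult)
  have "r = 0"
    using rz by (auto simp: h tv_quat adj_quat quat_mult quat_eq_iff inner_add_left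
        inner_add_right dot_cross_self inner_commute)
  moreover have "Ad h y $ i = z $ i" for i
    using rz by (simp add: Ad_def tau_quat quat_mult trace_quat inner_axis'
        flip: matrix_mul_assoc)
  then have "Ad h y = z"
    by (simp add: vec_eq_iff)
  ultimately show ?thesis
    using rz by (simp add: tv_quat)
qed

lemma Ad_eqI: "su2_mat h ** tv y ** adj (su2_mat h) = tv z \<Longrightarrow> Ad h y = z"
  by (simp add: tv_inject flip: tv_Ad)

lemma Ad_add: "Ad h (y + z) = Ad h y + Ad h z"
  by (rule Ad_eqI) (simp add: tv_add tv_Ad matrix_add_mult matrix_mult_add)

lemma Ad_scaleR: "Ad h (c *\<^sub>R y) = c *\<^sub>R Ad h y"
  by (rule Ad_eqI) (simp add: tv_scaleR tv_Ad matrix_scaleR_mult matrix_mul_scaleR_right)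

lemma linear_Ad: "linear (Ad h)"
  by (rule linearI) (simp_all add: Ad_add Ad_scaleR)

lemma Ad_uminus: "Ad h (- y) = - Ad h y"
  using Ad_scaleR[of h "-1" y] by simp

lemma Ad_diff: "Ad h (y - z) = Ad h y - Ad h z"
  using Ad_add[of h y "- z"] by (simp add: Ad_uminus)

lemma Ad_0 [simp]: "Ad h 0 = 0"
  using Ad_scaleR[of h 0 0] by simp

lemma Ad_times: "Ad (su2_times g h) y = Ad g (Ad h y)"
  by (rule Ad_eqI) (simp add: tv_Ad su2_times.rep_eq adj_mult matrix_mul_assoc)

lemma Ad_one [simp]: "Ad su2_one y = y"
  by (rule Ad_eqI) (simp add: su2_one.rep_eq mat1_quat adj_quat quat_mult tv_quat quat_eq_iff)

lemma Ad_inv [simp]: "Ad (su2_inv h) (Ad h y) = y" "Ad h (Ad (su2_inv h) y) = y"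
  by (simp_all flip: Ad_times)

lemma tv_mult: "tv y ** tv z = quat (- (y \<bullet> z)) (y \<times> z)"
  by (simp add: tv_quat quat_mult)

lemma Ad_mult: "tv (Ad h y) ** tv (Ad h z) = su2_mat h ** (tv y ** tv z) ** adj (su2_mat h)"
proof -
  have "tv (Ad h y) ** tv (Ad h z)
      = su2_mat h ** tv y ** (adj (su2_mat h) ** su2_mat h) ** tv z ** adj (su2_mat h)"
    by (simp only: tv_Ad matrix_mul_assoc)
  then show ?thesis
    by (simp add: su2_mat_unit' matrix_mul_assoc)
qed

lemma quat_conj: "su2_mat h ** quat w y ** adj (su2_mat h) = quat w (Ad h y)"
proof -
  have "su2_mat h ** quat w y ** adj (su2_mat h) = w *\<^sub>R mat 1 + tv (Ad h y)"
    by (simp add: quat_def matrix_add_mult matrix_mult_add tv_Ad matrix_scaleR_mult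
        matrix_mul_scaleR_right su2_mat_unit)
  then show ?thesis
    by (simp add: quat_def)
qed

text \<open>Both come from a single product: \<open>tv y ** tv z\<close> has minus the dot product
  as scalar part and the cross product as vector part, and conjugation leaves the former alone and
  rotates the latter.\<close>

lemma Ad_inner: "Ad h y \<bullet> Ad h z = y \<bullet> z" and Ad_cross: "Ad h y \<times> Ad h z = Ad h (y \<times> z)"
  using Ad_mult[of h y z] by (simp_all add: tv_mult quat_conj quat_eq_iff)

lemma Ad_norm: "norm (Ad h y) = norm y"
  by (simp add: norm_eq_sqrt_inner Ad_inner)

lemma inner_Ad: "Ad h y \<bullet> z = y \<bullet> Ad (su2_inv h) z"
  by (metis Ad_inner Ad_inv(2))

lemma su2_exp_quat: "su2_mat (su2_exp x) = quat (cos (norm x / 2)) ((sin (norm x / 2) / norm x) *\<^sub>R x)"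
  by (simp only: su2_exp.rep_eq mexp_su2_algebra) (simp add: su2_algebra_tv quat_def tv_scaleR)

lemma su2_exp_Ad: "su2_exp (Ad g x) = su2_times g (su2_times (su2_exp x) (su2_inv g))"
  by (rule su2_eqI)
    (simp add: su2_times.rep_eq su2_inv.rep_eq matrix_mul_assoc su2_exp_quat quat_conj Ad_norm Ad_scaleR)

text \<open>The quotient of sin(|\<theta>|/2) by |\<theta>| is even in \<theta>, so the absolute
  value coming from the norm disappears.\<close>

lemma su2_exp_axis: "su2_mat (su2_exp (\<theta> *\<^sub>R axis I 1)) = quat (cos (\<theta> / 2)) (sin (\<theta> / 2) *\<^sub>R axis I 1)"
proof (cases "\<theta> = 0")
  case False
  then show ?thesis
    by (cases "\<theta> > 0") (simp_all add: su2_exp_quat quat_eq_iff abs_if divide_simps)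
qed (simp add: su2_exp_quat quat_eq_iff)

lemma su2_exp_uminus: "su2_exp (- x) = su2_inv (su2_exp x)"
  by (rule su2_eqI) (simp add: su2_inv.rep_eq su2_exp_quat adj_quat)

text \<open>A rotation fixes its own axis; this is why reversing an edge of homogeneous data only
  flips the sign of its flux.\<close>

lemma Ad_exp_axis: "Ad (su2_exp (\<theta> *\<^sub>R axis I 1)) (axis I 1) = axis I 1"
proof (rule Ad_eqI)
  have "(su2_mat (su2_exp (\<theta> *\<^sub>R axis I 1))) ** tv (axis I 1) = tv (axis I 1) ** su2_mat (su2_exp (\<theta> *\<^sub>R axis I 1))"
    by (simp add: su2_exp_axis tv_quat quat_mult quat_eq_iff cross_mult_left cross_mult_right)
  then show "su2_mat (su2_exp (\<theta> *\<^sub>R axis I 1)) ** tv (axis I 1) ** adj (su2_mat (su2_exp (\<theta> *\<^sub>R axis I 1)))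
      = tv (axis I 1)"
    by (simp add: su2_mat_unit flip: matrix_mul_assoc)
qed

section \<open>Smooth functions on phase space\<close>

text \<open>The algebra of all functions generated by the coordinates, with positive functions also
  admitting real powers. It is closed under the left invariant derivations, and the chain rule
  can be proved by induction on the generation of a function, so that no manifold structure on the
  phase space is needed.\<close>

inductive smooth :: "'l::nontriv phase set \<Rightarrow> ('l phase \<Rightarrow> real) \<Rightarrow> bool" for U where
  smooth_const: "smooth U (\<lambda>_. c)"
| smooth_hol: "f \<in> {Re, Im} \<Longrightarrow> smooth U (\<lambda>x. f (su2_mat (fst x e) $ r $ s))"
| smooth_flux: "smooth U (\<lambda>x. snd x e $ i)"
| smooth_add: "smooth U F \<Longrightarrow> smooth U G \<Longrightarrow> smooth U (\<lambda>x. F x + G x)"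
| smooth_mult: "smooth U F \<Longrightarrow> smooth U G \<Longrightarrow> smooth U (\<lambda>x. F x * G x)"
| smooth_powr: "smooth U F \<Longrightarrow> (\<And>x. x \<in> U \<Longrightarrow> F x > 0) \<Longrightarrow> smooth U (\<lambda>x. F x powr r)"
| smooth_cong: "smooth U F \<Longrightarrow> (\<And>x. x \<in> U \<Longrightarrow> F x = G x) \<Longrightarrow> smooth U G"

lemma smooth_uminus: "smooth U F \<Longrightarrow> smooth U (\<lambda>x. - F x)"
  using smooth_mult[OF smooth_const[of U "-1"]] by simp

lemma smooth_diff: "smooth U F \<Longrightarrow> smooth U G \<Longrightarrow> smooth U (\<lambda>x. F x - G x)"
  using smooth_add[of U F "\<lambda>x. - G x"] smooth_uminus[of U G] by simp

lemma smooth_sum: "(\<And>i. i \<in> A \<Longrightarrow> smooth U (F i)) \<Longrightarrow> smooth U (\<lambda>x. \<Sum>i\<in>A. F i x)"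
  by (induction A rule: infinite_finite_induct) (auto intro: smooth_const smooth_add)

lemma smooth_power: "smooth U F \<Longrightarrow> smooth U (\<lambda>x. F x ^ n)"
  by (induction n) (auto intro: smooth_const smooth_mult)

lemma smooth_sqrt:
  assumes "smooth U F" "\<And>x. x \<in> U \<Longrightarrow> F x > 0"
  shows "smooth U (\<lambda>x. sqrt (F x))"
  by (rule smooth_cong[OF smooth_powr[OF assms, of "1/2"]]) (auto simp: powr_half_sqrt less_imp_le assms)

lemma smooth_mono: "smooth U F \<Longrightarrow> V \<subseteq> U \<Longrightarrow> smooth V F"
proof (induction rule: smooth.induct)
  case (smooth_powr F r)
  then show ?case by (auto intro!: smooth.smooth_powr)
next
  case (smooth_cong F G)
  then show ?case by (blast intro: smooth.smooth_cong)
qed (auto intro: smooth_const smooth_hol smooth_flux smooth_add smooth_mult)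

definition msmooth :: "'l::nontriv phase set \<Rightarrow> ('l phase \<Rightarrow> cmat2) \<Rightarrow> bool" where
  "msmooth U M \<longleftrightarrow> (\<forall>r s. smooth U (\<lambda>x. Re (M x $ r $ s)) \<and> smooth U (\<lambda>x. Im (M x $ r $ s)))"

lemma msmooth_const: "msmooth U (\<lambda>_. A)"
  by (simp add: msmooth_def smooth_const)

lemma msmooth_hol: "msmooth U (\<lambda>x. su2_mat (fst x e))"
  by (simp add: msmooth_def smooth_hol)

lemma msmooth_mult: "msmooth U M \<Longrightarrow> msmooth U M' \<Longrightarrow> msmooth U (\<lambda>x. M x ** M' x)"
  by (auto simp: msmooth_def matrix_matrix_mult_def sum_2
      intro!: smooth_add smooth_diff smooth_mult)

lemma msmooth_add: "msmooth U M \<Longrightarrow> msmooth U M' \<Longrightarrow> msmooth U (\<lambda>x. M x + M' x)"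
  by (auto simp: msmooth_def intro!: smooth_add)

lemma msmooth_scaleR: "smooth U f \<Longrightarrow> msmooth U M \<Longrightarrow> msmooth U (\<lambda>x. f x *\<^sub>R M x)"
  by (auto simp: msmooth_def intro!: smooth_mult)

lemma msmooth_tv: "(\<And>i. smooth U (\<lambda>x. y x $ i)) \<Longrightarrow> msmooth U (\<lambda>x. tv (y x))"
  by (simp add: tv_def sum_3) (intro msmooth_add msmooth_scaleR msmooth_const; simp)

lemma msmooth_adj: "msmooth U M \<Longrightarrow> msmooth U (\<lambda>x. adj (M x))"
  by (auto simp: msmooth_def adj_def transpose_def intro!: smooth_uminus)

lemma smooth_trace: "msmooth U M \<Longrightarrow> smooth U (\<lambda>x. Re (trace (M x)))"
  by (auto simp: msmooth_def trace_def sum_2 intro!: smooth_add)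

lemma smooth_Ad:
  assumes "msmooth U (\<lambda>x. su2_mat (h x))" "\<And>i. smooth U (\<lambda>x. y x $ i)"
  shows "smooth U (\<lambda>x. Ad (h x) (y x) $ i)"
  unfolding Ad_def vec_lambda_beta
  by (intro smooth_mult smooth_const smooth_trace msmooth_mult msmooth_const msmooth_tv msmooth_adj assms)

subsection \<open>Tangent vectors and the chain rule\<close>

text \<open>\<open>u\<close> and \<open>w\<close> are the coefficients of the velocity with respect
  to the derivations \<open>hol_deriv\<close> and \<open>flux_deriv\<close>; hence the factor 1/2
  and the multiplication from the left.\<close>

definition tangent ::
  "(real \<Rightarrow> 'l::nontriv phase) \<Rightarrow> 'l phase \<Rightarrow> ('l edge \<Rightarrow> real^3) \<Rightarrow> ('l edge \<Rightarrow> real^3) \<Rightarrow> bool" where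
  "tangent \<gamma> x u w \<longleftrightarrow> \<gamma> 0 = x \<and> (\<forall>e.
     ((\<lambda>t. su2_mat (fst (\<gamma> t) e)) has_vector_derivative (1 / 2) *\<^sub>R (tv (u e) ** su2_mat (fst x e))) (at 0)
     \<and> ((\<lambda>t. snd (\<gamma> t) e) has_vector_derivative w e) (at 0))"

text \<open>\<open>smooth_cong\<close> allows changes off \<open>U\<close>, so derivatives at points
  of \<open>U\<close> are controlled only if curves remain in \<open>U\<close> for a while. Testing
  openness on differentiable curves replaces a topology on phase space.\<close>

definition open_along :: "'l::nontriv phase set \<Rightarrow> bool" where
  "open_along U \<longleftrightarrow> (\<forall>x\<in>U. \<forall>\<gamma> u w. tangent \<gamma> x u w \<longrightarrow> (\<forall>\<^sub>F t in at 0. \<gamma> t \<in> U))"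

lemma open_along_UNIV: "open_along UNIV"
  by (simp add: open_along_def)

lemma has_vector_derivative_component:
  "(f has_vector_derivative f') F \<Longrightarrow> ((\<lambda>t. f t $ i) has_vector_derivative f' $ i) F"
  by (rule bounded_linear.has_vector_derivative[OF bounded_linear_vec_nth])

text \<open>One pair \<open>a\<close>, \<open>b\<close> has to serve all curves through
  \<open>x\<close>; partial derivatives alone would not give a chain rule for the images of curves
  under symmetries.\<close>

definition has_grad ::
  "('l::nontriv phase \<Rightarrow> real) \<Rightarrow> 'l phase \<Rightarrow> ('l edge \<Rightarrow> real^3) \<Rightarrow> ('l edge \<Rightarrow> real^3) \<Rightarrow> bool" where
  "has_grad F x a b \<longleftrightarrow> (\<forall>\<gamma> u w. tangent \<gamma> x u w \<longrightarrow>
    ((\<lambda>t. F (\<gamma> t)) has_real_derivative (\<Sum>e\<in>UNIV. u e \<bullet> a e + w e \<bullet> b e)) (at 0))"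

lemma has_gradI:
  "(\<And>\<gamma> u w. tangent \<gamma> x u w \<Longrightarrow>
    ((\<lambda>t. F (\<gamma> t)) has_real_derivative (\<Sum>e\<in>UNIV. u e \<bullet> a e + w e \<bullet> b e)) (at 0))
  \<Longrightarrow> \<exists>a b. has_grad F x a b"
  by (auto simp: has_grad_def)

lemma has_gradD:
  "has_grad F x a b \<Longrightarrow> tangent \<gamma> x u w \<Longrightarrow>
    ((\<lambda>t. F (\<gamma> t)) has_real_derivative (\<Sum>e\<in>UNIV. u e \<bullet> a e + w e \<bullet> b e)) (at 0)"
  by (simp add: has_grad_def)

text \<open>Each generator has an explicit gradient and each operation has a differentiation rule.
  Only congruence uses openness: the curve stays where the two functions agree.\<close>

lemma smooth_ex_grad:
  assumes "smooth U F" "open_along U" "x \<in> U"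
  shows "\<exists>a b. has_grad F x a b"
  using assms
proof (induction rule: smooth.induct)
  case (smooth_const c)
  show ?case
    by (rule has_gradI[of _ _ "\<lambda>_. 0" "\<lambda>_. 0"]) simp
next
  case (smooth_hol f e r s)
  then interpret f: bounded_linear f
    by (auto simp: bounded_linear_Re bounded_linear_Im)
  \<comment> \<open>The derivative of a matrix entry is linear in the velocity \<open>u e\<close>;
    these are its coefficients in the basis \<open>tau\<close>.\<close>
  define a where "a = (\<lambda>e'. if e' = e
    then (\<chi> i. f (((1 / 2) *\<^sub>R (tau i ** su2_mat (fst x e))) $ r $ s)) else 0 :: real^3)"
  have "((\<lambda>t. f (su2_mat (fst (\<gamma> t) e) $ r $ s)) has_real_derivative (\<Sum>e'\<in>UNIV. u e' \<bullet> a e' + w e' \<bullet> 0)) (at 0)"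
    if "tangent \<gamma> x u w" for \<gamma> u w
  proof -
    have "(\<Sum>e'\<in>UNIV. u e' \<bullet> a e') = (\<Sum>e'\<in>UNIV. if e' = e then u e \<bullet> a e else 0)"
      by (rule sum.cong) (auto simp: a_def)
    also have "\<dots> = f (((1 / 2) *\<^sub>R (tv (u e) ** su2_mat (fst x e))) $ r $ s)"
      by (simp add: a_def inner_vec_def tv_def sum_3 matrix_add_mult matrix_scaleR_mult f.add f.scaleR algebra_simps)
    moreover have "((\<lambda>t. f (su2_mat (fst (\<gamma> t) e) $ r $ s)) has_vector_derivative
        f (((1 / 2) *\<^sub>R (tv (u e) ** su2_mat (fst x e))) $ r $ s)) (at 0)"
      using that unfolding tangent_def
      by (intro bounded_linear.has_vector_derivative[OF f.bounded_linear_axioms] has_vector_derivative_component) blast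
    ultimately show ?thesis
      by (simp add: has_real_derivative_iff_has_vector_derivative)
  qed
  then show ?case by (rule has_gradI)
next
  case (smooth_flux e i)
  define b where "b = (\<lambda>e'. if e' = e then axis i 1 else 0 :: real^3)"
  have "((\<lambda>t. snd (\<gamma> t) e $ i) has_real_derivative (\<Sum>e'\<in>UNIV. u e' \<bullet> 0 + w e' \<bullet> b e')) (at 0)"
    if "tangent \<gamma> x u w" for \<gamma> u w
  proof -
    have "(\<Sum>e'\<in>UNIV. w e' \<bullet> b e') = (\<Sum>e'\<in>UNIV. if e' = e then w e $ i else 0)"
      by (rule sum.cong) (auto simp: b_def inner_axis)
    moreover have "((\<lambda>t. snd (\<gamma> t) e $ i) has_vector_derivative w e $ i) (at 0)"
      using that unfolding tangent_def by (intro has_vector_derivative_component) blast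
    ultimately show ?thesis
      by (simp add: has_real_derivative_iff_has_vector_derivative)
  qed
  then show ?case by (rule has_gradI)
next
  case (smooth_add F G)
  then obtain a b a' b' where
    "has_grad F x a b" "has_grad G x a' b'"
    by blast
  note F = has_gradD[OF this(1)] and G = has_gradD[OF this(2)]
  have "((\<lambda>t. F (\<gamma> t) + G (\<gamma> t)) has_real_derivative
      (\<Sum>e\<in>UNIV. u e \<bullet> (a e + a' e) + w e \<bullet> (b e + b' e))) (at 0)" if "tangent \<gamma> x u w" for \<gamma> u w
    using DERIV_add[OF F[OF that] G[OF that]] by (simp add: inner_add_right sum.distrib algebra_simps)
  then show ?case by (rule has_gradI)
next
  case (smooth_mult F G)
  then obtain a b a' b' where
    "has_grad F x a b" "has_grad G x a' b'"
    by blast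
  note F = has_gradD[OF this(1)] and G = has_gradD[OF this(2)]
  have "((\<lambda>t. F (\<gamma> t) * G (\<gamma> t)) has_real_derivative
      (\<Sum>e\<in>UNIV. u e \<bullet> (G x *\<^sub>R a e + F x *\<^sub>R a' e) + w e \<bullet> (G x *\<^sub>R b e + F x *\<^sub>R b' e))) (at 0)"
    if "tangent \<gamma> x u w" for \<gamma> u w
    using DERIV_mult[OF F[OF that] G[OF that]] that
    by (simp add: tangent_def inner_add_right sum.distrib sum_distrib_left sum_distrib_right algebra_simps)
  then show ?case by (rule has_gradI)
next
  case (smooth_powr F r)
  then obtain a b where "has_grad F x a b"
    by blast
  note F = has_gradD[OF this]
  let ?k = "r * F x powr (r - 1)"
  have "((\<lambda>t. F (\<gamma> t) powr r) has_real_derivative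
      (\<Sum>e\<in>UNIV. u e \<bullet> (?k *\<^sub>R a e) + w e \<bullet> (?k *\<^sub>R b e))) (at 0)"
    if "tangent \<gamma> x u w" for \<gamma> u w
  proof -
    have "\<gamma> 0 = x" "F x > 0"
      using that smooth_powr by (auto simp: tangent_def)
    then show ?thesis
      using DERIV_fun_powr[OF F[OF that], of r]
      by (simp add: sum_distrib_left sum_distrib_right algebra_simps)
  qed
  then show ?case by (rule has_gradI)
next
  case (smooth_cong F G)
  then obtain a b where "has_grad F x a b"
    by blast
  note F = has_gradD[OF this]
  have "((\<lambda>t. G (\<gamma> t)) has_real_derivative (\<Sum>e\<in>UNIV. u e \<bullet> a e + w e \<bullet> b e)) (at 0)"
    if T: "tangent \<gamma> x u w" for \<gamma> u w
  proof -
    have g: "\<gamma> 0 = x" "\<forall>\<^sub>F t in at 0. \<gamma> t \<in> U"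
      using T smooth_cong.prems by (auto simp: tangent_def open_along_def)
    have "\<forall>\<^sub>F t in at 0. F (\<gamma> t) = G (\<gamma> t)"
      using g(2) by (rule eventually_mono) (rule smooth_cong.hyps(2))
    moreover have "F (\<gamma> 0) = G (\<gamma> 0)"
      unfolding g(1) using smooth_cong.prems(2) by (rule smooth_cong.hyps(2))
    ultimately show ?thesis
      using F[OF T] by (subst (asm) has_field_derivative_cong_eventually) auto
  qed
  then show ?case by (rule has_gradI)
qed

section \<open>Coordinate curves and partial derivatives\<close>

definition flux_curve :: "'l::nontriv phase \<Rightarrow> 'l edge \<Rightarrow> 3 \<Rightarrow> real \<Rightarrow> 'l phase" where
  "flux_curve x e i t = (fst x, (snd x)(e := snd x e + t *\<^sub>R axis i 1))"

definition hol_curve :: "'l::nontriv phase \<Rightarrow> 'l edge \<Rightarrow> 3 \<Rightarrow> real \<Rightarrow> 'l phase" where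
  "hol_curve x e i t = ((fst x)(e := su2_times (su2_exp (t *\<^sub>R axis i 1)) (fst x e)), snd x)"

lemma flux_deriv_curve: "flux_deriv e i F x = vector_derivative (\<lambda>t. F (flux_curve x e i t)) (at 0)"
  and hol_deriv_curve: "hol_deriv e i F x = vector_derivative (\<lambda>t. F (hol_curve x e i t)) (at 0)"
  by (simp_all add: flux_deriv_def hol_deriv_def flux_curve_def hol_curve_def split_beta)

lemma has_vector_derivative_affine: "((\<lambda>t. y + t *\<^sub>R z) has_vector_derivative z) (at 0)"
  by (auto intro!: derivative_eq_intros)

lemma has_vector_derivative_exp_axis:
  "((\<lambda>t. su2_mat (su2_times (su2_exp (t *\<^sub>R axis i 1)) h)) has_vector_derivative
     (1 / 2) *\<^sub>R (tau i ** su2_mat h)) (at 0)"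
proof -
  have E: "su2_mat (su2_times (su2_exp (t *\<^sub>R axis i 1)) h)
      = cos (t / 2) *\<^sub>R su2_mat h + sin (t / 2) *\<^sub>R (tau i ** su2_mat h)" for t
    by (simp add: su2_times.rep_eq su2_exp_axis quat_def tv_scaleR tv_axis matrix_add_mult matrix_scaleR_mult)
  show ?thesis
    unfolding E
    by (auto intro!: derivative_eq_intros simp: has_real_derivative_iff_has_vector_derivative[symmetric])
qed

lemma tangent_flux_curve: "tangent (flux_curve x e i) x (\<lambda>_. 0) ((\<lambda>_. 0)(e := axis i 1))"
  by (auto simp: tangent_def flux_curve_def tv_def has_vector_derivative_affine)

lemma tangent_hol_curve: "tangent (hol_curve x e i) x ((\<lambda>_. 0)(e := axis i 1)) (\<lambda>_. 0)"
proof -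
  have "hol_curve x e i 0 = x"
    by (auto simp: hol_curve_def prod_eq_iff su2_mat_inject[symmetric] su2_times.rep_eq
        su2_exp_quat simp flip: mat1_quat)
  then show ?thesis
    by (auto simp: tangent_def hol_curve_def tv_axis has_vector_derivative_exp_axis)
qed

definition fgrad :: "('l::nontriv phase \<Rightarrow> real) \<Rightarrow> 'l phase \<Rightarrow> 'l edge \<Rightarrow> real^3" where
  "fgrad F x e = (\<chi> i. flux_deriv e i F x)"

definition hgrad :: "('l::nontriv phase \<Rightarrow> real) \<Rightarrow> 'l phase \<Rightarrow> 'l edge \<Rightarrow> real^3" where
  "hgrad F x e = (\<chi> i. hol_deriv e i F x)"

lemma vector_derivative_real: "(f has_real_derivative D) (at t) \<Longrightarrow> vector_derivative f (at t) = D"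
  by (simp add: has_real_derivative_iff_has_vector_derivative vector_derivative_at)

text \<open>A gradient exists abstractly; evaluating it on the coordinate curves identifies it with
  the partial derivatives.\<close>

lemma smooth_chain:
  assumes "smooth U F" "open_along U" "x \<in> U" "tangent \<gamma> x u w"
  shows "((\<lambda>t. F (\<gamma> t)) has_real_derivative (\<Sum>e\<in>UNIV. u e \<bullet> hgrad F x e + w e \<bullet> fgrad F x e)) (at 0)"
proof -
  obtain a b where "has_grad F x a b"
    using smooth_ex_grad[OF assms(1-3)] by blast
  note ab = has_gradD[OF this]
  have S: "(\<Sum>e'\<in>UNIV. (if e' = e then y else 0) \<bullet> c e') = y \<bullet> c e" for e :: "'a edge" and c and y :: "real^3"
  proof -
    have "(\<Sum>e'\<in>UNIV. (if e' = e then y else 0) \<bullet> c e') = (\<Sum>e'\<in>UNIV. if e' = e then y \<bullet> c e else 0)"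
      by (rule sum.cong) auto
    then show ?thesis by simp
  qed
  have "fgrad F x e = b e" for e
    using vector_derivative_real[OF ab[OF tangent_flux_curve[of x e]]]
    by (simp add: vec_eq_iff fgrad_def flux_deriv_curve S inner_axis')
  moreover have "hgrad F x e = a e" for e
    using vector_derivative_real[OF ab[OF tangent_hol_curve[of x e]]]
    by (simp add: vec_eq_iff hgrad_def hol_deriv_curve S inner_axis')
  ultimately show ?thesis
    using ab[OF assms(4)] by simp
qed

lemma smooth_flux_curve:
  assumes "smooth U F" "open_along U" "x \<in> U"
  shows "((\<lambda>t. F (flux_curve x e i t)) has_real_derivative flux_deriv e i F x) (at 0)"
proof -
  note D = smooth_chain[OF assms tangent_flux_curve[of x e i]]
  show ?thesis
    using D unfolding flux_deriv_curve vector_derivative_real[OF D] .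
qed

lemma smooth_hol_curve:
  assumes "smooth U F" "open_along U" "x \<in> U"
  shows "((\<lambda>t. F (hol_curve x e i t)) has_real_derivative hol_deriv e i F x) (at 0)"
proof -
  note D = smooth_chain[OF assms tangent_hol_curve[of x e i]]
  show ?thesis
    using D unfolding hol_deriv_curve vector_derivative_real[OF D] .
qed

text \<open>Differentiation along a family of curves obeys the sum, product and power rules by
  uniqueness of derivatives, so smoothness of \<open>D F\<close> reduces to smoothness of
  \<open>D\<close> on the coordinates. The flux and the holonomy derivations are both
  instances.\<close>

lemma smooth_derivation:
  fixes c :: "'l::nontriv phase \<Rightarrow> real \<Rightarrow> 'l phase"
    and D :: "('l phase \<Rightarrow> real) \<Rightarrow> 'l phase \<Rightarrow> real"
  assumes U: "open_along U"
    and D: "\<And>F x. smooth U F \<Longrightarrow> x \<in> U \<Longrightarrow> ((\<lambda>t. F (c x t)) has_real_derivative D F x) (at 0)"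
    and c0: "\<And>x. c x 0 = x"
    and c: "\<And>x. x \<in> U \<Longrightarrow> \<forall>\<^sub>F t in at 0. c x t \<in> U"
    and hol: "\<And>f e r s. f \<in> {Re, Im} \<Longrightarrow> smooth U (D (\<lambda>x. f (su2_mat (fst x e) $ r $ s)))"
    and flux: "\<And>e i. smooth U (D (\<lambda>x. snd x e $ i))"
    and F: "smooth U F"
  shows "smooth U (D F)"
  using F
proof (induction rule: smooth.induct)
  case (smooth_const k)
  have "D (\<lambda>_. k) x = 0" if "x \<in> U" for x
    using D[OF smooth.smooth_const[of U k] that] DERIV_const by (rule DERIV_unique)
  then show ?case by (intro smooth_cong[OF smooth.smooth_const[of U 0]]) auto
next
  case (smooth_add F G)
  have "D (\<lambda>x. F x + G x) x = D F x + D G x" if "x \<in> U" for x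
    using DERIV_unique[OF D[OF smooth.smooth_add[OF smooth_add.hyps] that]
        DERIV_add[OF D[OF smooth_add.hyps(1) that] D[OF smooth_add.hyps(2) that]]]
    by simp
  then show ?case
    by (intro smooth_cong[OF smooth.smooth_add[OF smooth_add.IH]]) auto
next
  case (smooth_mult F G)
  have "D (\<lambda>x. F x * G x) x = D F x * G x + D G x * F x" if "x \<in> U" for x
    using DERIV_unique[OF D[OF smooth.smooth_mult[OF smooth_mult.hyps] that]
        DERIV_mult[OF D[OF smooth_mult.hyps(1) that] D[OF smooth_mult.hyps(2) that]]]
    by (simp add: c0)
  then show ?case
    by (intro smooth_cong[OF smooth.smooth_add[OF smooth.smooth_mult[OF smooth_mult.IH(1) smooth_mult.hyps(2)]
        smooth.smooth_mult[OF smooth_mult.IH(2) smooth_mult.hyps(1)]]]) auto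
next
  case (smooth_powr F r)
  have "D (\<lambda>x. F x powr r) x = r * F x powr (r - 1) * D F x" if "x \<in> U" for x
    using DERIV_unique[OF D[OF smooth.smooth_powr[OF smooth_powr.hyps] that]
        DERIV_fun_powr[OF D[OF smooth_powr.hyps(1) that], of r]] smooth_powr.hyps(2)[OF that]
    by (simp add: c0)
  then show ?case
    by (intro smooth_cong[OF smooth.smooth_mult[OF smooth.smooth_mult[OF smooth.smooth_const[of U r]
        smooth.smooth_powr[OF smooth_powr.hyps, of "r - 1"]] smooth_powr.IH]]) auto
next
  case (smooth_cong F G)
  have "D F x = D G x" if x: "x \<in> U" for x
  proof (rule DERIV_unique)
    show "((\<lambda>t. F (c x t)) has_real_derivative D F x) (at 0)"
      using D[OF smooth_cong.hyps(1) x] .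
    have "\<forall>\<^sub>F t in at 0. F (c x t) = G (c x t)"
      using c[OF x] by (rule eventually_mono) (rule smooth_cong.hyps(2))
    moreover have "F (c x 0) = G (c x 0)"
      unfolding c0 using x by (rule smooth_cong.hyps(2))
    moreover have "((\<lambda>t. G (c x t)) has_real_derivative D G x) (at 0)"
      using D[OF smooth.smooth_cong[OF smooth_cong.hyps] x] by simp
    ultimately show "((\<lambda>t. F (c x t)) has_real_derivative D G x) (at 0)"
      by (subst has_field_derivative_cong_eventually) auto
  qed
  then show ?case by (intro smooth.smooth_cong[OF smooth_cong.IH]) auto
qed (use hol flux in auto)

lemma open_alongD: "open_along U \<Longrightarrow> x \<in> U \<Longrightarrow> tangent \<gamma> x u w \<Longrightarrow> \<forall>\<^sub>F t in at 0. \<gamma> t \<in> U"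
  by (auto simp: open_along_def)

lemma smooth_flux_deriv:
  assumes F: "smooth U F" and U: "open_along U"
  shows "smooth U (flux_deriv e i F)"
proof (rule smooth_derivation[OF U smooth_flux_curve[OF _ U] _ open_alongD[OF U _ tangent_flux_curve] _ _ F])
  show "flux_curve x e i 0 = x" for x
    by (simp add: flux_curve_def prod_eq_iff)
  show "smooth U (flux_deriv e i (\<lambda>x. f (su2_mat (fst x e') $ r $ s)))" for f e' r s
    using flux_deriv_hol[of e i "\<lambda>h. f (su2_mat (h e') $ r $ s)"]
    by (intro smooth_cong[OF smooth_const[of U 0]]) simp
  show "smooth U (flux_deriv e i (\<lambda>x. snd x e' $ j))" for e' j
    by (intro smooth_cong[OF smooth_const]) (auto simp: flux_deriv_flux)
qed

lemma smooth_hol_deriv: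
  assumes F: "smooth U F" and U: "open_along U"
  shows "smooth U (hol_deriv e i F)"
proof (rule smooth_derivation[OF U smooth_hol_curve[OF _ U] _ open_alongD[OF U _ tangent_hol_curve] _ _ F])
  show "hol_curve x e i 0 = x" for x
    using tangent_hol_curve[of x e i] by (simp add: tangent_def)
  show "smooth U (hol_deriv e i (\<lambda>x. snd x e' $ j))" for e' j
    using hol_deriv_flux[of e i "\<lambda>p. p e' $ j"]
    by (intro smooth_cong[OF smooth_const[of U 0]]) simp
  fix f :: "complex \<Rightarrow> real" and e' r s assume f: "f \<in> {Re, Im}"
  then interpret f: bounded_linear f
    by (auto simp: bounded_linear_Re bounded_linear_Im)
  have T: "tangent (hol_curve x e i) x ((\<lambda>_. 0)(e := axis i 1)) (\<lambda>_. 0)" for x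
    by (rule tangent_hol_curve)
  have eq: "hol_deriv e i (\<lambda>x. f (su2_mat (fst x e') $ r $ s)) x
      = f (((if e = e' then 1 / 2 else 0) *\<^sub>R (tau i ** su2_mat (fst x e))) $ r $ s)" for x
    unfolding hol_deriv_curve
  proof (rule vector_derivative_real)
    have "((\<lambda>t. f (su2_mat (fst (hol_curve x e i t) e') $ r $ s)) has_vector_derivative
        f (((1 / 2) *\<^sub>R (tv (((\<lambda>_. 0)(e := axis i 1)) e') ** su2_mat (fst x e'))) $ r $ s)) (at 0)"
      using T[of x] unfolding tangent_def
      by (intro bounded_linear.has_vector_derivative[OF f.bounded_linear_axioms] has_vector_derivative_component) blast
    then show "((\<lambda>t. f (su2_mat (fst (hol_curve x e i t) e') $ r $ s)) has_real_derivative
        f (((if e = e' then 1 / 2 else 0) *\<^sub>R (tau i ** su2_mat (fst x e))) $ r $ s)) (at 0)"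
      by (auto simp: has_real_derivative_iff_has_vector_derivative tv_axis f.zero split: if_splits)
  qed
  have "smooth U (\<lambda>x. f (((if e = e' then 1 / 2 else 0) *\<^sub>R (tau i ** su2_mat (fst x e))) $ r $ s))"
    using msmooth_scaleR[OF smooth_const[of U "if e = e' then 1 / 2 else 0"]
        msmooth_mult[OF msmooth_const[of U "tau i"] msmooth_hol[of U e]]] f
    unfolding msmooth_def by (elim insertE emptyE allE[of _ r] allE[of _ s] conjE) (simp_all only:)
  then show "smooth U (hol_deriv e i (\<lambda>x. f (su2_mat (fst x e') $ r $ s)))"
    by (rule smooth_cong) (rule eq[symmetric])
qed

text \<open>Differentiability along a curve implies continuity, and finitely many strict
  inequalities persist together; hence the finite index type, later the set of vertices.\<close>

lemma open_along_positive:
  assumes U: "open_along U" and G: "\<And>i :: 'i::finite. smooth U (G i)"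
  shows "open_along {x \<in> U. \<forall>i. G i x > 0}"
  unfolding open_along_def
proof (intro ballI allI impI)
  fix x \<gamma> u w
  assume x: "x \<in> {x \<in> U. \<forall>i. G i x > 0}" and T: "tangent \<gamma> x u w"
  have "\<forall>\<^sub>F t in at 0. G i (\<gamma> t) > 0" for i
  proof -
    have "isCont (\<lambda>t. G i (\<gamma> t)) 0"
      using smooth_chain[OF G U _ T] x DERIV_isCont by blast
    then have "((\<lambda>t. G i (\<gamma> t)) \<longlongrightarrow> G i (\<gamma> 0)) (at 0)"
      by (simp add: isCont_def)
    moreover have "G i (\<gamma> 0) > 0"
      using x T by (auto simp: tangent_def)
    ultimately show ?thesis
      by (rule order_tendstoD)
  qed
  then have "\<forall>\<^sub>F t in at 0. \<forall>i. G i (\<gamma> t) > 0"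
    by (simp add: eventually_all_finite)
  moreover have "\<forall>\<^sub>F t in at 0. \<gamma> t \<in> U"
    using x T by (auto intro: open_alongD[OF U])
  ultimately show "\<forall>\<^sub>F t in at 0. \<gamma> t \<in> {x \<in> U. \<forall>i. G i x > 0}"
    by eventually_elim auto
qed

text \<open>Edge by edge this is the bracket of the cotangent bundle of SU(2): the pairing of
  holonomy and flux derivatives, and the Lie-Poisson term of the fluxes.\<close>

lemma poisson_grad:
  "poisson \<kappa> a F G x = \<kappa> / a\<^sup>2 * (\<Sum>e\<in>UNIV. hgrad G x e \<bullet> fgrad F x e - fgrad G x e \<bullet> hgrad F x e
      - snd x e \<bullet> (fgrad F x e \<times> fgrad G x e))"
  for F :: "'l::nontriv phase \<Rightarrow> real"
proof -
  have "(\<Sum>i\<in>UNIV. \<Sum>j\<in>UNIV. \<Sum>k\<in>UNIV. (eps i j k * p $ k * g $ j) * f $ i) = p \<bullet> (f \<times> g)"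
    for p f g :: "real^3"
    by (simp add: sum_3 eps_def inner_vec_def cross3_def algebra_simps)
  then show ?thesis
    by (simp add: poisson_def fgrad_def hgrad_def inner_vec_def sum_subtractf) 
      (simp add: sum_3 eps_def inner_vec_def cross3_def algebra_simps)
qed

lemma smooth_poisson:
  assumes "smooth U F" "smooth U G" "open_along U"
  shows "smooth U (poisson \<kappa> a F G)"
  unfolding poisson_grad[abs_def] fgrad_def hgrad_def inner_vec_def cross3_def
  apply (simp only: sum_3 inner_real_def vec_lambda_beta vector_3)
    apply (intro smooth_mult smooth_add smooth_sum smooth_diff smooth_const[of U "_ / _"] smooth_flux smooth_flux_deriv
      smooth_hol_deriv assms)
done

section \<open>Oriented edges\<close>

definition ohol :: "'l::nontriv phase \<Rightarrow> 'l vertex \<Rightarrow> 3 \<Rightarrow> int \<Rightarrow> su2" where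
  "ohol x v I s = (if s = 1 then fst x (v, I) else su2_inv (fst x (shift v I (- 1), I)))"

text \<open>The law by which fluxes behave under reversal of an edge, stated for an arbitrary edge
  field \<open>b\<close>, since flux gradients are to be transported in the same way.\<close>

definition ofield :: "'l::nontriv phase \<Rightarrow> ('l edge \<Rightarrow> real^3) \<Rightarrow> 'l vertex \<Rightarrow> 3 \<Rightarrow> int \<Rightarrow> real^3" where
  "ofield x b v I s = (if s = 1 then b (v, I) else - Ad (ohol x v I s) (b (shift v I (- 1), I)))"

abbreviation oflux :: "'l::nontriv phase \<Rightarrow> 'l vertex \<Rightarrow> 3 \<Rightarrow> int \<Rightarrow> real^3" where
  "oflux x \<equiv> ofield x (snd x)"

abbreviation ograd :: "('l::nontriv phase \<Rightarrow> real) \<Rightarrow> 'l phase \<Rightarrow> 'l vertex \<Rightarrow> 3 \<Rightarrow> int \<Rightarrow> real^3" where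
  "ograd F x \<equiv> ofield x (fgrad F x)"

definition conjug :: "su2 \<Rightarrow> su2 \<Rightarrow> su2" where
  "conjug g h = su2_times g (su2_times h (su2_inv g))"

lemma shift_shift: "s + s' = 0 \<Longrightarrow> shift (shift v I s) I s' = v"
  by (auto simp: shift_def add.assoc vec_eq_iff axis_def simp flip: of_int_add)

lemma hol_ohol: "hol x v I s = su2_mat (ohol x v I s)"
  by (simp add: hol_def ohol_def su2_mat_inv)

lemma flux_oflux: "flux x v I s i = oflux x v I s $ i"
  by (simp add: flux_def ofield_def Let_def Ad_def ohol_def matrix_inv_su2 su2_inv.rep_eq adj_adj_su2
      flip: tv_def)

lemma ohol_rev: "s \<in> {1, - 1} \<Longrightarrow> ohol x (shift v I s) I (- s) = su2_inv (ohol x v I s)"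
  by (auto simp: ohol_def shift_shift)

lemma ofield_rev:
  "s \<in> {1, - 1} \<Longrightarrow> ofield x b (shift v I s) I (- s) = - Ad (su2_inv (ohol x v I s)) (ofield x b v I s)"
  using ohol_rev[of s x v I] by (auto simp: ofield_def shift_shift Ad_uminus)

section \<open>Brackets with a holonomy\<close>

lemma hol_deriv_adj:
  "hol_deriv e i (\<lambda>x. adj (su2_mat (fst x e'))) x
     = (if e = e' then - (1 / 2) *\<^sub>R (adj (su2_mat (fst x e)) ** tau i) else 0)"
proof -
  have "((\<lambda>t. adj (su2_mat (fst (hol_curve x e i t) e'))) has_vector_derivative
      adj ((1 / 2) *\<^sub>R (tv (((\<lambda>_. 0)(e := axis i 1)) e') ** su2_mat (fst x e')))) (at 0)"
    using tangent_hol_curve[of x e i] unfolding tangent_def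
    by (intro bounded_linear.has_vector_derivative[OF bounded_linear_adj]) blast
  then have "hol_deriv e i (\<lambda>x. adj (su2_mat (fst x e'))) x
      = adj ((1 / 2) *\<^sub>R (tv (((\<lambda>_. 0)(e := axis i 1)) e') ** su2_mat (fst x e')))"
    unfolding hol_deriv_curve by (rule vector_derivative_at)
  then show ?thesis
    using linear_0[OF bounded_linear.linear[OF bounded_linear_adj]]
    by (simp add: adj_scaleR adj_mult adj_tv matrix_mult_uminus flip: tv_axis)
qed

text \<open>Functions of the holonomies have no flux derivatives, so only the flux gradient of
  \<open>F\<close> on the single edge \<open>e0\<close> survives.\<close>

lemma poisson_hol_left:
  fixes M :: "('l::nontriv edge \<Rightarrow> su2) \<Rightarrow> cmat2"
  assumes "\<And>e i. hol_deriv e i (\<lambda>y. M (fst y)) x = (if e = e0 then B i else 0)"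
  shows "poisson \<kappa> a (\<lambda>y. M (fst y)) F x = - (\<kappa> / a\<^sup>2) *\<^sub>R (\<Sum>i\<in>UNIV. (fgrad F x e0 $ i) *\<^sub>R B i)"
proof -
  have "(\<Sum>e\<in>UNIV. \<Sum>i\<in>UNIV. - (flux_deriv e i F x *\<^sub>R (if e = e0 then B i else 0)))
      = (\<Sum>e\<in>UNIV. if e = e0 then \<Sum>i\<in>UNIV. - (flux_deriv e0 i F x *\<^sub>R B i) else 0)"
    by (rule sum.cong) auto
  then show ?thesis
    by (simp add: poisson_def flux_deriv_hol assms fgrad_def sum_negf)
qed

text \<open>The derivation applied to the inverse holonomy reproduces it next to a
  \<open>tau\<close>, and the holonomy in front cancels it. For a backward edge a conjugation and a
  sign remain, exactly those in \<open>ofield\<close>. Thus the constraints involve brackets only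
  through flux gradients.\<close>

lemma hol_bracket_ograd:
  "hol_bracket \<kappa> a v I s F x = (\<kappa> / (2 * a\<^sup>2)) *\<^sub>R tv (ograd F x v I s)"
proof (cases "s = 1")
  case True
  define h where "h = su2_mat (fst x (v, I))"
  have "hol_bracket \<kappa> a v I s F x = h ** poisson \<kappa> a (\<lambda>y. adj (su2_mat (fst y (v, I)))) F x"
    by (simp add: True hol_bracket_def hol_def matrix_inv_su2 h_def)
  also have "poisson \<kappa> a (\<lambda>y. adj (su2_mat (fst y (v, I)))) F x
      = - (\<kappa> / a\<^sup>2) *\<^sub>R (\<Sum>i\<in>UNIV. (fgrad F x (v, I) $ i) *\<^sub>R (- (1 / 2) *\<^sub>R (adj h ** tau i)))"
    by (rule poisson_hol_left[where M = "\<lambda>f. adj (su2_mat (f (v, I)))"]) (simp add: hol_deriv_adj h_def)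
  also have "\<dots> = (\<kappa> / (2 * a\<^sup>2)) *\<^sub>R (adj h ** tv (fgrad F x (v, I)))"
    by (simp add: tv_def sum_3 matrix_mult_add matrix_mul_scaleR_right algebra_simps)
  also have "h ** \<dots> = (\<kappa> / (2 * a\<^sup>2)) *\<^sub>R tv (fgrad F x (v, I))"
    by (simp add: matrix_mul_scaleR_right matrix_mul_assoc h_def su2_mat_unit)
  finally show ?thesis
    by (simp add: ofield_def True)
next
  case False
  define e where "e = (shift v I (- 1), I)"
  define h where "h = su2_mat (fst x e)"
  have "hol_bracket \<kappa> a v I s F x = adj h ** poisson \<kappa> a (\<lambda>y. su2_mat (fst y e)) F x"
    by (simp add: False hol_bracket_def hol_def matrix_inv_su2 h_def e_def)
      (simp add: adj_adj_su2 flip: su2_inv.rep_eq su2_mat_inv)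
  also have "poisson \<kappa> a (\<lambda>y. su2_mat (fst y e)) F x
      = - (\<kappa> / a\<^sup>2) *\<^sub>R (\<Sum>i\<in>UNIV. (fgrad F x e $ i) *\<^sub>R ((1 / 2) *\<^sub>R (tau i ** h)))"
    by (rule poisson_hol_left[where M = "\<lambda>f. su2_mat (f e)"]) (simp add: hol_deriv_hol h_def)
  also have "\<dots> = - (\<kappa> / (2 * a\<^sup>2)) *\<^sub>R (tv (fgrad F x e) ** h)"
    by (simp add: tv_def sum_3 matrix_add_mult matrix_scaleR_mult algebra_simps)
  also have "adj h ** \<dots> = - (\<kappa> / (2 * a\<^sup>2)) *\<^sub>R (adj h ** tv (fgrad F x e) ** adj (adj h))"
    by (simp add: matrix_mul_scaleR_right matrix_mult_uminus matrix_mul_assoc h_def adj_adj_su2)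
  also have "\<dots> = (\<kappa> / (2 * a\<^sup>2)) *\<^sub>R tv (- Ad (su2_inv (fst x e)) (fgrad F x e))"
    by (simp add: tv_uminus tv_Ad su2_inv.rep_eq h_def)
  finally show ?thesis
    by (simp add: ofield_def False ohol_def e_def)
qed

section \<open>Velocities of reversed and rotated edge data\<close>

lemma has_vector_derivative_mult:
  fixes f g :: "real \<Rightarrow> cmat2"
  assumes "(f has_vector_derivative f') (at 0)" "(g has_vector_derivative g') (at 0)"
  shows "((\<lambda>t. f t ** g t) has_vector_derivative (f 0 ** g' + f' ** g 0)) (at 0)"
  using bounded_bilinear.has_vector_derivative[OF bounded_bilinear_cmat2_mult assms] .

lemma has_vector_derivative_adj:
  "(f has_vector_derivative f') F \<Longrightarrow> ((\<lambda>t. adj (f t)) has_vector_derivative adj f') F"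
  by (rule bounded_linear.has_vector_derivative[OF bounded_linear_adj])

lemma has_vector_derivative_inv_hol:
  assumes "((\<lambda>t. su2_mat (h t)) has_vector_derivative (1 / 2) *\<^sub>R (tv u ** su2_mat (h 0))) (at 0)"
  shows "((\<lambda>t. su2_mat (su2_inv (h t))) has_vector_derivative
    (1 / 2) *\<^sub>R (tv (- Ad (su2_inv (h 0)) u) ** su2_mat (su2_inv (h 0)))) (at 0)"
proof -
  have "adj ((1 / 2) *\<^sub>R (tv u ** su2_mat (h 0))) = (1 / 2) *\<^sub>R (tv (- Ad (su2_inv (h 0)) u) ** adj (su2_mat (h 0)))"
    by (simp add: adj_scaleR adj_mult adj_tv tv_uminus tv_Ad su2_inv.rep_eq adj_adj_su2
        matrix_uminus_mult matrix_mult_uminus)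
      (simp add: su2_mat_unit flip: matrix_mul_assoc)
  then show ?thesis
    using has_vector_derivative_adj[OF assms] by (simp add: su2_inv.rep_eq)
qed

lemma has_vector_derivative_conjug:
  assumes "((\<lambda>t. su2_mat (h t)) has_vector_derivative (1 / 2) *\<^sub>R (tv u ** su2_mat (h 0))) (at 0)"
  shows "((\<lambda>t. su2_mat (conjug g (h t))) has_vector_derivative
    (1 / 2) *\<^sub>R (tv (Ad g u) ** su2_mat (conjug g (h 0)))) (at 0)"
proof -
  have "su2_mat g ** (((1 / 2) *\<^sub>R (tv u ** su2_mat (h 0))) ** adj (su2_mat g))
      = (1 / 2) *\<^sub>R (su2_mat g ** tv u ** (adj (su2_mat g) ** su2_mat g) ** su2_mat (h 0) ** adj (su2_mat g))"
    by (simp add: su2_mat_unit' matrix_mul_scaleR_right matrix_scaleR_mult matrix_mul_assoc)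
  then have "su2_mat g ** (((1 / 2) *\<^sub>R (tv u ** su2_mat (h 0))) ** adj (su2_mat g))
      = (1 / 2) *\<^sub>R (tv (Ad g u) ** su2_mat (conjug g (h 0)))"
    by (simp add: conjug_def su2_times.rep_eq su2_inv.rep_eq tv_Ad matrix_mul_assoc)
  moreover have "bounded_linear (\<lambda>M :: cmat2. su2_mat g ** (M ** adj (su2_mat g)))"
    by (rule linear_conv_bounded_linear[THEN iffD1], rule linearI)
      (simp_all add: matrix_add_mult matrix_mult_add matrix_scaleR_mult matrix_mul_scaleR_right)
  ultimately show ?thesis
    using bounded_linear.has_vector_derivative[OF _ assms, of "\<lambda>M. su2_mat g ** (M ** adj (su2_mat g))"]
    by (simp add: conjug_def su2_times.rep_eq su2_inv.rep_eq)
qed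

lemma has_vector_derivative_Ad:
  "(f has_vector_derivative f') F \<Longrightarrow> ((\<lambda>t. Ad h (f t)) has_vector_derivative Ad h f') F"
  by (rule bounded_linear.has_vector_derivative[OF linear_conv_bounded_linear[THEN iffD1, OF linear_Ad]])

text \<open>The transported flux depends on the holonomy as well: varying the latter adds half the
  commutator of \<open>tv (p 0)\<close> and \<open>tv u\<close>, which is the cross product
  term.\<close>

lemma has_vector_derivative_Ad_inv:
  assumes h: "((\<lambda>t. su2_mat (h t)) has_vector_derivative (1 / 2) *\<^sub>R (tv u ** su2_mat (h 0))) (at 0)"
    and p: "(p has_vector_derivative w) (at 0)"
  shows "((\<lambda>t. Ad (su2_inv (h t)) (p t)) has_vector_derivative Ad (su2_inv (h 0)) (w - u \<times> p 0)) (at 0)"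
proof -
  \<comment> \<open>A linear left inverse of \<open>tv\<close>, by which the derivative computed for
    matrices is brought back to vectors.\<close>
  define part where "part = (\<lambda>M :: cmat2. \<chi> i. - 1 / 2 * Re (trace (tau i ** M)))"
  have lin: "bounded_linear part"
    by (rule linear_conv_bounded_linear[THEN iffD1], rule linearI)
      (simp_all add: part_def vec_eq_iff matrix_mult_add matrix_mul_scaleR_right trace_add
        trace_scaleR algebra_simps)
  have part_tv: "part (tv y) = y" for y
    by (simp add: part_def vec_eq_iff tau_quat tv_quat quat_mult trace_quat inner_axis')
  define a where "a = adj (su2_mat (h 0))"
  define m where "m = su2_mat (h 0)"
  have ptv: "((\<lambda>t. tv (p t)) has_vector_derivative tv w) (at 0)"
    using bounded_linear.has_vector_derivative[OF bounded_linear_tv p] .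
  have "((\<lambda>t. adj (su2_mat (h t)) ** tv (p t) ** su2_mat (h t)) has_vector_derivative
      (a ** tv (p 0) ** ((1 / 2) *\<^sub>R (tv u ** m))
        + (a ** tv w + adj ((1 / 2) *\<^sub>R (tv u ** m)) ** tv (p 0)) ** m)) (at 0)"
    using has_vector_derivative_mult[OF has_vector_derivative_mult[OF has_vector_derivative_adj[OF h] ptv] h]
    by (simp add: a_def m_def)
  moreover have "a ** tv (p 0) ** ((1 / 2) *\<^sub>R (tv u ** m))
        + (a ** tv w + adj ((1 / 2) *\<^sub>R (tv u ** m)) ** tv (p 0)) ** m
      = a ** (tv w + (1 / 2) *\<^sub>R (tv (p 0) ** tv u) + (- (1 / 2)) *\<^sub>R (tv u ** tv (p 0))) ** m"
    by (simp add: adj_scaleR adj_mult adj_tv matrix_add_mult matrix_mult_add matrix_scaleR_mult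
        matrix_mul_scaleR_right matrix_uminus_mult matrix_mult_uminus matrix_diff_mult matrix_mult_diff
        matrix_mul_assoc a_def m_def)
  moreover have "tv w + (1 / 2) *\<^sub>R (tv (p 0) ** tv u) + (- (1 / 2)) *\<^sub>R (tv u ** tv (p 0)) = tv (w - u \<times> p 0)"
    by (simp only: tv_mult quat_scaleR quat_add quat_eq_iff tv_quat[of w] tv_quat[of "w - u \<times> p 0"])
      (simp add: inner_commute cross_skew[of "p 0" u] flip: scaleR_add_left)
  moreover have "a ** tv y ** m = tv (Ad (su2_inv (h 0)) y)" for y
    by (simp add: tv_Ad su2_inv.rep_eq adj_adj_su2 a_def m_def)
  moreover have "adj (su2_mat (h t)) ** tv (p t) ** su2_mat (h t) = tv (Ad (su2_inv (h t)) (p t))" for t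
    by (simp add: tv_Ad su2_inv.rep_eq adj_adj_su2)
  ultimately have "((\<lambda>t. tv (Ad (su2_inv (h t)) (p t))) has_vector_derivative
      tv (Ad (su2_inv (h 0)) (w - u \<times> p 0))) (at 0)"
    by simp
  from bounded_linear.has_vector_derivative[OF lin this] show ?thesis
    by (simp only: part_tv)
qed

section \<open>Lattice symmetries\<close>

text \<open>\<open>R\<close> is an automorphism of the lattice, mapping the direction \<open>I\<close> to \<open>sg I\<close> times the
  direction \<open>\<pi> I\<close>, and the last condition says that it preserves the orientation; \<open>g\<close> is an
  independent global rotation of the su(2) indices.\<close>

locale lattice_sym =
  fixes R :: "'l::nontriv vertex \<Rightarrow> 'l vertex" and \<pi> :: "3 \<Rightarrow> 3" and sg :: "3 \<Rightarrow> int" and g :: su2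
  assumes bij_R: "bij R" and bij_\<pi>: "bij \<pi>" and sg: "sg I \<in> {1, - 1}"
    and R_shift: "s \<in> {1, - 1} \<Longrightarrow> R (shift v I s) = shift (R v) (\<pi> I) (sg I * s)"
    and eps_\<pi>: "eps (\<pi> I) (\<pi> J) (\<pi> K) = of_int (sg I * sg J * sg K) * eps I J K"
begin

text \<open>A pull-back: the data on an edge are taken from its image, so no inverse of
  \<open>R\<close> occurs and the volume of \<open>act x\<close> at \<open>v\<close> is that of
  \<open>x\<close> at \<open>R v\<close>.\<close>

definition act :: "'l phase \<Rightarrow> 'l phase" where
  "act x = (\<lambda>(v, I). conjug g (ohol x (R v) (\<pi> I) (sg I)), \<lambda>(v, I). Ad g (oflux x (R v) (\<pi> I) (sg I)))"

text \<open>The positively oriented edge that stores the data used on the given edge. For a reversed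
  image it starts one vertex earlier, and \<open>rot\<close> then contains a holonomy, so it varies
  with \<open>x\<close>.\<close>

definition src :: "'l edge \<Rightarrow> 'l edge" where
  "src = (\<lambda>(v, I). if sg I = 1 then (R v, \<pi> I) else (shift (R v) (\<pi> I) (- 1), \<pi> I))"

definition rot :: "'l phase \<Rightarrow> 'l edge \<Rightarrow> su2" where
  "rot x = (\<lambda>(v, I). if sg I = 1 then g else su2_times g (ohol x (R v) (\<pi> I) (- 1)))"

definition sgn_edge :: "'l edge \<Rightarrow> real" where
  "sgn_edge e = of_int (sg (snd e))"

lemma sgn_edge_cases: "sgn_edge e = 1 \<or> sgn_edge e = - 1"
  using sg[of "snd e"] by (auto simp: sgn_edge_def)

lemma ofield_rot: "Ad g (ofield x b (R v) (\<pi> I) (sg I)) = sgn_edge (v, I) *\<^sub>R Ad (rot x (v, I)) (b (src (v, I)))"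
  using sg[of I] by (auto simp: ofield_def rot_def src_def sgn_edge_def Ad_times Ad_uminus)

lemma bij_src: "bij src"
proof -
  have "inj src"
  proof (rule injI)
    fix e e' assume E: "src e = src e'"
    obtain v I v' I' where e: "e = (v, I)" "e' = (v', I')" by (cases e; cases e')
    have "\<pi> I = \<pi> I'"
      using E by (auto simp: e src_def split: if_splits)
    then have I: "I = I'"
      using bij_\<pi> by (auto simp: bij_def inj_def)
    have "R v = R v'"
      using E by (auto simp: e src_def I shift_def split: if_splits)
    then show "e = e'"
      using bij_R by (auto simp: bij_def inj_def e I)
  qed
  then show ?thesis
    by (simp add: bij_def finite_UNIV_inj_surj)
qed

lemma ohol_act: "s \<in> {1, - 1} \<Longrightarrow> ohol (act x) v I s = conjug g (ohol x (R v) (\<pi> I) (sg I * s))"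
proof -
  have "ohol (act x) v I (- 1) = su2_inv (conjug g (ohol x (shift (R v) (\<pi> I) (- sg I)) (\<pi> I) (sg I)))"
    using R_shift[of "- 1" v I] unfolding ohol_def[of "act x"] by (simp add: act_def)
  also have "\<dots> = conjug g (ohol x (R v) (\<pi> I) (- sg I))"
    using ohol_rev[of "- sg I" x "R v" "\<pi> I"] sg[of I]
    by (auto simp: conjug_def su2_inv_times su2_mult_assoc)
  finally show "s \<in> {1, - 1} \<Longrightarrow> ?thesis"
    unfolding ohol_def[of "act x"] by (auto simp: act_def)
qed

text \<open>Kept general in \<open>b\<close> because it is applied twice: to the fluxes themselves
  and to the flux gradient of a function.\<close>

lemma ofield_act:
  assumes b': "\<And>v I. b' (v, I) = Ad g (ofield x b (R v) (\<pi> I) (sg I))" and s: "s \<in> {1, - 1}"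
  shows "ofield (act x) b' v I s = Ad g (ofield x b (R v) (\<pi> I) (sg I * s))"
proof -
  have "ofield (act x) b' v I (- 1)
      = - Ad (conjug g (ohol x (R v) (\<pi> I) (- sg I))) (Ad g (ofield x b (shift (R v) (\<pi> I) (- sg I)) (\<pi> I) (sg I)))"
    using R_shift[of "- 1" v I] by (simp add: ofield_def[of "act x"] b' ohol_act)
  also have "\<dots> = Ad g (ofield x b (R v) (\<pi> I) (- sg I))"
    using ofield_rev[of "- sg I" x b "R v" "\<pi> I"] sg[of I]
    by (auto simp: conjug_def Ad_times Ad_uminus)
  finally show ?thesis
    using s by (auto simp: ofield_def[of "act x"] b')
qed

lemma oflux_act: "s \<in> {1, - 1} \<Longrightarrow> oflux (act x) v I s = Ad g (oflux x (R v) (\<pi> I) (sg I * s))"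
  by (rule ofield_act) (simp_all add: act_def)

lemma snd_act: "snd (act x) e = sgn_edge e *\<^sub>R Ad (rot x e) (snd x (src e))"
  by (cases e) (simp add: act_def ofield_rot)

subsection \<open>Symmetries are Poisson maps\<close>

text \<open>The coefficient \<open>(1 - sgn_edge e) / 2\<close> is 1 on reversed edges and 0
  elsewhere: only reversal makes the new flux depend on the old holonomy.\<close>

lemma tangent_act:
  assumes T: "tangent \<gamma> x u w"
  shows "tangent (\<lambda>t. act (\<gamma> t)) (act x)
    (\<lambda>e. sgn_edge e *\<^sub>R Ad (rot x e) (u (src e)))
    (\<lambda>e. sgn_edge e *\<^sub>R Ad (rot x e) (w (src e) - ((1 - sgn_edge e) / 2) *\<^sub>R (u (src e) \<times> snd x (src e))))"
proof -
  have x: "\<gamma> 0 = x" and h: "((\<lambda>t. su2_mat (fst (\<gamma> t) e)) has_vector_derivative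
      (1 / 2) *\<^sub>R (tv (u e) ** su2_mat (fst (\<gamma> 0) e))) (at 0)"
    and p: "((\<lambda>t. snd (\<gamma> t) e) has_vector_derivative w e) (at 0)" for e
    using T by (auto simp: tangent_def simp del: split_paired_All)
  have 1: "((\<lambda>t. su2_mat (fst (act (\<gamma> t)) (v, I))) has_vector_derivative
      (1 / 2) *\<^sub>R (tv (sgn_edge (v, I) *\<^sub>R Ad (rot x (v, I)) (u (src (v, I)))) ** su2_mat (fst (act x) (v, I)))) (at 0)" for v I
  proof (cases "sg I = 1")
    case True
    then show ?thesis
      using has_vector_derivative_conjug[OF h[of "(R v, \<pi> I)"]]
      by (simp add: act_def ohol_def rot_def src_def sgn_edge_def x)
  next
    case False
    then have "sg I = - 1"
      using sg[of I] by auto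
    then show ?thesis
      using has_vector_derivative_conjug[OF has_vector_derivative_inv_hol[OF h[of "(shift (R v) (\<pi> I) (- 1), \<pi> I)"]]]
      by (simp add: act_def ohol_def rot_def src_def sgn_edge_def x Ad_times Ad_uminus)
  qed
  have 2: "((\<lambda>t. snd (act (\<gamma> t)) (v, I)) has_vector_derivative sgn_edge (v, I) *\<^sub>R Ad (rot x (v, I)) (w (src (v, I))
      - ((1 - sgn_edge (v, I)) / 2) *\<^sub>R (u (src (v, I)) \<times> snd x (src (v, I))))) (at 0)" for v I
  proof (cases "sg I = 1")
    case True
    then show ?thesis
      using has_vector_derivative_Ad[OF p[of "(R v, \<pi> I)"]]
      by (simp add: act_def ofield_def rot_def src_def sgn_edge_def)
  next
    case False
    then have "sg I = - 1"
      using sg[of I] by auto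
    then show ?thesis
      using has_vector_derivative_minus[OF has_vector_derivative_Ad[OF has_vector_derivative_Ad_inv[OF
            h[of "(shift (R v) (\<pi> I) (- 1), \<pi> I)"] p[of "(shift (R v) (\<pi> I) (- 1), \<pi> I)"]]], of g]
      by (simp add: act_def ofield_def ohol_def rot_def src_def sgn_edge_def x Ad_times Ad_uminus)
  qed
  show ?thesis
    using 1 2 by (auto simp: tangent_def x)
qed

lemma sum_src: "(\<Sum>e'\<in>UNIV. f e' (((\<lambda>_. 0)(src e := y)) (src e'))) = f e y"
  if "\<And>e'. f e' 0 = 0" for f :: "'l edge \<Rightarrow> real^3 \<Rightarrow> real"
proof -
  have "src e' = src e \<longleftrightarrow> e' = e" for e'
    using bij_src by (rule inj_eq[OF bij_is_inj])
  then have "(\<Sum>e'\<in>UNIV. f e' (((\<lambda>_. 0)(src e := y)) (src e'))) = (\<Sum>e'\<in>UNIV. if e' = e then f e y else 0)"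
    by (intro sum.cong) (auto simp: that)
  then show ?thesis by simp
qed

text \<open>The transpose of \<open>tangent_act\<close>: the chain rule is applied to images of
  coordinate curves, which move one edge only, and the rotation and the cross product are shifted to
  the other side of the dot product.\<close>

lemma grad_act:
  assumes "smooth U F" "open_along U" "act x \<in> U"
  shows "fgrad (\<lambda>y. F (act y)) x (src e) = sgn_edge e *\<^sub>R Ad (su2_inv (rot x e)) (fgrad F (act x) e)"
    and "hgrad (\<lambda>y. F (act y)) x (src e) = sgn_edge e *\<^sub>R (Ad (su2_inv (rot x e)) (hgrad F (act x) e)
      - ((1 - sgn_edge e) / 2) *\<^sub>R (snd x (src e) \<times> Ad (su2_inv (rot x e)) (fgrad F (act x) e)))"
proof -
  note D = smooth_chain[OF assms tangent_act]
  show "fgrad (\<lambda>y. F (act y)) x (src e) = sgn_edge e *\<^sub>R Ad (su2_inv (rot x e)) (fgrad F (act x) e)"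
    using vector_derivative_real[OF D[OF tangent_flux_curve[of x "src e"]]]
      sum_src[of "\<lambda>e' z. (sgn_edge e' *\<^sub>R Ad (rot x e') z) \<bullet> fgrad F (act x) e'" e]
    by (simp add: vec_eq_iff fgrad_def[of "\<lambda>y. F (act y)"] flux_deriv_curve inner_Ad inner_axis'
        del: fun_upd_apply)
  have "hgrad (\<lambda>y. F (act y)) x (src e) $ i =
      (sgn_edge e *\<^sub>R Ad (rot x e) (axis i 1)) \<bullet> hgrad F (act x) e +
      (sgn_edge e *\<^sub>R Ad (rot x e) (- ((1 - sgn_edge e) / 2) *\<^sub>R (axis i 1 \<times> snd x (src e)))) \<bullet> fgrad F (act x) e" for i
    using vector_derivative_real[OF D[OF tangent_hol_curve[of x "src e" i]]]
      sum_src[of "\<lambda>e' z. (sgn_edge e' *\<^sub>R Ad (rot x e') z) \<bullet> hgrad F (act x) e' +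
        (sgn_edge e' *\<^sub>R Ad (rot x e') (- ((1 - sgn_edge e') / 2) *\<^sub>R (z \<times> snd x (src e')))) \<bullet> fgrad F (act x) e'"
        e "axis i 1"]
    by (simp add: hgrad_def[of "\<lambda>y. F (act y)"] hol_deriv_curve del: fun_upd_apply)
  then show "hgrad (\<lambda>y. F (act y)) x (src e) = sgn_edge e *\<^sub>R (Ad (su2_inv (rot x e)) (hgrad F (act x) e)
      - ((1 - sgn_edge e) / 2) *\<^sub>R (snd x (src e) \<times> Ad (su2_inv (rot x e)) (fgrad F (act x) e)))"
    by (simp add: vec_eq_iff inner_Ad cross_inner inner_axis' Ad_scaleR Ad_uminus algebra_simps)
qed

lemma ograd_act:
  assumes "smooth U F" "open_along U" "act x \<in> U" "s \<in> {1, - 1}"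
  shows "ograd F (act x) v I s = Ad g (ograd (\<lambda>y. F (act y)) x (R v) (\<pi> I) (sg I * s))"
proof (rule ofield_act[OF _ assms(4)])
  fix v I
  have "sgn_edge (v, I) * sgn_edge (v, I) = 1"
    using sgn_edge_cases[of "(v, I)"] by auto
  then show "fgrad F (act x) (v, I) = Ad g (ograd (\<lambda>y. F (act y)) x (R v) (\<pi> I) (sg I))"
    by (simp add: ofield_rot grad_act[OF assms(1-3)] Ad_scaleR)
qed

text \<open>On edges that keep their orientation this is rotation invariance. On a reversed edge the
  Lie-Poisson term has the wrong sign, and the two corrections in the holonomy gradients contribute
  twice the right one.\<close>

lemma poisson_act:
  fixes F G :: "'l phase \<Rightarrow> real"
  assumes F: "smooth U F" and G: "smooth U G" and U: "open_along U" "act x \<in> U"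
  shows "poisson \<kappa> a F G (act x) = poisson \<kappa> a (\<lambda>y. F (act y)) (\<lambda>y. G (act y)) x"
proof -
  define B where "B = (\<lambda>(F :: 'l phase \<Rightarrow> real) (G :: 'l phase \<Rightarrow> real) x e. hgrad G x e \<bullet> fgrad F x e - fgrad G x e \<bullet> hgrad F x e
      - snd x e \<bullet> (fgrad F x e \<times> fgrad G x e) :: real)"
  have "B (\<lambda>y. F (act y)) (\<lambda>y. G (act y)) x (src e) = B F G (act x) e" for e
  proof -
    define A where "A = Ad (su2_inv (rot x e))"
    define f hf g' hg where "f = A (fgrad F (act x) e)" and "hf = A (hgrad F (act x) e)"
      and "g' = A (fgrad G (act x) e)" and "hg = A (hgrad G (act x) e)"
    have "B F G (act x) e = hg \<bullet> f - g' \<bullet> hf - sgn_edge e * (snd x (src e) \<bullet> (f \<times> g'))"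
      by (simp add: B_def f_def hf_def g'_def hg_def A_def Ad_inner Ad_cross snd_act inner_Ad)
    moreover have "(snd x (src e) \<times> g') \<bullet> f = - (snd x (src e) \<bullet> (f \<times> g'))"
      "g' \<bullet> (snd x (src e) \<times> f) = snd x (src e) \<bullet> (f \<times> g')"
      by (simp_all add: cross3_simps)
    ultimately show ?thesis
      using sgn_edge_cases[of e]
      by (auto simp: B_def grad_act[OF F U] grad_act[OF G U] f_def hf_def g'_def hg_def A_def
          inner_diff_left inner_diff_right)
  qed
  then have "(\<Sum>e\<in>UNIV. B (\<lambda>y. F (act y)) (\<lambda>y. G (act y)) x e) = (\<Sum>e\<in>UNIV. B F G (act x) e)"
    using sum.reindex_bij_betw[OF bij_src, of "B (\<lambda>y. F (act y)) (\<lambda>y. G (act y)) x"] by simp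
  then show ?thesis
    by (simp add: poisson_grad B_def)
qed

end

text \<open>The coordinate curves stay in \<open>U\<close> for small parameters; hence identities
  known only on \<open>U\<close>, such as invariance on \<open>nondeg\<close>, may be
  differentiated.\<close>

lemma grad_cong:
  assumes F: "smooth U F" and U: "open_along U" "x \<in> U" and eq: "\<And>y. y \<in> U \<Longrightarrow> F y = G y"
  shows "fgrad G x e = fgrad F x e" "hgrad G x e = hgrad F x e"
proof -
  have G: "smooth U G"
    using F eq by (rule smooth_cong)
  have *: "d' = d" if "((\<lambda>t. F (\<gamma> t)) has_real_derivative d) (at 0)" "((\<lambda>t. G (\<gamma> t)) has_real_derivative d') (at 0)"
    "tangent \<gamma> x u w" for d d' \<gamma> u w
  proof (rule DERIV_unique[OF that(2)])
    have "\<forall>\<^sub>F t in at 0. F (\<gamma> t) = G (\<gamma> t)"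
      using open_alongD[OF U that(3)] by (rule eventually_mono) (rule eq)
    moreover have "F (\<gamma> 0) = G (\<gamma> 0)"
      using that(3) eq U by (auto simp: tangent_def)
    ultimately show "((\<lambda>t. G (\<gamma> t)) has_real_derivative d) (at 0)"
      using that(1) by (subst (asm) has_field_derivative_cong_eventually) auto
  qed
  show "fgrad G x e = fgrad F x e"
    using *[OF smooth_flux_curve[OF F U] smooth_flux_curve[OF G U] tangent_flux_curve]
    by (simp add: fgrad_def vec_eq_iff)
  show "hgrad G x e = hgrad F x e"
    using *[OF smooth_hol_curve[OF F U] smooth_hol_curve[OF G U] tangent_hol_curve]
    by (simp add: hgrad_def vec_eq_iff)
qed

lemma poisson_cong:
  fixes F G F' G' :: "'l::nontriv phase \<Rightarrow> real"
  assumes "smooth U F" "smooth U G" "open_along U" "x \<in> U"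
    and "\<And>y. y \<in> U \<Longrightarrow> F y = F' y" "\<And>y. y \<in> U \<Longrightarrow> G y = G' y"
  shows "poisson \<kappa> a F' G' x = poisson \<kappa> a F G x"
  using grad_cong[OF assms(1,3,4,5)] grad_cong[OF assms(2,3,4,6)] by (simp add: poisson_grad)

section \<open>Smoothness and invariance of the constraints\<close>

definition av :: "'l::nontriv phase \<Rightarrow> 'l vertex \<Rightarrow> 3 \<Rightarrow> real^3" where
  "av x v I = (1 / 2) *\<^sub>R (oflux x v I 1 - oflux x v I (- 1))"

text \<open>Positivity rather than mere nonvanishing: homogeneous data with p > 0 lie here, and the
  absolute value in \<open>Vol\<close> disappears.\<close>

definition nondeg :: "real \<Rightarrow> real \<Rightarrow> 'l::nontriv phase set" where
  "nondeg \<beta> a = {x. \<forall>v. Q \<beta> a v x > 0}"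

lemma avg_flux_av: "avg_flux x v I i = av x v I $ i"
  by (simp add: avg_flux_def av_def flux_oflux)

lemma eps_triple:
  "(\<Sum>i\<in>UNIV. \<Sum>j\<in>UNIV. \<Sum>k\<in>UNIV. eps i j k * A $ i * B $ j * C $ k) = A \<bullet> (B \<times> C)"
  by (simp add: sum_3 eps_def inner_vec_def cross3_def algebra_simps)

lemma Q_av: "Q \<beta> a v x = (\<beta> * a\<^sup>2 / 2) ^ 3 * (av x v 1 \<bullet> (av x v 2 \<times> av x v 3))"
  by (simp only: Q_def avg_flux_av eps_triple)

text \<open>The triple product is alternating; this undoes the permutation of the directions by a
  symmetry.\<close>

lemma triple_eps: "y I \<bullet> (y J \<times> y K) = eps I J K * (y 1 \<bullet> (y 2 \<times> y 3))" for y :: "3 \<Rightarrow> real^3"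
proof -
  have perm: "b \<bullet> (c \<times> a) = a \<bullet> (b \<times> c)" "c \<bullet> (a \<times> b) = a \<bullet> (b \<times> c)"
    "a \<bullet> (c \<times> b) = - (a \<bullet> (b \<times> c))" "b \<bullet> (a \<times> c) = - (a \<bullet> (b \<times> c))"
    "c \<bullet> (b \<times> a) = - (a \<bullet> (b \<times> c))" for a b c :: "real^3"
    by (simp_all add: cross3_def inner_vec_def sum_3) (simp_all add: algebra_simps)
  have "\<forall>I J K. y I \<bullet> (y J \<times> y K) = eps I J K * (y 1 \<bullet> (y 2 \<times> y 3))"
    unfolding forall_3 using perm[of "y 2" "y 3" "y 1"] by (simp add: eps_def dot_cross_self)
  then show ?thesis
    by blast
qed

lemma msmooth_ohol: "msmooth U (\<lambda>x. su2_mat (ohol x v I s))"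
  using msmooth_hol msmooth_adj[OF msmooth_hol] by (cases "s = 1") (simp_all add: ohol_def su2_inv.rep_eq)

lemma smooth_ofield:
  assumes "\<And>e i. smooth U (\<lambda>x. b x e $ i)"
  shows "smooth U (\<lambda>x. ofield x (b x) v I s $ i)"
  using assms smooth_uminus[OF smooth_Ad[OF msmooth_ohol assms]] by (cases "s = 1") (simp_all add: ofield_def)

lemma smooth_Q: "smooth U (Q \<beta> a v)"
proof -
  have "smooth U (\<lambda>x. av x v I $ i)" for I i
    unfolding av_def vector_scaleR_component vector_minus_component real_scaleR_def
    by (intro smooth_mult smooth_const smooth_diff smooth_ofield smooth_flux)
  then show ?thesis
    unfolding Q_def[abs_def] avg_flux_av
    by (intro smooth_mult smooth_const smooth_sum)
qed

lemma open_along_nondeg: "open_along (nondeg \<beta> a)"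
  using open_along_positive[OF open_along_UNIV, of "Q \<beta> a", OF smooth_Q] by (simp add: nondeg_def)

lemma smooth_Vol: "smooth (nondeg \<beta> a) (Vol \<beta> a v)"
  by (rule smooth_cong[OF smooth_sqrt[OF smooth_Q]]) (auto simp: Vol_def nondeg_def less_imp_le)

lemma msmooth_loop: "msmooth U (\<lambda>x. loop x v I s J s')"
  unfolding loop_def hol_ohol matrix_inv_su2
  by (intro msmooth_mult msmooth_adj msmooth_ohol)

lemma msmooth_hol_bracket:
  assumes "smooth U F" "open_along U"
  shows "msmooth U (hol_bracket \<kappa> a v I s F)"
  unfolding hol_bracket_ograd[abs_def]
  by (intro msmooth_scaleR smooth_const msmooth_tv smooth_ofield)
    (simp add: fgrad_def smooth_flux_deriv[OF assms])

lemma smooth_constr: "smooth (nondeg \<beta> a) (constr \<kappa> a \<beta> t v)"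
  unfolding constr_def[abs_def]
  by (intro smooth_mult smooth_const smooth_sum smooth_trace msmooth_mult msmooth_const msmooth_loop
      msmooth_hol_bracket smooth_Vol open_along_nondeg)

lemma smooth_Kext: "smooth (nondeg \<beta> a) (Kext \<kappa> a \<beta>)"
  unfolding Kext_def[abs_def]
  by (intro smooth_mult smooth_const smooth_poisson smooth_sum smooth_constr smooth_Vol open_along_nondeg)

lemma smooth_constr_L: "smooth (nondeg \<beta> a) (constr_L \<kappa> a \<beta> v)"
  unfolding constr_L_def[abs_def]
  by (intro smooth_mult smooth_const smooth_sum smooth_trace msmooth_mult
      msmooth_hol_bracket smooth_Vol smooth_Kext open_along_nondeg)

lemma smooth_constr_GT: "smooth (nondeg \<beta> a) (constr_GT \<kappa> a \<beta> v)"
  unfolding constr_GT_def[abs_def]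
  by (intro smooth_add smooth_mult smooth_const smooth_constr smooth_constr_L)

section \<open>Behaviour of loops, brackets and constraints under symmetries\<close>

lemma conjug_times: "conjug g (su2_times h k) = su2_times (conjug g h) (conjug g k)"
  by (simp add: conjug_def su2_mult_assoc)

lemma conjug_inv: "conjug g (su2_inv h) = su2_inv (conjug g h)"
  by (simp add: conjug_def su2_inv_times su2_mult_assoc)

lemma su2_mat_conjug: "su2_mat (conjug g h) = su2_mat g ** su2_mat h ** adj (su2_mat g)"
  by (simp add: conjug_def su2_times.rep_eq su2_inv.rep_eq matrix_mul_assoc)

text \<open>The loop as a group element, so that \<open>conjug g\<close> passes through it as a
  homomorphism.\<close>

definition sloop :: "'l::nontriv phase \<Rightarrow> 'l vertex \<Rightarrow> 3 \<Rightarrow> int \<Rightarrow> 3 \<Rightarrow> int \<Rightarrow> su2" where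
  "sloop x v I s J s' = su2_times (su2_times (su2_times (ohol x v I s) (ohol x (shift v I s) J s'))
     (su2_inv (ohol x (shift v J s') I s))) (su2_inv (ohol x v J s'))"

lemma loop_sloop: "loop x v I s J s' = su2_mat (sloop x v I s J s')"
  by (simp add: loop_def sloop_def hol_ohol su2_times.rep_eq su2_mat_inv)

lemma conj_mult:
  "(su2_mat g ** A ** adj (su2_mat g)) ** (su2_mat g ** B ** adj (su2_mat g))
    = su2_mat g ** (A ** B) ** adj (su2_mat g)"
proof -
  have "(su2_mat g ** A ** adj (su2_mat g)) ** (su2_mat g ** B ** adj (su2_mat g))
      = su2_mat g ** A ** (adj (su2_mat g) ** su2_mat g) ** B ** adj (su2_mat g)"
    by (simp only: matrix_mul_assoc)
  then show ?thesis
    by (simp add: su2_mat_unit' matrix_mul_assoc)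
qed

lemma sum_swap3:
  "(\<Sum>b\<in>B. \<Sum>c\<in>C. \<Sum>i\<in>I. f b c i) = (\<Sum>i\<in>I. \<Sum>b\<in>B. \<Sum>c\<in>C. f b c i :: 'a :: comm_monoid_add)"
proof -
  have "(\<Sum>b\<in>B. \<Sum>c\<in>C. \<Sum>i\<in>I. f b c i) = (\<Sum>b\<in>B. \<Sum>i\<in>I. \<Sum>c\<in>C. f b c i)"
    by (intro sum.cong refl sum.swap)
  also have "\<dots> = (\<Sum>i\<in>I. \<Sum>b\<in>B. \<Sum>c\<in>C. f b c i)"
    by (rule sum.swap)
  finally show ?thesis .
qed

text \<open>A symmetry changes a sign in dependence on its direction, so each sign sum has to stand
  next to the matching direction sum.\<close>

lemma sum_interleave:
  "(\<Sum>s1\<in>S. \<Sum>s2\<in>S. \<Sum>s3\<in>S. \<Sum>I1\<in>I. \<Sum>I2\<in>I. \<Sum>I3\<in>I. X s1 s2 s3 I1 I2 I3)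
    = (\<Sum>s1\<in>S. \<Sum>I1\<in>I. \<Sum>s2\<in>S. \<Sum>I2\<in>I. \<Sum>s3\<in>S. \<Sum>I3\<in>I. X s1 s2 s3 I1 I2 I3 :: 'a :: comm_monoid_add)"
proof -
  have "(\<Sum>s2\<in>S. \<Sum>s3\<in>S. \<Sum>I1\<in>I. \<Sum>I2\<in>I. \<Sum>I3\<in>I. X s1 s2 s3 I1 I2 I3)
      = (\<Sum>I1\<in>I. \<Sum>s2\<in>S. \<Sum>I2\<in>I. \<Sum>s3\<in>S. \<Sum>I3\<in>I. X s1 s2 s3 I1 I2 I3)" for s1
  proof -
    have "(\<Sum>s2\<in>S. \<Sum>s3\<in>S. \<Sum>I1\<in>I. \<Sum>I2\<in>I. \<Sum>I3\<in>I. X s1 s2 s3 I1 I2 I3)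
        = (\<Sum>I1\<in>I. \<Sum>s2\<in>S. \<Sum>s3\<in>S. \<Sum>I2\<in>I. \<Sum>I3\<in>I. X s1 s2 s3 I1 I2 I3)"
      by (rule sum_swap3)
    also have "\<dots> = (\<Sum>I1\<in>I. \<Sum>s2\<in>S. \<Sum>I2\<in>I. \<Sum>s3\<in>S. \<Sum>I3\<in>I. X s1 s2 s3 I1 I2 I3)"
      by (intro sum.cong refl sum.swap)
    finally show ?thesis .
  qed
  then show ?thesis by simp
qed

lemma constr_add: "constr \<kappa> a \<beta> (t + t') v x = constr \<kappa> a \<beta> t v x + constr \<kappa> a \<beta> t' v x"
  unfolding constr_def matrix_add_mult trace_add plus_complex.sel distrib_left sum.distrib ..

lemma constr_scaleR: "constr \<kappa> a \<beta> (c *\<^sub>R t) v x = c * constr \<kappa> a \<beta> t v x"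
  unfolding constr_def matrix_scaleR_mult trace_scaleR scaleR_complex.sel mult.left_commute[of _ c]
    sum_distrib_left[symmetric] ..

lemma constr_tv: "constr \<kappa> a \<beta> (tv y) v x = y \<bullet> (\<chi> i. constr \<kappa> a \<beta> (tau i) v x)"
  by (simp add: tv_def sum_3 constr_add constr_scaleR inner_vec_def)

context lattice_sym
begin

text \<open>The pairs of a sign and a direction label the six edges at a vertex, and a symmetry
  permutes them.\<close>

lemma sum_sym:
  fixes X :: "int \<Rightarrow> int \<Rightarrow> int \<Rightarrow> 3 \<Rightarrow> 3 \<Rightarrow> 3 \<Rightarrow> real"
  shows "(\<Sum>s1\<in>{1, - 1}. \<Sum>s2\<in>{1, - 1}. \<Sum>s3\<in>{1, - 1}. \<Sum>I1\<in>UNIV. \<Sum>I2\<in>UNIV. \<Sum>I3\<in>UNIV.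
      X (sg I1 * s1) (sg I2 * s2) (sg I3 * s3) (\<pi> I1) (\<pi> I2) (\<pi> I3))
    = (\<Sum>s1\<in>{1, - 1}. \<Sum>s2\<in>{1, - 1}. \<Sum>s3\<in>{1, - 1}. \<Sum>I1\<in>UNIV. \<Sum>I2\<in>UNIV. \<Sum>I3\<in>UNIV. X s1 s2 s3 I1 I2 I3)"
proof -
  have one: "(\<Sum>s\<in>{1, - 1}. \<Sum>I\<in>UNIV. f (sg I * s) (\<pi> I)) = (\<Sum>s\<in>{1, - 1}. \<Sum>I\<in>UNIV. f s I)"
    for f :: "int \<Rightarrow> 3 \<Rightarrow> real"
  proof -
    have "(\<Sum>s\<in>{1, - 1}. f (sg I * s) (\<pi> I)) = (\<Sum>s\<in>{1, - 1}. f s (\<pi> I))" for I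
      using sg[of I] by (auto simp: add.commute)
    then have "(\<Sum>s\<in>{1, - 1}. \<Sum>I\<in>UNIV. f (sg I * s) (\<pi> I)) = (\<Sum>I\<in>UNIV. \<Sum>s\<in>{1, - 1}. f s (\<pi> I))"
      by (subst sum.swap) (simp only:)
    also have "\<dots> = (\<Sum>I\<in>UNIV. \<Sum>s\<in>{1, - 1}. f s I)"
      using sum.reindex_bij_betw[OF bij_\<pi>] .
    finally show ?thesis
      by (subst (asm) (2) sum.swap)
  qed
  show ?thesis
    unfolding sum_interleave one[of "\<lambda>s3 I3. X _ _ s3 _ _ I3"]
      one[of "\<lambda>s2 I2. \<Sum>s3\<in>{1, - 1}. \<Sum>I3\<in>UNIV. X _ s2 s3 _ I2 I3"]
    by (rule one)
qed

lemma av_act: "av (act x) v I = of_int (sg I) *\<^sub>R Ad g (av x (R v) (\<pi> I))"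
  using sg[of I] by (auto simp: av_def oflux_act Ad_scaleR Ad_diff simp flip: scaleR_minus_right)

text \<open>The three signs occur twice, once from the averaged fluxes and once from the orientation
  condition on \<open>eps\<close>, and square to 1.\<close>

lemma Q_act: "Q \<beta> a v (act x) = Q \<beta> a (R v) x"
proof -
  have "av (act x) v 1 \<bullet> (av (act x) v 2 \<times> av (act x) v 3)
      = of_int (sg 1 * sg 2 * sg 3) * (av x (R v) (\<pi> 1) \<bullet> (av x (R v) (\<pi> 2) \<times> av x (R v) (\<pi> 3)))"
    by (simp add: av_act cross_mult_left cross_mult_right Ad_cross Ad_inner)
  also have "\<dots> = of_int ((sg 1 * sg 2 * sg 3) * (sg 1 * sg 2 * sg 3))
      * (av x (R v) 1 \<bullet> (av x (R v) 2 \<times> av x (R v) 3))"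
    unfolding triple_eps[of "av x (R v)" "\<pi> 1"] eps_\<pi> by (simp add: eps_def)
  also have "(sg 1 * sg 2 * sg 3) * (sg 1 * sg 2 * sg 3) = 1"
    using sg[of 1] sg[of 2] sg[of 3] by auto
  finally show ?thesis
    by (simp add: Q_av)
qed

lemma Vol_act: "Vol \<beta> a v (act x) = Vol \<beta> a (R v) x"
  by (simp add: Vol_def Q_act)

lemma act_nondeg: "act x \<in> nondeg \<beta> a \<longleftrightarrow> x \<in> nondeg \<beta> a"
proof -
  have "(\<forall>v. Q \<beta> a (R v) x > 0) \<longleftrightarrow> (\<forall>v. Q \<beta> a v x > 0)"
    using bij_R by (metis bij_pointE)
  then show ?thesis
    by (simp add: nondeg_def Q_act)
qed

lemma loop_act:
  assumes "s \<in> {1, - 1}" "s' \<in> {1, - 1}"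
  shows "loop (act x) v I s J s'
    = su2_mat g ** loop x (R v) (\<pi> I) (sg I * s) (\<pi> J) (sg J * s') ** adj (su2_mat g)"
proof -
  have "sloop (act x) v I s J s' = conjug g (sloop x (R v) (\<pi> I) (sg I * s) (\<pi> J) (sg J * s'))"
    unfolding sloop_def ohol_act[OF assms(1)] ohol_act[OF assms(2)] R_shift[OF assms(1)] R_shift[OF assms(2)]
      conjug_times conjug_inv ..
  then show ?thesis
    by (simp add: loop_sloop su2_mat_conjug)
qed

text \<open>\<open>F\<close> and its pull-back \<open>G\<close> are kept apart since the volume at
  \<open>v\<close> becomes the volume at \<open>R v\<close>; for \<open>Kext\<close> they
  coincide.\<close>

lemma hol_bracket_act:
  assumes F: "smooth (nondeg \<beta> a) F" and x: "x \<in> nondeg \<beta> a" and s: "s \<in> {1, - 1}"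
    and FG: "\<And>y. y \<in> nondeg \<beta> a \<Longrightarrow> F (act y) = G y" and G: "smooth (nondeg \<beta> a) G"
  shows "hol_bracket \<kappa> b v I s F (act x)
    = su2_mat g ** hol_bracket \<kappa> b (R v) (\<pi> I) (sg I * s) G x ** adj (su2_mat g)"
proof -
  have "fgrad (\<lambda>y. F (act y)) x = fgrad G x"
    using grad_cong(1)[OF G open_along_nondeg x FG[symmetric]] by blast
  then show ?thesis
    using ograd_act[OF F open_along_nondeg _ s] x
    by (simp add: hol_bracket_ograd act_nondeg tv_Ad matrix_mul_scaleR_right matrix_scaleR_mult)
qed

lemma sg_eps: "of_int (s1 * s2 * s3) * eps I1 I2 I3
    = of_int ((sg I1 * s1) * (sg I2 * s2) * (sg I3 * s3)) * eps (\<pi> I1) (\<pi> I2) (\<pi> I3)"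
  using sg[of I1] sg[of I2] sg[of I3] by (auto simp: eps_\<pi>)

text \<open>Loop and bracket are conjugated by \<open>g\<close> while \<open>t\<close> is not;
  cyclicity of the trace moves the conjugation onto \<open>t\<close>.\<close>

lemma constr_act:
  assumes x: "x \<in> nondeg \<beta> a"
  shows "constr \<kappa> a \<beta> t v (act x) = constr \<kappa> a \<beta> (adj (su2_mat g) ** t ** su2_mat g) (R v) x"
proof -
  define t' where "t' = adj (su2_mat g) ** t ** su2_mat g"
  define X where "X = (\<lambda>s1 s2 s3 I1 I2 I3. of_int (s1 * s2 * s3) * eps I1 I2 I3 *
    Re (trace (t' ** loop x (R v) I1 s1 I2 s2 ** hol_bracket \<kappa> a (R v) I3 s3 (Vol \<beta> a (R v)) x)))"
  have "of_int (s1 * s2 * s3) * eps I1 I2 I3 *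
      Re (trace (t ** loop (act x) v I1 s1 I2 s2 ** hol_bracket \<kappa> a v I3 s3 (Vol \<beta> a v) (act x)))
    = X (sg I1 * s1) (sg I2 * s2) (sg I3 * s3) (\<pi> I1) (\<pi> I2) (\<pi> I3)"
    if s: "s1 \<in> {1, - 1}" "s2 \<in> {1, - 1}" "s3 \<in> {1, - 1}" for s1 s2 s3 I1 I2 I3
  proof -
    let ?A = "loop x (R v) (\<pi> I1) (sg I1 * s1) (\<pi> I2) (sg I2 * s2)"
    let ?B = "hol_bracket \<kappa> a (R v) (\<pi> I3) (sg I3 * s3) (Vol \<beta> a (R v)) x"
    have "trace (t ** loop (act x) v I1 s1 I2 s2 ** hol_bracket \<kappa> a v I3 s3 (Vol \<beta> a v) (act x))
        = trace (t ** (su2_mat g ** (?A ** ?B) ** adj (su2_mat g)))"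
      unfolding matrix_mul_assoc[symmetric, of t] loop_act[OF s(1,2)]
        hol_bracket_act[OF smooth_Vol x s(3) Vol_act smooth_Vol] conj_mult ..
    also have "\<dots> = trace ((t ** su2_mat g ** (?A ** ?B)) ** adj (su2_mat g))"
      by (simp only: matrix_mul_assoc)
    also have "\<dots> = trace (adj (su2_mat g) ** (t ** su2_mat g ** (?A ** ?B)))"
      by (rule trace_mul_sym)
    also have "\<dots> = trace (t' ** ?A ** ?B)"
      by (simp only: t'_def matrix_mul_assoc)
    finally show ?thesis
      unfolding X_def sg_eps[of s1 s2 s3 I1 I2 I3] by simp
  qed
  then have "constr \<kappa> a \<beta> t v (act x) = - (8 / (3 * \<beta> * \<kappa>\<^sup>2)) *
     (\<Sum>s1\<in>{1, - 1}. \<Sum>s2\<in>{1, - 1}. \<Sum>s3\<in>{1, - 1}. \<Sum>I1\<in>UNIV. \<Sum>I2\<in>UNIV. \<Sum>I3\<in>UNIV.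
      X (sg I1 * s1) (sg I2 * s2) (sg I3 * s3) (\<pi> I1) (\<pi> I2) (\<pi> I3))"
    unfolding constr_def by (intro arg_cong2[where f = "(*)"] refl sum.cong) blast
  then show ?thesis
    unfolding sum_sym[of X] unfolding constr_def X_def t'_def .
qed

lemma constr_1_act: "x \<in> nondeg \<beta> a \<Longrightarrow> constr \<kappa> a \<beta> (mat 1) v (act x) = constr \<kappa> a \<beta> (mat 1) (R v) x"
  by (simp add: constr_act su2_mat_unit')

text \<open>The three components form a vector that is rotated by \<open>Ad g\<close>, and a
  rotation preserves its length.\<close>

lemma constr_tau_act:
  "x \<in> nondeg \<beta> a \<Longrightarrow> (\<Sum>j\<in>UNIV. (constr \<kappa> a \<beta> (tau j) v (act x))\<^sup>2) = (\<Sum>j\<in>UNIV. (constr \<kappa> a \<beta> (tau j) (R v) x)\<^sup>2)"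
proof -
  assume x: "x \<in> nondeg \<beta> a"
  define c where "c = (\<chi> i. constr \<kappa> a \<beta> (tau i) (R v) x)"
  have "adj (su2_mat g) ** tau j ** su2_mat g = tv (Ad (su2_inv g) (axis j 1))" for j
    by (simp add: tv_Ad su2_inv.rep_eq adj_adj_su2 tv_axis)
  then have "constr \<kappa> a \<beta> (tau j) v (act x) = Ad g c $ j" for j
    using inner_Ad[of "su2_inv g" "axis j 1" c] by (simp add: constr_act x constr_tv c_def[symmetric] inner_axis')
  moreover have "(\<Sum>j\<in>UNIV. (y $ j)\<^sup>2) = y \<bullet> y" for y :: "real^3"
    by (simp add: inner_vec_def power2_eq_square)
  ultimately have "(\<Sum>j\<in>UNIV. (constr \<kappa> a \<beta> (tau j) v (act x))\<^sup>2) = c \<bullet> c"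
    by (simp add: Ad_inner)
  also have "c \<bullet> c = (\<Sum>j\<in>UNIV. (constr \<kappa> a \<beta> (tau j) (R v) x)\<^sup>2)"
    by (simp add: inner_vec_def power2_eq_square c_def)
  finally show ?thesis .
qed

text \<open>Sums over all vertices absorb the permutation \<open>R\<close>, and \<open>act\<close>
  preserves the bracket; \<open>poisson_cong\<close> is needed because invariance is available on
  \<open>nondeg\<close> only.\<close>

lemma Kext_act:
  assumes x: "x \<in> nondeg \<beta> a"
  shows "Kext \<kappa> a \<beta> (act x) = Kext \<kappa> a \<beta> x"
proof -
  let ?C = "\<lambda>y. \<Sum>v\<in>UNIV. constr \<kappa> a \<beta> (mat 1) v y" and ?V = "\<lambda>y. \<Sum>v\<in>UNIV. Vol \<beta> a v y"
  have C: "smooth (nondeg \<beta> a) ?C" and V: "smooth (nondeg \<beta> a) ?V"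
    by (intro smooth_sum smooth_constr smooth_Vol)+
  have "?C (act y) = ?C y" if "y \<in> nondeg \<beta> a" for y
    using sum.reindex_bij_betw[OF bij_R, of "\<lambda>v. constr \<kappa> a \<beta> (mat 1) v y"] that
    by (simp add: constr_1_act)
  moreover have "?V (act y) = ?V y" for y
    using sum.reindex_bij_betw[OF bij_R, of "\<lambda>v. Vol \<beta> a v y"] by (simp add: Vol_act)
  ultimately have "poisson \<kappa> a ?C ?V (act x) = poisson \<kappa> a ?C ?V x"
    unfolding poisson_act[OF C V open_along_nondeg act_nondeg[THEN iffD2, OF x]]
    by (intro poisson_cong[OF C V open_along_nondeg x]) simp_all
  then show ?thesis
    by (simp add: Kext_def)
qed

lemma constr_L_act:
  assumes x: "x \<in> nondeg \<beta> a"
  shows "constr_L \<kappa> a \<beta> v (act x) = constr_L \<kappa> a \<beta> (R v) x"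
proof -
  define X where "X = (\<lambda>s1 s2 s3 I1 I2 I3. of_int (s1 * s2 * s3) * eps I1 I2 I3 *
    Re (trace (hol_bracket \<kappa> a (R v) I1 s1 (Kext \<kappa> a \<beta>) x ** hol_bracket \<kappa> a (R v) I2 s2 (Kext \<kappa> a \<beta>) x
      ** hol_bracket \<kappa> a (R v) I3 s3 (Vol \<beta> a (R v)) x)))"
  have K: "hol_bracket \<kappa> a v I s (Kext \<kappa> a \<beta>) (act x)
      = su2_mat g ** hol_bracket \<kappa> a (R v) (\<pi> I) (sg I * s) (Kext \<kappa> a \<beta>) x ** adj (su2_mat g)"
    if "s \<in> {1, - 1}" for I s
    by (rule hol_bracket_act[OF smooth_Kext x that Kext_act smooth_Kext])
  have "of_int (s1 * s2 * s3) * eps I1 I2 I3 *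
      Re (trace (hol_bracket \<kappa> a v I1 s1 (Kext \<kappa> a \<beta>) (act x) ** hol_bracket \<kappa> a v I2 s2 (Kext \<kappa> a \<beta>) (act x)
      ** hol_bracket \<kappa> a v I3 s3 (Vol \<beta> a v) (act x)))
    = X (sg I1 * s1) (sg I2 * s2) (sg I3 * s3) (\<pi> I1) (\<pi> I2) (\<pi> I3)"
    if s: "s1 \<in> {1, - 1}" "s2 \<in> {1, - 1}" "s3 \<in> {1, - 1}" for s1 s2 s3 I1 I2 I3
    unfolding hol_bracket_act[OF smooth_Vol x s(3) Vol_act smooth_Vol]
      K[OF s(1)] K[OF s(2)] conj_mult
      trace_conj[OF su2_mat_unit'] X_def sg_eps[of s1 s2 s3 I1 I2 I3] ..
  then have "constr_L \<kappa> a \<beta> v (act x) = 128 / (3 * \<beta> ^ 3 * \<kappa> ^ 4) *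
     (\<Sum>s1\<in>{1, - 1}. \<Sum>s2\<in>{1, - 1}. \<Sum>s3\<in>{1, - 1}. \<Sum>I1\<in>UNIV. \<Sum>I2\<in>UNIV. \<Sum>I3\<in>UNIV.
      X (sg I1 * s1) (sg I2 * s2) (sg I3 * s3) (\<pi> I1) (\<pi> I2) (\<pi> I3))"
    unfolding constr_L_def by (intro arg_cong2[where f = "(*)"] refl sum.cong) blast
  then show ?thesis
    unfolding sum_sym[of X] unfolding constr_L_def X_def .
qed

lemma constr_GT_act: "x \<in> nondeg \<beta> a \<Longrightarrow> constr_GT \<kappa> a \<beta> v (act x) = constr_GT \<kappa> a \<beta> (R v) x"
  by (simp add: constr_GT_def constr_1_act constr_L_act)

end

section \<open>Homogeneous isotropic data\<close>

definition homog :: "real \<Rightarrow> real \<Rightarrow> 'l::nontriv phase" where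
  "homog \<theta> p = (\<lambda>(v, I). su2_exp (\<theta> *\<^sub>R axis I 1), \<lambda>(v, I). p *\<^sub>R axis I 1)"

lemma ohol_homog: "s \<in> {1, - 1} \<Longrightarrow> ohol (homog \<theta> p) v I s = su2_exp ((of_int s * \<theta>) *\<^sub>R axis I 1)"
  by (auto simp: ohol_def homog_def simp flip: su2_exp_uminus)

lemma ofield_homog:
  assumes "s \<in> {1, - 1}" "b (v, I) = c *\<^sub>R axis I 1" "b (shift v I (- 1), I) = c *\<^sub>R axis I 1"
  shows "ofield (homog \<theta> p) b v I s = (of_int s * c) *\<^sub>R axis I 1"
  using assms Ad_exp_axis[of "- \<theta>" I]
  by (auto simp: ofield_def ohol_homog Ad_scaleR)

lemma oflux_homog: "s \<in> {1, - 1} \<Longrightarrow> oflux (homog \<theta> p) v I s = (of_int s * p) *\<^sub>R axis I 1"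
  by (rule ofield_homog) (simp_all add: homog_def)

text \<open>Homogeneous data lock spatial directions to su(2) directions, so \<open>g\<close> has to
  undo what the lattice map does to the axes.\<close>

locale homog_sym = lattice_sym R \<pi> sg g
  for R :: "'l::nontriv vertex \<Rightarrow> 'l vertex" and \<pi> sg g +
  assumes Ad_axis: "Ad g (axis (\<pi> I) 1) = of_int (sg I) *\<^sub>R axis I 1"
begin

lemma act_homog: "act (homog \<theta> p) = homog \<theta> p"
proof -
  have s: "real_of_int (sg I) * real_of_int (sg I) = 1" for I
    using sg[of I] by auto
  have "conjug g (ohol (homog \<theta> p) (R v) (\<pi> I) (sg I)) = su2_exp (\<theta> *\<^sub>R axis I 1)" for v I
    unfolding ohol_homog[OF sg] conjug_def su2_exp_Ad[symmetric]
    using s[of I] by (simp add: Ad_scaleR Ad_axis mult.assoc mult.left_commute[of _ \<theta>])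
  moreover have "Ad g (oflux (homog \<theta> p) (R v) (\<pi> I) (sg I)) = p *\<^sub>R axis I 1" for v I
    unfolding oflux_homog[OF sg]
    using s[of I] by (simp add: Ad_scaleR Ad_axis mult.assoc mult.left_commute[of _ p])
  ultimately show ?thesis
    by (simp add: act_def homog_def)
qed

text \<open>With \<open>sg I = 1\<close> the correction term in the holonomy gradient is absent, so
  both gradients obey one law; edges in other directions may still be reversed.\<close>

lemma grad_homog:
  assumes F: "smooth U F" and U: "open_along U" "homog \<theta> p \<in> U"
    and inv: "\<And>y. y \<in> U \<Longrightarrow> F (act y) = F y" and I: "sg I = 1"
  shows "fgrad F (homog \<theta> p) (R v, \<pi> I) = Ad (su2_inv g) (fgrad F (homog \<theta> p) (v, I))"
    and "hgrad F (homog \<theta> p) (R v, \<pi> I) = Ad (su2_inv g) (hgrad F (homog \<theta> p) (v, I))"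
proof -
  have x: "act (homog \<theta> p) \<in> U"
    using U by (simp add: act_homog)
  note c = grad_cong[OF F U inv[symmetric]] and a = grad_act[OF F U(1) x, of "(v, I)"]
  show "fgrad F (homog \<theta> p) (R v, \<pi> I) = Ad (su2_inv g) (fgrad F (homog \<theta> p) (v, I))"
    "hgrad F (homog \<theta> p) (R v, \<pi> I) = Ad (su2_inv g) (hgrad F (homog \<theta> p) (v, I))"
    using a I by (simp_all add: c act_homog src_def rot_def sgn_edge_def)
qed

end

section \<open>Symmetries of homogeneous isotropic data\<close>

lemma homog_sym_translation: "homog_sym (\<lambda>u :: 'l::nontriv vertex. u + w) (\<lambda>I. I) (\<lambda>_. 1) su2_one"
proof unfold_locales
  show "bij (\<lambda>u. u + w)"
    by (rule bij_plus_right)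
qed (auto simp: shift_def bij_def algebra_simps)

lemma homog_sym_cyclic:
  obtains g where "homog_sym (\<lambda>u :: 'l::nontriv vertex. \<chi> i. u $ (i - 1)) (\<lambda>I. I + 1) (\<lambda>_. 1) g"
proof -
  \<comment> \<open>The unit quaternion of the rotation by -2 pi/3 about the diagonal (1,1,1). It
    sends each axis to its predecessor, while the lattice map sends it to its successor; indices of
    type \<open>3\<close> wrap around.\<close>
  define y :: "real^3" where "y = vector [- 1/2, - 1/2, - 1/2]"
  have "(1 / 2)\<^sup>2 + y \<bullet> y = 1"
    by (simp add: y_def inner_vec_def sum_3 power2_eq_square)
  then obtain g where g: "su2_mat g = quat (1 / 2) y"
    using su2_quat_ex by blast
  have "homog_sym (\<lambda>u :: 'l vertex. \<chi> i. u $ (i - 1)) (\<lambda>I. I + 1) (\<lambda>_. 1) g"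
  proof unfold_locales
    have "inj (\<lambda>u :: 'l vertex. \<chi> i. u $ (i - 1))"
    proof (rule injI)
      fix u v :: "'l vertex"
      assume E: "(\<chi> i. u $ (i - 1)) = (\<chi> i. v $ (i - 1))"
      have "u $ j = v $ j" for j
        using arg_cong[OF E, of "\<lambda>z. z $ (j + 1)"] by simp
      then show "u = v"
        by (simp add: vec_eq_iff)
    qed
    then show "bij (\<lambda>u :: 'l vertex. \<chi> i. u $ (i - 1))"
      by (simp add: bij_def finite_UNIV_inj_surj)
    show "bij (\<lambda>I :: 3. I + 1)"
      by (rule bij_plus_right)
    show "(\<chi> i. shift v I s $ (i - 1)) = shift (\<chi> i. v $ (i - 1)) (I + 1) (1 * s)" for v :: "'l vertex" and I s
      by (auto simp: shift_def vec_eq_iff axis_def diff_eq_eq)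
    have "\<forall>I J K. eps (I + 1) (J + 1) (K + 1) = eps I J K"
      unfolding forall_3 by (simp add: eps_def)
    then show "eps (I + 1) (J + 1) (K + 1) = of_int (1 * 1 * 1) * eps I J K" for I J K
      by simp
    have "Ad g (axis (I + 1) 1) = axis I 1" for I
      using exhaust_3[of I]
      by (intro Ad_eqI, simp only: g adj_quat tv_quat quat_mult quat_eq_iff)
        (auto simp: y_def vec_eq_iff forall_3 cross3_def inner_vec_def sum_3 axis_def)
    then show "Ad g (axis (I + 1) 1) = of_int 1 *\<^sub>R axis I 1" for I
      by simp
  qed simp
  then show thesis
    using that by blast
qed

text \<open>These symmetries, unlike the previous two, reverse edges; they are what kills the transversal
  derivatives.\<close>

lemma homog_sym_rotation:
  fixes v :: "'l::nontriv vertex" and K :: 3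
  obtains g where "homog_sym (\<lambda>u. \<chi> i. if i = K then u $ i else 2 * v $ i - u $ i) (\<lambda>I. I)
      (\<lambda>I. if I = K then 1 else - 1) g"
    and "Ad g = (\<lambda>y. (2 * y $ K) *\<^sub>R axis K 1 - y)"
proof -
  \<comment> \<open>The half-turn about the line through \<open>v\<close> in direction
    \<open>K\<close>; its su(2) counterpart is the pure quaternion \<open>axis K 1\<close>.\<close>
  let ?R = "\<lambda>u :: 'l vertex. \<chi> i. if i = K then u $ i else 2 * v $ i - u $ i"
  have "0\<^sup>2 + axis K 1 \<bullet> (axis K 1 :: real^3) = 1"
    by (simp add: inner_axis_axis)
  then obtain g where g: "su2_mat g = quat 0 (axis K 1)"
    using su2_quat_ex by blast
  have Ad: "Ad g y = (2 * y $ K) *\<^sub>R axis K 1 - y" for y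
    using exhaust_3[of K]
    by (intro Ad_eqI, simp only: g adj_quat tv_quat quat_mult quat_eq_iff)
      (auto simp: vec_eq_iff forall_3 cross3_def inner_vec_def sum_3 axis_def)
  have "homog_sym ?R (\<lambda>I. I) (\<lambda>I. if I = K then 1 else - 1) g"
  proof unfold_locales
    show "bij ?R"
      by (rule involuntory_imp_bij) (simp add: vec_eq_iff)
    show "?R (shift u I s) = shift (?R u) I ((if I = K then 1 else - 1) * s)" for u I s
      by (auto simp: shift_def vec_eq_iff axis_def)
    have "\<forall>K I J L. eps I J L = of_int ((if I = K then 1 else - 1) * (if J = K then 1 else - 1)
        * (if L = K then 1 else - 1)) * eps I J L"
      unfolding forall_3 by (simp add: eps_def)
    then show "eps I J L = of_int ((if I = K then 1 else - 1) * (if J = K then 1 else - 1)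
        * (if L = K then 1 else - 1)) * eps I J L" for I J L
      by blast
    show "Ad g (axis I 1) = of_int (if I = K then 1 else - 1) *\<^sub>R axis I 1" for I
      by (auto simp: Ad vec_eq_iff axis_def)
  qed (auto simp: bij_def)
  moreover have "Ad g = (\<lambda>y. (2 * y $ K) *\<^sub>R axis K 1 - y)"
    using Ad by blast
  ultimately show thesis
    by (rule that)
qed

definition sym_fun :: "'l::nontriv phase set \<Rightarrow> ('l phase \<Rightarrow> real) \<Rightarrow> bool" where
  "sym_fun U F \<longleftrightarrow> smooth U F \<and> (\<forall>R \<pi> sg g. homog_sym R \<pi> sg g \<longrightarrow>
     (\<forall>x\<in>U. F (lattice_sym.act R \<pi> sg g x) = F x))"

lemma sym_fun_grad_ex:
  fixes F :: "'l::nontriv phase \<Rightarrow> real"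
  assumes F: "sym_fun U F" and U: "open_along U" "homog \<theta> p \<in> U"
  obtains c d :: real where "\<And>v I. fgrad F (homog \<theta> p) (v, I) = c *\<^sub>R axis I 1"
    and "\<And>v I. hgrad F (homog \<theta> p) (v, I) = d *\<^sub>R axis I 1"
proof -
  let ?x = "homog \<theta> p :: 'l phase"
  have S: "smooth U F" and inv: "\<And>R \<pi> sg g y. homog_sym R \<pi> sg g \<Longrightarrow> y \<in> U \<Longrightarrow> F (lattice_sym.act R \<pi> sg g y) = F y"
    using F by (auto simp: sym_fun_def)
  have *: "\<exists>c. \<forall>v I. G (v, I) = c *\<^sub>R axis I 1"
    if G: "\<And>R \<pi> sg g v I. homog_sym R \<pi> sg g \<Longrightarrow> sg I = 1 \<Longrightarrow> G (R v, \<pi> I) = Ad (su2_inv g) (G (v, I))"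
    for G :: "'l edge \<Rightarrow> real^3"
  proof -
    \<comment> \<open>The half-turn about the edge itself fixes this edge with its orientation but
      negates the transversal components of \<open>G\<close>.\<close>
    have ax: "G (v, K) = (G (v, K) $ K) *\<^sub>R axis K 1" for v K
    proof -
      let ?R = "\<lambda>u. \<chi> i. if i = K then u $ i else 2 * v $ i - u $ i"
      obtain g where g: "homog_sym ?R (\<lambda>I. I) (\<lambda>I. if I = K then 1 else - 1) g"
        "Ad g = (\<lambda>y. (2 * y $ K) *\<^sub>R axis K 1 - y)"
        by (rule homog_sym_rotation[of K v])
      have "?R v = v"
        by (simp add: vec_eq_iff)
      then have "G (v, K) = Ad (su2_inv g) (G (v, K))"
        using G[OF g(1), where v = v and I = K] by simp
      then have "Ad g (G (v, K)) = G (v, K)"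
        by (metis Ad_inv(2))
      then show ?thesis
        by (auto simp: g(2) vec_eq_iff axis_def split: if_splits)
    qed
    have tr: "G (v, I) = G (0, I)" for v I
      using G[OF homog_sym_translation[of v], where v = 0 and I = I]
      by (simp add: su2_inv_unique[of su2_one su2_one])
    have cyc: "G (0, I + 1) $ (I + 1) = G (0, I) $ I" for I
    proof -
      obtain g where g: "homog_sym (\<lambda>u :: 'l vertex. \<chi> i. u $ (i - 1)) (\<lambda>I. I + 1) (\<lambda>_. 1) g"
        by (rule homog_sym_cyclic)
      interpret homog_sym "\<lambda>u :: 'l vertex. \<chi> i. u $ (i - 1)" "\<lambda>I. I + 1" "\<lambda>_. 1" g
        by (rule g)
      have "G (0, I + 1) = Ad (su2_inv g) (G (0, I))"
        using G[OF g, where v = 0 and I = I] tr[of "\<chi> i. 0 $ (i - 1)"] by simp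
      then have "G (0, I + 1) = (G (0, I) $ I) *\<^sub>R Ad (su2_inv g) (axis I 1)"
        by (subst (asm) ax) (simp add: Ad_scaleR)
      moreover have "Ad (su2_inv g) (axis I 1) = axis (I + 1) 1"
        using Ad_axis[of I] by (metis Ad_inv(1) of_int_1 scaleR_one)
      ultimately show ?thesis
        by simp
    qed
    have "G (0, 2) $ 2 = G (0, 1) $ 1" "G (0, 3) $ 3 = G (0, 2) $ 2"
      using cyc[of 1] cyc[of 2] by simp_all
    then have "G (0, I) $ I = G (0, 1) $ 1" for I
      using exhaust_3[of I] by auto
    then show ?thesis
      using ax tr by metis
  qed
  have "fgrad F ?x (R v, \<pi> I) = Ad (su2_inv g) (fgrad F ?x (v, I))"
    "hgrad F ?x (R v, \<pi> I) = Ad (su2_inv g) (hgrad F ?x (v, I))"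
    if h: "homog_sym R \<pi> sg g" "sg I = 1" for R \<pi> sg g v I
    using homog_sym.grad_homog[OF h(1) S U inv[OF h(1)] h(2)] by simp_all
  then obtain c d where "\<forall>v I. fgrad F ?x (v, I) = c *\<^sub>R axis I 1" "\<forall>v I. hgrad F ?x (v, I) = d *\<^sub>R axis I 1"
    using *[of "fgrad F ?x"] *[of "hgrad F ?x"] by blast
  then show thesis
    using that by blast
qed

subsection \<open>Perturbations\<close>

text \<open>Increments along the axis commute with the base point, so the exponential is
  differentiated as in one variable.\<close>

lemma su2_exp_axis_derivative:
  assumes "(a has_real_derivative a') (at 0)" "a 0 = 0"
  shows "((\<lambda>t. su2_mat (su2_exp ((\<theta> + a t) *\<^sub>R axis I 1))) has_vector_derivative
    (1 / 2) *\<^sub>R (tv (a' *\<^sub>R axis I 1) ** su2_mat (su2_exp (\<theta> *\<^sub>R axis I 1)))) (at 0)"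
proof -
  have "((\<lambda>t. cos ((\<theta> + a t) / 2) *\<^sub>R mat 1 + sin ((\<theta> + a t) / 2) *\<^sub>R tau I) has_vector_derivative
      (- (a' / 2) * sin (\<theta> / 2)) *\<^sub>R mat 1 + (a' / 2 * cos (\<theta> / 2)) *\<^sub>R tau I) (at 0)"
    using assms
    by (auto intro!: derivative_eq_intros simp: has_real_derivative_iff_has_vector_derivative[symmetric] mult.commute)
  moreover have "(- (a' / 2) * sin (\<theta> / 2)) *\<^sub>R mat 1 + (a' / 2 * cos (\<theta> / 2)) *\<^sub>R tau I
      = (1 / 2) *\<^sub>R (tv (a' *\<^sub>R axis I 1) ** su2_mat (su2_exp (\<theta> *\<^sub>R axis I 1)))"
    by (simp add: su2_exp_axis tv_quat quat_mult quat_scaleR mat1_quat tau_quat quat_add quat_eq_iff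
        inner_axis_axis cross_mult_left cross_mult_right)
  ultimately show ?thesis
    by (simp add: su2_exp_axis quat_def tv_scaleR tv_axis)
qed

lemma axis0: "axis b 0 = (0 :: real^3)"
  by (simp add: vec_eq_iff axis_def)

text \<open>Transversal angles are left out here: they do not commute with the homogeneous holonomy
  and require the derivative of the exponential off the axis.\<close>

lemma tangent_perturbed:
  fixes c :: "real \<Rightarrow> 'l::nontriv edge \<Rightarrow> real^3"
  assumes a: "\<And>e. ((\<lambda>t. a t e) has_real_derivative a' e) (at 0)" "\<And>e. a 0 e = 0"
    and b: "\<And>e. ((\<lambda>t. b t e) has_real_derivative b' e) (at 0)" "\<And>e. b 0 e = 0"
    and c: "\<And>e. ((\<lambda>t. c t e) has_vector_derivative c' e) (at 0)" "\<And>e. c 0 e = 0"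
  shows "tangent (\<lambda>t. perturbed \<theta> p (a t) (\<lambda>_. 0) (b t) (c t)) (homog \<theta> p)
    (\<lambda>e. a' e *\<^sub>R axis (snd e) 1) (\<lambda>e. b' e *\<^sub>R axis (snd e) 1 + c' e)"
proof -
  have "((\<lambda>t. (p + b t e) *\<^sub>R axis I 1 + c t e) has_vector_derivative b' e *\<^sub>R axis I 1 + c' e) (at 0)"
    for e and I :: 3
    using b(1)[of e] c(1)[of e] by (auto intro!: derivative_eq_intros)
  then show ?thesis
    using su2_exp_axis_derivative[OF a] by (simp add: tangent_def perturbed_def homog_def a b c)
qed

text \<open>Since gradients of invariant functions are parallel to the edge, all that matters about
  the velocity \<open>u\<close> is that it has no component along \<open>I\<close>.\<close>

lemma tangent_perturbed_theta_perp:
  fixes v :: "'l::nontriv vertex"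
  assumes bI: "b \<noteq> I" and \<theta>: "\<theta> \<noteq> 0"
  obtains u where "u $ I = 0"
    and "tangent (\<lambda>t. perturbed \<theta> p (\<lambda>_. 0) ((\<lambda>_. 0)((v, I) := axis b t)) (\<lambda>_. 0) (\<lambda>_. 0))
      (homog \<theta> p) ((\<lambda>_. 0)((v, I) := u)) (\<lambda>_. 0)"
proof -
  \<comment> \<open>A transversal increment changes the norm only at second order;
    \<open>\<theta> \<noteq> 0\<close> makes \<open>r\<close> differentiable at 0.\<close>
  define r where "r = (\<lambda>t. sqrt (\<theta>\<^sup>2 + t\<^sup>2))"
  define k where "k = (\<lambda>t. sin (r t / 2) / r t)"
  define A B :: "real^3" where "A = axis I 1" and "B = axis b 1"
  \<comment> \<open>Obtained by solving (1/2) u h = \<open>k 0\<close> B for \<open>u\<close>, that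
    is, u = 2 \<open>k 0\<close> B h^{-1} with h^{-1} = cos(\<theta>/2) - sin(\<theta>/2) A.\<close>
  define u where "u = (2 * k 0) *\<^sub>R (cos (\<theta> / 2) *\<^sub>R B - sin (\<theta> / 2) *\<^sub>R (B \<times> A))"
  have AB: "A \<bullet> A = 1" "B \<bullet> B = 1" "A \<bullet> B = 0"
    using bI by (auto simp: A_def B_def inner_axis_axis)
  have norm: "norm (\<theta> *\<^sub>R A + t *\<^sub>R B) = r t" for t
    by (simp add: norm_eq_sqrt_inner r_def inner_add_left inner_add_right AB inner_commute[of B A] power2_eq_square)
  have r0: "r 0 = \<bar>\<theta>\<bar>" "r 0 \<noteq> 0"
    using \<theta> by (simp_all add: r_def)
  have k0: "k 0 * \<theta> = sin (\<theta> / 2)"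
    using \<theta> by (simp add: k_def r0 abs_if)
  have r': "(r has_real_derivative 0) (at 0)"
    unfolding r_def using \<theta> by (auto intro!: derivative_eq_intros)
  have k': "(k has_real_derivative 0) (at 0)"
    unfolding k_def using r0 by (auto intro!: derivative_eq_intros r')
  have c': "((\<lambda>t. cos (r t / 2)) has_real_derivative 0) (at 0)"
    by (auto intro!: derivative_eq_intros r')
  have "axis b t = t *\<^sub>R B" for t
    by (simp add: B_def vec_eq_iff axis_def)
  then have E: "su2_mat (su2_exp (\<theta> *\<^sub>R axis I 1 + axis b t)) = cos (r t / 2) *\<^sub>R mat 1 + (k t) *\<^sub>R (\<theta> *\<^sub>R tv A + t *\<^sub>R tv B)" for t
    using norm[of t] by (simp add: su2_exp_quat quat_def k_def tv_scaleR tv_add flip: A_def)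
  have D: "((\<lambda>t. su2_mat (su2_exp (\<theta> *\<^sub>R axis I 1 + axis b t))) has_vector_derivative k 0 *\<^sub>R tv B) (at 0)"
    unfolding E using k' r'
    by (auto intro!: derivative_eq_intros simp: has_real_derivative_iff_has_vector_derivative[symmetric])
  have BAA: "(B \<times> A) \<times> A = - B"
  proof -
    have "(B \<times> A) \<times> A = (A \<bullet> B) *\<^sub>R A - (A \<bullet> A) *\<^sub>R B"
      by (simp add: cross3_simps forall_3)
    then show ?thesis
      by (simp add: AB)
  qed
  have uA: "u \<bullet> A = 0"
    by (simp add: u_def inner_diff_left AB inner_commute[of B A] dot_cross_self)
  have "cos (\<theta> / 2) *\<^sub>R u + sin (\<theta> / 2) *\<^sub>R (u \<times> A)
      = (2 * k 0 * (cos (\<theta> / 2))\<^sup>2) *\<^sub>R B + (2 * k 0 * (sin (\<theta> / 2))\<^sup>2) *\<^sub>R B"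
    unfolding u_def cross_mult_left Cross3.left_diff_distrib BAA
    by (simp add: algebra_simps power2_eq_square)
  also have "\<dots> = (2 * k 0) *\<^sub>R B"
    by (simp flip: scaleR_add_left distrib_left)
  finally have "(1 / 2) *\<^sub>R (tv u ** su2_mat (su2_exp (\<theta> *\<^sub>R axis I 1))) = k 0 *\<^sub>R tv B"
    using uA unfolding su2_exp_axis unfolding A_def[symmetric] tv_quat quat_mult quat_scaleR quat_eq_iff
    by (simp add: cross_mult_right)
  then have "tangent (\<lambda>t. perturbed \<theta> p (\<lambda>_. 0) ((\<lambda>_. 0)((v, I) := axis b t)) (\<lambda>_. 0) (\<lambda>_. 0))
      (homog \<theta> p) ((\<lambda>_. 0)((v, I) := u)) (\<lambda>_. 0)"
    using D by (auto simp: tangent_def perturbed_def homog_def axis0)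
  moreover have "u $ I = 0"
    using uA by (simp add: A_def inner_axis)
  ultimately show thesis
    using that by blast
qed

text \<open>Everything is the chain rule with a gradient parallel to the edges: moving all 3|V|
  edges adds up equal terms, moving one in parallel gives \<open>c\<close> or \<open>d\<close>, and
  transversal velocities are orthogonal to the gradient.\<close>

lemma sym_fun_grad:
  fixes F :: "'l::nontriv phase \<Rightarrow> real"
  assumes F: "sym_fun U F" and U: "open_along U" "homog \<theta> p \<in> U"
  obtains c d :: real where "\<And>v I. fgrad F (homog \<theta> p) (v, I) = c *\<^sub>R axis I 1"
    and "\<And>v I. hgrad F (homog \<theta> p) (v, I) = d *\<^sub>R axis I 1"
    and "((\<lambda>q. F (homog \<theta> q)) has_real_derivative 3 * real CARD('l vertex) * c) (at p)"
    and "((\<lambda>u. F (homog u p)) has_real_derivative 3 * real CARD('l vertex) * d) (at \<theta>)"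
    and "\<And>e. has_partial_p_par F \<theta> p e c" and "\<And>e. has_partial_theta_par F \<theta> p e d"
    and "\<And>v I b. b \<noteq> I \<Longrightarrow> has_partial_p_perp F \<theta> p (v, I) b 0"
    and "\<And>v I b. b \<noteq> I \<Longrightarrow> \<theta> \<noteq> 0 \<Longrightarrow> has_partial_theta_perp F \<theta> p (v, I) b 0"
proof -
  let ?x = "homog \<theta> p :: 'l phase"
  obtain c d where f: "\<And>v I. fgrad F ?x (v, I) = c *\<^sub>R axis I 1" and h: "\<And>v I. hgrad F ?x (v, I) = d *\<^sub>R axis I 1"
    using sym_fun_grad_ex[OF F U] by blast
  have f': "fgrad F ?x e = c *\<^sub>R axis (snd e) 1" and h': "hgrad F ?x e = d *\<^sub>R axis (snd e) 1" for e
    using f h by (cases e; simp)+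
  have S: "smooth U F"
    using F by (simp add: sym_fun_def)
  note chain = smooth_chain[OF S U]
  have card: "card (UNIV :: 'l edge set) = 3 * CARD('l vertex)"
    by (simp add: card_prod)
  have upd0: "(\<lambda>_. 0)(e := 0) = (\<lambda>_. 0)" for e :: "'l edge"
    by auto
  show thesis
  proof (rule that[OF f h])
    have "((\<lambda>t. F (perturbed \<theta> p (\<lambda>_. 0) (\<lambda>_. 0) (\<lambda>_. t) (\<lambda>_. 0))) has_real_derivative 3 * real CARD('l vertex) * c) (at 0)"
      using chain[OF tangent_perturbed[of "\<lambda>_ _. 0" "\<lambda>_. 0" "\<lambda>t _. t" "\<lambda>_. 1" "\<lambda>_ _. 0" "\<lambda>_. 0"]]
      by (simp add: f' h' inner_axis_axis card mult_ac)
    moreover have "perturbed \<theta> p (\<lambda>_. 0) (\<lambda>_. 0) (\<lambda>_. t) (\<lambda>_. 0) = (homog \<theta> (t + p) :: 'l phase)" for t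
      by (simp add: perturbed_def homog_def add.commute)
    ultimately show "((\<lambda>q. F (homog \<theta> q)) has_real_derivative 3 * real CARD('l vertex) * c) (at p)"
      using DERIV_shift[of "\<lambda>q. F (homog \<theta> q)" _ 0 p] by simp
    have "((\<lambda>t. F (perturbed \<theta> p (\<lambda>_. t) (\<lambda>_. 0) (\<lambda>_. 0) (\<lambda>_. 0))) has_real_derivative 3 * real CARD('l vertex) * d) (at 0)"
      using chain[OF tangent_perturbed[of "\<lambda>t _. t" "\<lambda>_. 1" "\<lambda>_ _. 0" "\<lambda>_. 0" "\<lambda>_ _. 0" "\<lambda>_. 0"]]
      by (simp add: f' h' inner_axis_axis card mult_ac)
    moreover have "perturbed \<theta> p (\<lambda>_. t) (\<lambda>_. 0) (\<lambda>_. 0) (\<lambda>_. 0) = (homog (t + \<theta>) p :: 'l phase)" for t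
      by (simp add: perturbed_def homog_def add.commute)
    ultimately show "((\<lambda>u. F (homog u p)) has_real_derivative 3 * real CARD('l vertex) * d) (at \<theta>)"
      using DERIV_shift[of "\<lambda>u. F (homog u p)" _ 0 \<theta>] by simp
    fix e :: "'l edge"
    define \<delta> where "\<delta> = (\<lambda>e'. if e' = e then 1 else 0 :: real)"
    have \<delta>: "((\<lambda>t. ((\<lambda>_. 0)(e := t)) e') has_real_derivative \<delta> e') (at 0)" for e'
      by (auto simp: \<delta>_def)
    have \<delta>_sum: "(\<Sum>e'\<in>UNIV. (\<delta> e' *\<^sub>R axis (snd e') 1) \<bullet> (k *\<^sub>R (axis (snd e') 1 :: real^3))) = k" for k
    proof -
      have "(\<Sum>e'\<in>UNIV. (\<delta> e' *\<^sub>R axis (snd e') 1) \<bullet> (k *\<^sub>R (axis (snd e') 1 :: real^3)))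
          = (\<Sum>e'\<in>UNIV. if e' = e then k else 0)"
        by (rule sum.cong) (auto simp: \<delta>_def inner_axis_axis)
      then show ?thesis by simp
    qed
    show "has_partial_p_par F \<theta> p e c"
      using chain[OF tangent_perturbed[of "\<lambda>_ _. 0" "\<lambda>_. 0" "\<lambda>t. (\<lambda>_. 0)(e := t)" \<delta> "\<lambda>_ _. 0" "\<lambda>_. 0"]] \<delta> \<delta>_sum[of c]
      by (simp add: has_partial_p_par_def f' h' upd0 del: fun_upd_apply)
    show "has_partial_theta_par F \<theta> p e d"
      using chain[OF tangent_perturbed[of "\<lambda>t. (\<lambda>_. 0)(e := t)" \<delta> "\<lambda>_ _. 0" "\<lambda>_. 0" "\<lambda>_ _. 0" "\<lambda>_. 0"]] \<delta> \<delta>_sum[of d]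
      by (simp add: has_partial_theta_par_def f' h' upd0 del: fun_upd_apply)
  next
    fix v :: "'l vertex" and I b :: 3 assume bI: "b \<noteq> I"
    have ax: "axis b t = t *\<^sub>R (axis b 1 :: real^3)" for t
      by (simp add: vec_eq_iff axis_def)
    have \<delta>: "((\<lambda>t. ((\<lambda>_. 0)((v, I) := axis b t)) e) has_vector_derivative ((\<lambda>_. 0)((v, I) := axis b 1)) e) (at 0)"
      for e :: "'l edge"
      using has_vector_derivative_affine[of 0 "axis b (1 :: real)"] by (auto simp: ax[symmetric])
    have 0: "(((\<lambda>_. 0)((v, I) := u)) e) \<bullet> axis (snd e) 1 = 0" if "u $ I = 0" for u :: "real^3" and e :: "'l edge"
      using that by (auto simp: inner_axis)
    show "has_partial_p_perp F \<theta> p (v, I) b 0"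
      using chain[OF tangent_perturbed[of "\<lambda>_ _. 0" "\<lambda>_. 0" "\<lambda>_ _. 0" "\<lambda>_. 0" "\<lambda>t. (\<lambda>_. 0)((v, I) := axis b t)"
            "(\<lambda>_. 0)((v, I) := axis b 1)"]] \<delta> 0[of "axis b 1", unfolded axis_def[of b 1] vec_lambda_beta, folded axis_def[of b 1]] bI
      by (simp add: has_partial_p_perp_def f' h' axis0 upd0 del: fun_upd_apply)
    assume "\<theta> \<noteq> 0"
    then obtain u where u: "u $ I = 0" "tangent (\<lambda>t. perturbed \<theta> p (\<lambda>_. 0) ((\<lambda>_. 0)((v, I) := axis b t)) (\<lambda>_. 0) (\<lambda>_. 0))
      ?x ((\<lambda>_. 0)((v, I) := u)) (\<lambda>_. 0)"
      using tangent_perturbed_theta_perp[OF bI] by metis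
    show "has_partial_theta_perp F \<theta> p (v, I) b 0"
      using chain[OF u(2)] 0[OF u(1)] by (simp add: has_partial_theta_perp_def f' h' del: fun_upd_apply)
  qed
qed

section \<open>Values on homogeneous isotropic data\<close>

lemma av_homog: "av (homog \<theta> p) v I = p *\<^sub>R axis I 1"
  by (simp add: av_def oflux_homog flip: scaleR_add_left)

lemma Q_homog: "Q \<beta> a v (homog \<theta> p) = (\<beta> * a\<^sup>2 / 2 * p) ^ 3"
  by (simp add: Q_av av_homog cross_mult_left cross_mult_right cross_basis inner_axis_axis
      power3_eq_cube algebra_simps)

lemma homog_nondeg: "\<lbrakk>a > 0; \<beta> > 0; p > 0\<rbrakk> \<Longrightarrow> homog \<theta> p \<in> nondeg \<beta> a"
  by (simp add: nondeg_def Q_homog)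

lemma Vol_homog:
  assumes "a > 0" "\<beta> > 0" "p > 0"
  shows "Vol \<beta> a v (homog \<theta> p) = \<beta> * a ^ 3 * p * sqrt (2 * \<beta> * p) / 4"
proof -
  have "(\<beta> * a\<^sup>2 / 2 * p) ^ 3 = (\<beta> * a ^ 3 * p * sqrt (2 * \<beta> * p) / 4)\<^sup>2"
    using assms by (simp add: power_mult_distrib power_divide) (simp add: field_simps eval_nat_numeral)
  then show ?thesis
    using assms by (simp add: Vol_def Q_homog)
qed

text \<open>Here L >= 2 enters: the two edges at \<open>v\<close> along one direction are distinct,
  so perturbing one leaves the other unchanged.\<close>

lemma shift_neq: "shift v I (- 1) \<noteq> v"
  by (auto simp: shift_def vec_eq_iff axis_def)

text \<open>By multilinearity the perturbed factor contributes only its component along its own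
  axis, so the dependence on \<open>w\<close> is exactly affine.\<close>

lemma triple_perturbed:
  "(p *\<^sub>R axis 1 1 + (if 1 = I then w else 0)) \<bullet>
     ((p *\<^sub>R axis 2 1 + (if 2 = I then w else 0)) \<times> (p *\<^sub>R axis 3 1 + (if 3 = I then w else 0)))
   = p ^ 3 + p\<^sup>2 * w $ I"
  for w :: "real^3"
  using exhaust_3[of I]
  by (elim disjE) (simp_all add: cross3_def inner_vec_def sum_3 axis_def power3_eq_cube power2_eq_square algebra_simps)

lemma DERIV_sqrt:
  assumes "(g has_real_derivative D) (at x)" "g x > 0"
  shows "((\<lambda>t. sqrt (g t)) has_real_derivative D / (2 * sqrt (g x))) (at x)"
  using DERIV_chain2[OF DERIV_real_sqrt[OF assms(2)] assms(1)] by (simp add: field_simps)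

text \<open>The derivative of the volume with respect to a parallel flux on one of the six edges at its vertex.\<close>

definition vol_slope :: "real \<Rightarrow> real \<Rightarrow> real \<Rightarrow> real" where
  "vol_slope \<beta> a p = \<beta> * a ^ 3 * sqrt (2 * \<beta> * p) / 16"

text \<open>The volume at one vertex is not translation invariant, so this gradient is computed
  directly. The slope is V/(4p), one sixth of dV/dp = 3V/(2p), as six edges share the
  change.\<close>

lemma fgrad_Vol_homog:
  fixes v :: "'l::nontriv vertex"
  assumes pos: "a > 0" "\<beta> > 0" "p > 0" and e: "e = (v, I) \<or> e = (shift v I (- 1), I)"
  shows "fgrad (Vol \<beta> a v) (homog \<theta> p) e = vol_slope \<beta> a p *\<^sub>R axis I 1"
proof -
  let ?x = "homog \<theta> p :: 'l phase"
  have "flux_deriv e i (Vol \<beta> a v) ?x = vol_slope \<beta> a p * (if i = I then 1 else 0)" for i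
  proof -
    define y where "y = flux_curve ?x e i"
    \<comment> \<open>The direction in which the averaged flux moves. A backward edge is seen
      transported to \<open>v\<close>, and its reversal sign cancels the minus sign in
      \<open>av\<close>, so both edges enter alike.\<close>
    define z where "z = (if e = (v, I) then axis i 1 else Ad (ohol ?x v I (- 1)) (axis i 1))"
    have zI: "z $ I = (if i = I then 1 else 0)"
    proof -
      have "Ad (ohol ?x v I (- 1)) (axis i 1) \<bullet> axis I 1 = axis i 1 \<bullet> axis I (1 :: real)"
        using Ad_exp_axis[of \<theta> I] by (simp add: inner_Ad ohol_homog flip: su2_exp_uminus)
      then have "Ad (ohol ?x v I (- 1)) (axis i 1) $ I = (if i = I then 1 else 0)"
        by (simp add: inner_axis inner_axis_axis) (simp add: axis_def)
      moreover have "axis i (1 :: real) $ I = (if i = I then 1 else 0)"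
        by (simp add: axis_def)
      ultimately show ?thesis
        by (cases "e = (v, I)") (simp_all only: z_def if_True if_False simp_thms)
    qed
    have h: "ohol (y t) v J s = ohol ?x v J s" for t J s
      by (simp add: ohol_def y_def flux_curve_def)
    have f: "Ad (ohol ?x v J (- 1)) (p *\<^sub>R axis J 1) = p *\<^sub>R axis J 1" for J
      using oflux_homog[of "- 1" \<theta> p v J] by (simp add: ofield_def homog_def)
    have snd_y: "snd (y t) (w, J) = p *\<^sub>R axis J 1 + (if (w, J) = e then t *\<^sub>R axis i 1 else 0)" for t w J
      by (auto simp: y_def flux_curve_def homog_def)
    have av: "av (y t) v J = p *\<^sub>R axis J 1 + (if J = I then (t / 2) *\<^sub>R z else 0)" for t J
    proof (cases "e = (v, I)")
      case True
      then have "oflux (y t) v J (- 1) = - p *\<^sub>R axis J 1"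
        using shift_neq[of v J] f[of J] by (simp add: ofield_def h snd_y)
      moreover have "oflux (y t) v J 1 = p *\<^sub>R axis J 1 + (if J = I then t *\<^sub>R z else 0)"
        using True by (simp add: ofield_def snd_y z_def)
      ultimately show ?thesis
        unfolding av_def by (simp only:) (auto simp: vec_eq_iff field_simps)
    next
      case False
      then have e': "e = (shift v I (- 1), I)"
        using e by simp
      have "oflux (y t) v J 1 = p *\<^sub>R axis J 1"
        using shift_neq[of v I] by (auto simp: e' ofield_def snd_y)
      moreover have "oflux (y t) v J (- 1) = - (p *\<^sub>R axis J 1 + (if J = I then t *\<^sub>R z else 0))"
        using False f[of J] by (auto simp: e' ofield_def h snd_y z_def Ad_add Ad_scaleR)
      ultimately show ?thesis
        unfolding av_def by (simp only:) (auto simp: vec_eq_iff field_simps)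
    qed
    define c where "c = \<beta> * a\<^sup>2 / 2"
    have Q: "Q \<beta> a v (y t) = c ^ 3 * (p ^ 3 + p\<^sup>2 * (t / 2 * z $ I))" for t
      unfolding Q_av av using triple_perturbed[of p I "(t / 2) *\<^sub>R z"]
      by (simp add: c_def eq_commute[of _ I])
    have c: "c > 0"
      using pos by (simp add: c_def)
    let ?V = "\<beta> * a ^ 3 * p * sqrt (2 * \<beta> * p) / 4"
    have V0: "sqrt (c ^ 3 * p ^ 3) = ?V"
    proof -
      have "c ^ 3 * p ^ 3 = \<bar>(c * p) ^ 3\<bar>"
        using c pos by (simp add: power_mult_distrib)
      then show ?thesis
        using Vol_homog[OF pos, of v \<theta>] by (simp only: Vol_def Q_homog c_def)
    qed
    have "\<forall>\<^sub>F t in at 0. y t \<in> nondeg \<beta> a"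
      unfolding y_def by (rule open_alongD[OF open_along_nondeg homog_nondeg[OF pos] tangent_flux_curve])
    then have ev: "\<forall>\<^sub>F t in at 0. sqrt (Q \<beta> a v (y t)) = Vol \<beta> a v (y t)"
      by (rule eventually_mono) (simp add: Vol_def nondeg_def less_imp_le)
    have "((\<lambda>t. sqrt (Q \<beta> a v (y t))) has_real_derivative c ^ 3 * (p\<^sup>2 * (z $ I / 2)) / (2 * ?V)) (at 0)"
    proof -
      have "((\<lambda>t. Q \<beta> a v (y t)) has_real_derivative c ^ 3 * (p\<^sup>2 * (z $ I / 2))) (at 0)"
        unfolding Q by (auto intro!: derivative_eq_intros)
      then have "((\<lambda>t. sqrt (Q \<beta> a v (y t))) has_real_derivative
          c ^ 3 * (p\<^sup>2 * (z $ I / 2)) / (2 * sqrt (Q \<beta> a v (y 0)))) (at 0)"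
        by (rule DERIV_sqrt) (use Q[of 0] c pos in simp)
      then show ?thesis
        by (simp add: Q V0)
    qed
    then have "((\<lambda>t. Vol \<beta> a v (y t)) has_real_derivative c ^ 3 * (p\<^sup>2 * (z $ I / 2)) / (2 * ?V)) (at 0)"
      by (subst (asm) has_field_derivative_cong_eventually[OF ev]) (use Q[of 0] c pos in \<open>simp_all add: Vol_def\<close>)
    then have "flux_deriv e i (Vol \<beta> a v) ?x = c ^ 3 * (p\<^sup>2 * (z $ I / 2)) / (2 * ?V)"
      unfolding flux_deriv_curve y_def by (rule vector_derivative_real)
    also have "\<dots> = vol_slope \<beta> a p * z $ I"
    proof -
      define S where "S = sqrt (2 * \<beta> * p)"
      have S: "S > 0" "\<beta> * p = S * S / 2"
        using pos by (simp_all add: S_def)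
      have "c ^ 3 * p\<^sup>2 / (4 * (\<beta> * a ^ 3 * p * S / 4)) = \<beta> * a ^ 3 * (\<beta> * p) / (8 * S)"
        using pos S(1) by (simp add: c_def field_simps eval_nat_numeral)
      also have "\<dots> = \<beta> * a ^ 3 * S / 16"
        unfolding S(2) using S(1) by (simp add: field_simps)
      finally have 1: "c ^ 3 * p\<^sup>2 / (4 * (\<beta> * a ^ 3 * p * S / 4)) = vol_slope \<beta> a p"
        by (simp add: vol_slope_def flip: S_def)
      have "A * (B * (z $ I / 2)) / (2 * C) = A * B / (4 * C) * z $ I" for A B C :: real
        by (simp add: mult.assoc)
      then have "c ^ 3 * (p\<^sup>2 * (z $ I / 2)) / (2 * (\<beta> * a ^ 3 * p * S / 4))
          = c ^ 3 * p\<^sup>2 / (4 * (\<beta> * a ^ 3 * p * S / 4)) * z $ I"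
        by blast
      then show ?thesis
        unfolding 1 unfolding S_def .
    qed
    finally show ?thesis
      by (simp add: zI)
  qed
  then show ?thesis
    by (simp add: vec_eq_iff fgrad_def axis_def)
qed

lemma ograd_Vol_homog:
  assumes "a > 0" "\<beta> > 0" "p > 0" "s \<in> {1, - 1}"
  shows "ograd (Vol \<beta> a v) (homog \<theta> p) v I s = (of_int s * vol_slope \<beta> a p) *\<^sub>R axis I 1"
  by (rule ofield_homog) (use assms in \<open>simp_all add: fgrad_Vol_homog\<close>)

section \<open>The constraints \<open>constr\<close> at homogeneous data\<close>

lemma ohol_homog_quat:
  "s \<in> {1, - 1} \<Longrightarrow> su2_mat (ohol (homog \<theta> p) v I s) = quat (cos (\<theta> / 2)) ((of_int s * sin (\<theta> / 2)) *\<^sub>R axis I 1)"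
  by (auto simp: ohol_homog su2_exp_axis)

text \<open>Homogeneous holonomies do not depend on the vertex, so the square loop is a group
  commutator of rotations about two coordinate axes; its component along the third one is
  extracted.\<close>

lemma quat_loop:
  assumes "eps I J K \<noteq> 0"
  shows "Re (trace (quat c (m *\<^sub>R axis I 1) ** quat c (n *\<^sub>R axis J 1) ** quat c (- (m *\<^sub>R axis I 1))
    ** quat c (- (n *\<^sub>R axis J 1)) ** tau K)) = - 4 * eps I J K * c\<^sup>2 * m * n"
proof -
  have "(I, J, K) \<in> {(1, 2, 3), (2, 3, 1), (3, 1, 2), (1, 3, 2), (3, 2, 1), (2, 1, 3)}"
    using assms by (auto simp: eps_def split: if_splits)
  then show ?thesis
    by (elim insertE emptyE; simp only: prod.inject; elim conjE; simp only: tau_quat quat_mult trace_quat)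
      (simp_all add: eps_def cross3_def inner_vec_def sum_3 axis_def power2_eq_square algebra_simps)
qed

lemma loop_homog:
  assumes "eps I J K \<noteq> 0" "s \<in> {1, - 1}" "s' \<in> {1, - 1}"
  shows "Re (trace (loop (homog \<theta> p) v I s J s' ** tau K)) = - (of_int (s * s') * eps I J K * (sin \<theta>)\<^sup>2)"
proof -
  have "(sin \<theta>)\<^sup>2 = 4 * (cos (\<theta> / 2))\<^sup>2 * (sin (\<theta> / 2))\<^sup>2"
    using sin_double[of "\<theta> / 2"] by (simp add: power_mult_distrib)
  then show ?thesis
    unfolding loop_def hol_ohol matrix_inv_su2
    unfolding ohol_homog_quat[OF assms(2)] ohol_homog_quat[OF assms(3)]
      adj_quat quat_loop[OF assms(1)]
    by (simp add: power2_eq_square)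
qed

text \<open>There are 8 choices of signs and 6 permutations.\<close>

lemma sum_eps_const:
  "(\<Sum>s1\<in>{1, - 1 :: int}. \<Sum>s2\<in>{1, - 1 :: int}. \<Sum>s3\<in>{1, - 1 :: int}. \<Sum>I\<in>UNIV. \<Sum>J\<in>UNIV. \<Sum>K\<in>UNIV. (eps I J K)\<^sup>2 * T) = 48 * T"
proof -
  have "(\<Sum>I\<in>UNIV. \<Sum>J\<in>UNIV. \<Sum>K\<in>UNIV. (eps I J K)\<^sup>2 * T) = 6 * T"
    by (simp add: sum_3 eps_def)
  then show ?thesis
    by simp
qed

text \<open>The loop supplies the signs \<open>s1 * s2\<close>, the volume gradient supplies
  \<open>s3\<close>, and both cancel against the prefactor; so all 48 terms are equal.\<close>

lemma constr_homog:
  assumes pos: "a > 0" "\<beta> > 0" "p > 0" and \<kappa>: "\<kappa> > 0"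
  shows "constr \<kappa> a \<beta> (mat 1) v (homog \<theta> p) = 64 * vol_slope \<beta> a p / (\<beta> * \<kappa> * a\<^sup>2) * (sin \<theta>)\<^sup>2"
proof -
  let ?x = "homog \<theta> p" and ?T = "- (\<kappa> / (2 * a\<^sup>2) * vol_slope \<beta> a p * (sin \<theta>)\<^sup>2)"
  have "of_int (s1 * s2 * s3) * eps I J K *
        Re (trace (mat 1 ** loop ?x v I s1 J s2 ** hol_bracket \<kappa> a v K s3 (Vol \<beta> a v) ?x))
      = (eps I J K)\<^sup>2 * ?T"
    if s: "s1 \<in> {1, - 1}" "s2 \<in> {1, - 1}" "s3 \<in> {1, - 1}" for s1 s2 s3 I J K
  proof (cases "eps I J K = 0")
    case False
    have "Re (trace (mat 1 ** loop ?x v I s1 J s2 ** hol_bracket \<kappa> a v K s3 (Vol \<beta> a v) ?x))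
        = \<kappa> / (2 * a\<^sup>2) * (of_int s3 * vol_slope \<beta> a p) * - (of_int (s1 * s2) * eps I J K * (sin \<theta>)\<^sup>2)"
      unfolding hol_bracket_ograd ograd_Vol_homog[OF pos s(3)] tv_scaleR tv_axis matrix_mul_lid
        matrix_mul_scaleR_right trace_scaleR scaleR_complex.sel loop_homog[OF False s(1,2)] by simp
    moreover have "of_int (s1 * s2 * s3) * e * (k * (of_int s3 * W) * - (of_int (s1 * s2) * e * S))
        = (of_int (s1 * s2 * s3) * of_int (s1 * s2 * s3)) * (e\<^sup>2 * - (k * W * S))" for e k W S :: real
      by (simp add: power2_eq_square algebra_simps)
    moreover have "real_of_int (s1 * s2 * s3) * real_of_int (s1 * s2 * s3) = 1"
      using s by auto
    ultimately show ?thesis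
      by (simp only: mult_1)
  qed simp
  then have "constr \<kappa> a \<beta> (mat 1) v ?x = - (8 / (3 * \<beta> * \<kappa>\<^sup>2)) *
    (\<Sum>s1\<in>{1, - 1 :: int}. \<Sum>s2\<in>{1, - 1 :: int}. \<Sum>s3\<in>{1, - 1 :: int}. \<Sum>I\<in>UNIV. \<Sum>J\<in>UNIV. \<Sum>K\<in>UNIV. (eps I J K)\<^sup>2 * ?T)"
    unfolding constr_def by (intro arg_cong[where f = "(*) _"] sum.cong refl)
  then show ?thesis
    unfolding sum_eps_const using pos \<kappa> by (simp add: field_simps power2_eq_square)
qed

text \<open>A half-turn about an axis other than \<open>j\<close> fixes the vertex and the data but
  turns \<open>tau j\<close> into its negative; \<open>j + 1\<close> is such an axis.\<close>

lemma constr_tau_homog: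
  assumes "a > 0" "\<beta> > 0" "p > 0"
  shows "constr \<kappa> a \<beta> (tau j) v (homog \<theta> p) = 0"
proof -
  let ?K = "j + 1"
  have jK: "j \<noteq> ?K"
    by simp
  obtain g where g: "homog_sym (\<lambda>u. \<chi> i. if i = ?K then u $ i else 2 * v $ i - u $ i) (\<lambda>I. I) (\<lambda>I. if I = ?K then 1 else - 1) g"
    and Ad: "Ad g = (\<lambda>y. (2 * y $ ?K) *\<^sub>R axis ?K 1 - y)"
    by (rule homog_sym_rotation[of ?K v])
  interpret homog_sym "\<lambda>u. \<chi> i. if i = ?K then u $ i else 2 * v $ i - u $ i" "\<lambda>I. I" "\<lambda>I. if I = ?K then 1 else - 1" g
    by (rule g)
  have "Ad g (axis j 1) = - axis j 1"
    using jK by (simp add: Ad axis_def)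
  then have "Ad (su2_inv g) (axis j 1) = - axis j 1"
    by (metis Ad_inv(1) Ad_uminus minus_minus)
  then have "adj (su2_mat g) ** tau j ** su2_mat g = - tau j"
    using tv_Ad[of "su2_inv g" "axis j 1"] by (simp add: su2_inv.rep_eq adj_adj_su2 tv_axis tv_uminus)
  moreover have "(\<chi> i. if i = ?K then v $ i else 2 * v $ i - v $ i) = v"
    by (simp add: vec_eq_iff)
  ultimately have "constr \<kappa> a \<beta> (tau j) v (homog \<theta> p) = constr \<kappa> a \<beta> ((- 1) *\<^sub>R tau j) v (homog \<theta> p)"
    using constr_act[OF homog_nondeg[OF assms], of \<kappa> "tau j" v \<theta>] by (simp add: act_homog)
  then show ?thesis
    unfolding constr_scaleR by simp
qed

section \<open>K and the Lorentzian part at homogeneous data\<close>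

lemma sum_R: "bij R \<Longrightarrow> (\<Sum>v\<in>UNIV. f (R v)) = (\<Sum>v\<in>UNIV. f v)"
  by (rule sum.reindex_bij_betw)

lemma sym_fun_sum:
  assumes "\<And>v. smooth U (f v)"
    and "\<And>R \<pi> sg g v x. homog_sym R \<pi> sg g \<Longrightarrow> x \<in> U \<Longrightarrow> f v (lattice_sym.act R \<pi> sg g x) = f (R v) x"
  shows "sym_fun U (\<lambda>x. \<Sum>v\<in>UNIV. f v x)"
proof -
  have "bij R" if "homog_sym R \<pi> sg g" for R :: "'a vertex \<Rightarrow> 'a vertex" and \<pi> sg g
  proof -
    interpret homog_sym R \<pi> sg g
      by (rule that)
    show ?thesis
      by (rule bij_R)
  qed
  then show ?thesis
    using assms by (auto simp: sym_fun_def smooth_sum sum_R[of _ "\<lambda>v. f v _"] simp del: split_paired_All)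
qed

lemma homog_sym_lattice_sym: "homog_sym R \<pi> sg g \<Longrightarrow> lattice_sym R \<pi> sg"
  by (simp add: homog_sym_def)

lemma sym_fun_constr: "sym_fun (nondeg \<beta> a) (\<lambda>x. \<Sum>v\<in>UNIV. constr \<kappa> a \<beta> (mat 1) v x)"
  by (rule sym_fun_sum[OF smooth_constr]) (rule lattice_sym.constr_1_act[OF homog_sym_lattice_sym])

lemma sym_fun_Vol: "sym_fun (nondeg \<beta> a) (\<lambda>x. \<Sum>v\<in>UNIV. Vol \<beta> a v x)"
  by (rule sym_fun_sum[OF smooth_Vol]) (rule lattice_sym.Vol_act[OF homog_sym_lattice_sym])

lemma sym_fun_Kext: "sym_fun (nondeg \<beta> a) (Kext \<kappa> a \<beta>)"
  unfolding sym_fun_def using smooth_Kext lattice_sym.Kext_act[OF homog_sym_lattice_sym] by blast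

lemma has_real_derivative_cong_pos:
  assumes "(f has_real_derivative D) (at p)" "p > (0 :: real)" "\<And>q. q > 0 \<Longrightarrow> f q = g q"
  shows "(g has_real_derivative D) (at p)"
  using assms by (intro has_field_derivative_transform_within_open[OF assms(1), of "{0<..}"]) auto

text \<open>The bracket of two invariant functions needs only the numbers \<open>c\<close> and
  \<open>d\<close> of each, and these come from differentiating the homogeneous values in p and
  \<theta>.\<close>

lemma Kext_homog:
  assumes pos: "a > 0" "\<beta> > 0" "p > 0" and \<kappa>: "\<kappa> > 0"
  shows "Kext \<kappa> a \<beta> (homog \<theta> p :: 'l::nontriv phase) = real CARD('l vertex) * a\<^sup>2 * p * sin (2 * \<theta>)"
proof -
  let ?x = "homog \<theta> p :: 'l phase"
  define n where "n = real CARD('l vertex)"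
  define W where "W = vol_slope \<beta> a p"
  have n: "n > 0"
    by (simp add: n_def)
  let ?C = "\<lambda>x :: 'l phase. \<Sum>v\<in>UNIV. constr \<kappa> a \<beta> (mat 1) v x" and ?V = "\<lambda>x :: 'l phase. \<Sum>v\<in>UNIV. Vol \<beta> a v x"
  note x = open_along_nondeg homog_nondeg[OF pos]
  obtain cC dC where C: "\<And>v I. fgrad ?C ?x (v, I) = cC *\<^sub>R axis I 1" "\<And>v I. hgrad ?C ?x (v, I) = dC *\<^sub>R axis I 1"
    "((\<lambda>u. ?C (homog u p)) has_real_derivative 3 * n * dC) (at \<theta>)"
    using sym_fun_grad[OF sym_fun_constr x] unfolding n_def by metis
  obtain cV dV where V: "\<And>v I. fgrad ?V ?x (v, I) = cV *\<^sub>R axis I 1" "\<And>v I. hgrad ?V ?x (v, I) = dV *\<^sub>R axis I 1"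
    "((\<lambda>q. ?V (homog \<theta> q)) has_real_derivative 3 * n * cV) (at p)"
    "((\<lambda>u. ?V (homog u p)) has_real_derivative 3 * n * dV) (at \<theta>)"
    using sym_fun_grad[OF sym_fun_Vol x] unfolding n_def by metis
  have "((\<lambda>u. n * (A * (sin u)\<^sup>2)) has_real_derivative n * (A * (2 * sin \<theta> * cos \<theta>))) (at \<theta>)" for A
    by (auto intro!: derivative_eq_intros)
  then have "((\<lambda>u. ?C (homog u p)) has_real_derivative n * (64 * W / (\<beta> * \<kappa> * a\<^sup>2) * (2 * sin \<theta> * cos \<theta>))) (at \<theta>)"
    unfolding constr_homog[OF pos \<kappa>] sum_constant n_def W_def .
  from DERIV_unique[OF C(3) this]
  have "n * (3 * dC) = n * (64 * W / (\<beta> * \<kappa> * a\<^sup>2) * (2 * sin \<theta> * cos \<theta>))"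
    by (simp only: mult_ac)
  then have dC: "3 * dC = 64 * W / (\<beta> * \<kappa> * a\<^sup>2) * (2 * sin \<theta> * cos \<theta>)"
    using n by (simp only: mult_cancel_left) simp
  have "((\<lambda>u. ?V (homog u p)) has_real_derivative 0) (at \<theta>)"
    unfolding Vol_homog[OF pos] by simp
  then have dV: "dV = 0"
    using DERIV_unique[OF V(4)] n by fastforce
  have "((\<lambda>q. n * (\<beta> * a ^ 3 * q * sqrt (2 * \<beta> * q) / 4)) has_real_derivative n * (6 * W)) (at p)"
  proof -
    define S where "S = sqrt (2 * \<beta> * p)"
    have S: "S > 0" "\<beta> * p = S * S / 2"
      using pos by (simp_all add: S_def)
    have "\<beta> * a ^ 3 * S / 4 + \<beta> * a ^ 3 * (\<beta> * p) / (4 * S) = 6 * (\<beta> * a ^ 3 * S / 16)"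
      unfolding S(2) using S(1) by (simp add: field_simps)
    then show ?thesis
      using pos by (auto intro!: derivative_eq_intros simp: mult_less_0_iff W_def vol_slope_def field_simps simp flip: S_def)
  qed
  then have "((\<lambda>q. ?V (homog \<theta> q)) has_real_derivative n * (6 * W)) (at p)"
    by (rule has_real_derivative_cong_pos) (use pos in \<open>simp_all add: Vol_homog n_def\<close>)
  \<comment> \<open>Each edge meets two vertices, hence twice the slope of a single volume.\<close>
  then have cV: "cV = 2 * W"
    using DERIV_unique[OF V(3)] n by fastforce
  \<comment> \<open>All gradients are parallel to the edge, so the cross product vanishes, and the
    volume does not depend on \<theta>; one term per edge is left.\<close>
  have "hgrad ?V ?x e \<bullet> fgrad ?C ?x e - fgrad ?V ?x e \<bullet> hgrad ?C ?x e
      - snd ?x e \<bullet> (fgrad ?C ?x e \<times> fgrad ?V ?x e) = - 2 * W * dC" for e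
    by (cases e) (simp add: C V dV cV inner_axis_axis cross_mult_left cross_mult_right)
  then have "Kext \<kappa> a \<beta> ?x = 1 / \<beta>\<^sup>2 * (\<kappa> / a\<^sup>2) * n * (2 * W) * (3 * dC)"
    using pos by (simp add: Kext_def poisson_grad n_def card_prod)
  also have "\<dots> = 256 * (W * W) * n * (sin \<theta> * cos \<theta>) / (\<beta> ^ 3 * a ^ 4)"
    unfolding dC using pos \<kappa> by (simp add: field_simps eval_nat_numeral)
  \<comment> \<open>One factor comes from the constraint and one from the volume; their square roots
    combine, which makes K linear in p.\<close>
  also have "W * W = \<beta> ^ 3 * a ^ 6 * p / 128"
  proof -
    have "W * W = (\<beta> * a ^ 3 / 16)\<^sup>2 * (sqrt (2 * \<beta> * p))\<^sup>2"
      by (simp add: W_def vol_slope_def power2_eq_square)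
    also have "(sqrt (2 * \<beta> * p))\<^sup>2 = 2 * \<beta> * p"
      using pos by simp
    finally show ?thesis
      by (simp add: eval_nat_numeral)
  qed
  finally show ?thesis
    unfolding sin_double using pos by (simp add: n_def field_simps eval_nat_numeral)
qed

lemma fgrad_Kext_homog:
  assumes pos: "a > 0" "\<beta> > 0" "p > 0" and \<kappa>: "\<kappa> > 0"
  shows "fgrad (Kext \<kappa> a \<beta>) (homog \<theta> p :: 'l::nontriv phase) (v, I) = (a\<^sup>2 * sin (2 * \<theta>) / 3) *\<^sub>R axis I 1"
proof -
  define n where "n = real CARD('l vertex)"
  obtain c where c: "\<And>v I. fgrad (Kext \<kappa> a \<beta>) (homog \<theta> p :: 'l phase) (v, I) = c *\<^sub>R axis I 1"
    "((\<lambda>q. Kext \<kappa> a \<beta> (homog \<theta> q :: 'l phase)) has_real_derivative 3 * n * c) (at p)"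
    using sym_fun_grad[OF sym_fun_Kext open_along_nondeg homog_nondeg[OF pos]] unfolding n_def by metis
  have "((\<lambda>q. n * a\<^sup>2 * q * sin (2 * \<theta>)) has_real_derivative n * a\<^sup>2 * sin (2 * \<theta>)) (at p)"
    by (auto intro!: derivative_eq_intros)
  then have "((\<lambda>q. Kext \<kappa> a \<beta> (homog \<theta> q :: 'l phase)) has_real_derivative n * a\<^sup>2 * sin (2 * \<theta>)) (at p)"
    by (rule has_real_derivative_cong_pos) (use pos \<kappa> in \<open>simp_all add: Kext_homog n_def\<close>)
  then have "3 * n * c = n * a\<^sup>2 * sin (2 * \<theta>)"
    by (rule DERIV_unique[OF c(2)])
  moreover have "n > 0"
    by (simp add: n_def)
  ultimately have "c = a\<^sup>2 * sin (2 * \<theta>) / 3"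
    by (simp add: field_simps)
  then show ?thesis
    by (simp add: c)
qed

lemma trace_tau3: "Re (trace (tau I ** tau J ** tau K)) = - 2 * eps I J K"
proof -
  have "axis I 1 \<bullet> (axis J 1 \<times> axis K (1 :: real)) = eps I J K"
    using triple_eps[of "\<lambda>I. axis I 1" I J K] by (simp add: cross_basis inner_axis_axis)
  then show ?thesis
    by (simp add: tau_quat quat_mult trace_quat cross_inner)
qed

text \<open>As for \<open>constr\<close> the signs cancel and 48 equal terms remain. The 9 in the
  denominator is the square of the 3 by which the derivative of K is shared among the
  directions.\<close>

lemma constr_L_homog:
  assumes pos: "a > 0" "\<beta> > 0" "p > 0" and \<kappa>: "\<kappa> > 0"
  shows "constr_L \<kappa> a \<beta> v (homog \<theta> p) = - (512 / 9) * vol_slope \<beta> a p / (\<beta> ^ 3 * \<kappa> * a\<^sup>2) * (sin (2 * \<theta>))\<^sup>2"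
proof -
  let ?x = "homog \<theta> p"
  define k where "k = a\<^sup>2 * sin (2 * \<theta>) / 3"
  let ?T = "- 2 * (\<kappa> / (2 * a\<^sup>2)) ^ 3 * k\<^sup>2 * vol_slope \<beta> a p"
  have K: "hol_bracket \<kappa> a v I s (Kext \<kappa> a \<beta>) ?x = (\<kappa> / (2 * a\<^sup>2) * (of_int s * k)) *\<^sub>R tau I" if "s \<in> {1, - 1}" for I s
    using ofield_homog[of s "fgrad (Kext \<kappa> a \<beta>) ?x" v I k \<theta> p] that
    by (simp add: hol_bracket_ograd fgrad_Kext_homog[OF pos \<kappa>] k_def[symmetric] tv_scaleR tv_axis del: insert_iff)
  have V: "hol_bracket \<kappa> a v I s (Vol \<beta> a v) ?x = (\<kappa> / (2 * a\<^sup>2) * (of_int s * vol_slope \<beta> a p)) *\<^sub>R tau I" if "s \<in> {1, - 1}" for I s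
    by (simp add: hol_bracket_ograd ograd_Vol_homog[OF pos that] tv_scaleR tv_axis)
  have "of_int (s1 * s2 * s3) * eps I J K *
        Re (trace (hol_bracket \<kappa> a v I s1 (Kext \<kappa> a \<beta>) ?x ** hol_bracket \<kappa> a v J s2 (Kext \<kappa> a \<beta>) ?x
           ** hol_bracket \<kappa> a v K s3 (Vol \<beta> a v) ?x))
      = (eps I J K)\<^sup>2 * ?T"
    if s: "s1 \<in> {1, - 1}" "s2 \<in> {1, - 1}" "s3 \<in> {1, - 1}" for s1 s2 s3 I J K
  proof -
    have 1: "real_of_int (s1 * s2 * s3) * real_of_int (s1 * s2 * s3) = 1"
      using s by auto
    have "of_int (s1 * s2 * s3) * e * (c * (of_int s3 * W) * (c * (of_int s2 * k) * (c * (of_int s1 * k) * (- 2 * e))))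
        = (of_int (s1 * s2 * s3) * of_int (s1 * s2 * s3)) * (e\<^sup>2 * (- 2 * c ^ 3 * k\<^sup>2 * W))" for e c W :: real
      by (simp add: power2_eq_square power3_eq_cube algebra_simps)
    then show ?thesis
      unfolding K[OF s(1)] K[OF s(2)] V[OF s(3)] matrix_scaleR_mult matrix_mul_scaleR_right trace_scaleR
        scaleR_complex.sel trace_tau3 1 mult_1 .
  qed
  then have "constr_L \<kappa> a \<beta> v ?x = 128 / (3 * \<beta> ^ 3 * \<kappa> ^ 4) *
    (\<Sum>s1\<in>{1, - 1 :: int}. \<Sum>s2\<in>{1, - 1 :: int}. \<Sum>s3\<in>{1, - 1 :: int}. \<Sum>I\<in>UNIV. \<Sum>J\<in>UNIV. \<Sum>K\<in>UNIV. (eps I J K)\<^sup>2 * ?T)"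
    unfolding constr_L_def by (intro arg_cong[where f = "(*) _"] sum.cong refl)
  then show ?thesis
    unfolding sum_eps_const k_def using pos \<kappa> by (simp add: field_simps eval_nat_numeral)
qed

definition bracket :: "real \<Rightarrow> real \<Rightarrow> real" where
  "bracket \<beta> \<theta> = (sin \<theta>)\<^sup>2 - 4 / 9 * ((1 + \<beta>\<^sup>2) / \<beta>\<^sup>2) * (sin (2 * \<theta>))\<^sup>2"

text \<open>The constant 4/9 in \<open>bracket\<close> is half of 512/9, divided by the 64 of the
  Euclidean part.\<close>

lemma constr_GT_homog:
  assumes pos: "a > 0" "\<beta> > 0" "p > 0" and \<kappa>: "\<kappa> > 0"
  shows "constr_GT \<kappa> a \<beta> v (homog \<theta> p) = 4 * a / \<kappa> * sqrt (2 * \<beta> * p) * bracket \<beta> \<theta>"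
proof -
  define W where "W = vol_slope \<beta> a p"
  have "constr_GT \<kappa> a \<beta> v (homog \<theta> p) = 64 * W / (\<beta> * \<kappa> * a\<^sup>2) * bracket \<beta> \<theta>"
    unfolding constr_GT_def constr_homog[OF assms] constr_L_homog[OF assms] bracket_def W_def[symmetric]
    using pos \<kappa> by (simp add: field_simps eval_nat_numeral)
  also have "64 * W / (\<beta> * \<kappa> * a\<^sup>2) = 4 * a / \<kappa> * sqrt (2 * \<beta> * p)"
    using pos \<kappa> by (simp add: W_def vol_slope_def field_simps eval_nat_numeral)
  finally show ?thesis .
qed

section \<open>The physical Hamiltonians\<close>

text \<open>The sign in the scalar case makes the expression positive where C_v is negative; the
  absolute value in the Hamiltonian hides it.\<close>

fun local_H :: "model \<Rightarrow> real \<Rightarrow> real \<Rightarrow> real \<Rightarrow> 'l::nontriv vertex \<Rightarrow> 'l phase \<Rightarrow> real" where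
  "local_H Brown_Kuchar_Dust \<kappa> a \<beta> v x = (constr_GT \<kappa> a \<beta> v x)\<^sup>2 - 1 / 4 * (\<Sum>j\<in>UNIV. (constr \<kappa> a \<beta> (tau j) v x)\<^sup>2)"
| "local_H Gaussian_Dust \<kappa> a \<beta> v x = (constr_GT \<kappa> a \<beta> v x)\<^sup>2"
| "local_H Scalar \<kappa> a \<beta> v x = - (Vol \<beta> a v x * constr_GT \<kappa> a \<beta> v x)"

definition regular :: "model \<Rightarrow> real \<Rightarrow> real \<Rightarrow> real \<Rightarrow> 'l::nontriv phase set" where
  "regular m \<kappa> a \<beta> = {x \<in> nondeg \<beta> a. \<forall>v. local_H m \<kappa> a \<beta> v x > 0}"

lemma H_phys_local: "H_phys m \<kappa> a \<beta> x = (\<Sum>v\<in>UNIV. sqrt \<bar>local_H m \<kappa> a \<beta> v x\<bar>)"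
  by (cases m) (simp_all add: H_dust_def H_scalar_def)

lemma smooth_local_H: "smooth (nondeg \<beta> a) (local_H m \<kappa> a \<beta> v)"
proof (cases m)
  case Brown_Kuchar_Dust
  show ?thesis
    unfolding Brown_Kuchar_Dust local_H.simps[abs_def]
    by (intro smooth_diff smooth_mult smooth_const smooth_sum smooth_power smooth_constr smooth_constr_GT)
next
  case Gaussian_Dust
  show ?thesis
    unfolding Gaussian_Dust local_H.simps[abs_def] by (intro smooth_power smooth_constr_GT)
next
  case Scalar
  show ?thesis
    unfolding Scalar local_H.simps[abs_def] by (intro smooth_uminus smooth_mult smooth_Vol smooth_constr_GT)
qed

lemma open_along_regular: "open_along (regular m \<kappa> a \<beta>)"
  unfolding regular_def by (rule open_along_positive[OF open_along_nondeg smooth_local_H])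

lemma local_H_act:
  assumes "homog_sym R \<pi> sg g" "x \<in> nondeg \<beta> a"
  shows "local_H m \<kappa> a \<beta> v (lattice_sym.act R \<pi> sg g x) = local_H m \<kappa> a \<beta> (R v) x"
proof -
  interpret homog_sym R \<pi> sg g
    by (rule assms)
  show ?thesis
    using assms(2) by (cases m) (simp_all add: constr_GT_act constr_tau_act Vol_act)
qed

lemma sym_fun_H: "sym_fun (regular m \<kappa> a \<beta> :: 'l::nontriv phase set) (H_phys m \<kappa> a \<beta>)"
proof -
  have "sym_fun (regular m \<kappa> a \<beta> :: 'l phase set) (\<lambda>x. \<Sum>v\<in>UNIV. sqrt \<bar>local_H m \<kappa> a \<beta> v x\<bar>)"
  proof (rule sym_fun_sum)
    fix v :: "'l vertex"
    have "smooth (regular m \<kappa> a \<beta>) (\<lambda>x. sqrt (local_H m \<kappa> a \<beta> v x))"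
      by (rule smooth_sqrt[OF smooth_mono[OF smooth_local_H]]) (auto simp: regular_def)
    then show "smooth (regular m \<kappa> a \<beta>) (\<lambda>x. sqrt \<bar>local_H m \<kappa> a \<beta> v x\<bar>)"
      by (rule smooth_cong) (auto simp: regular_def abs_of_pos)
  qed (auto simp: local_H_act regular_def)
  then show ?thesis
    by (simp add: H_phys_local[abs_def])
qed

text \<open>The real \<open>sqrt\<close> of a negative number is negative, so positivity of the
  scalar Hamiltonian also forces a positive radicand.\<close>

lemma H_cosm_pos_iff:
  assumes "\<kappa> > 0" "a > 0" "\<beta> > 0" "p > 0" "N > 0"
  shows "H_cosm m N \<kappa> a \<beta> \<theta> p > 0 \<longleftrightarrow> bracket \<beta> \<theta> < 0"
proof -
  have pos: "0 < k * y \<longleftrightarrow> 0 < y" if "k > 0" for k y :: real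
    using that by (simp add: zero_less_mult_iff)
  have "H_cosm_dust N \<kappa> a \<beta> \<theta> p = (4 * a * N / \<kappa> * sqrt (2 * \<beta> * p)) * - bracket \<beta> \<theta>"
    unfolding H_cosm_dust_def bracket_def[symmetric] by simp
  moreover have "4 * a * N / \<kappa> * sqrt (2 * \<beta> * p) > 0"
    using assms by simp
  ultimately have 1: "H_cosm_dust N \<kappa> a \<beta> \<theta> p > 0 \<longleftrightarrow> bracket \<beta> \<theta> < 0"
    by (simp only: pos) simp
  have "H_cosm_scalar N \<kappa> a \<beta> \<theta> p = (sqrt 2 * a\<^sup>2 * N / sqrt \<kappa> * \<beta> * p) * sqrt (- bracket \<beta> \<theta>)"
    by (simp add: H_cosm_scalar_def bracket_def)
  moreover have "sqrt 2 * a\<^sup>2 * N / sqrt \<kappa> * \<beta> * p > 0"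
    using assms by simp
  ultimately have 2: "H_cosm_scalar N \<kappa> a \<beta> \<theta> p > 0 \<longleftrightarrow> bracket \<beta> \<theta> < 0"
    by (simp only: pos) simp
  show ?thesis
    using 1 2 by (cases m) simp_all
qed

text \<open>Negativity of \<open>bracket\<close> makes C_v negative, which resolves the absolute
  values; the vertices contribute equally, and each contribution is the reduced Hamiltonian for N =
  1.\<close>

lemma
  fixes m :: model
  assumes \<kappa>: "\<kappa> > 0" and pos: "a > 0" "\<beta> > 0" "p > 0" and neg: "bracket \<beta> \<theta> < 0"
  shows homog_regular: "homog \<theta> p \<in> (regular m \<kappa> a \<beta> :: 'l::nontriv phase set)"
    and H_homog: "H_phys m \<kappa> a \<beta> (homog \<theta> p :: 'l phase) = H_cosm m (real CARD('l vertex)) \<kappa> a \<beta> \<theta> p"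
proof -
  let ?x = "homog \<theta> p :: 'l phase"
  define n where "n = real CARD('l vertex)"
  define B where "B = bracket \<beta> \<theta>"
  define C where "C = 4 * a / \<kappa> * sqrt (2 * \<beta> * p) * - B"
  have C: "constr_GT \<kappa> a \<beta> v ?x = - C" for v
    by (simp add: constr_GT_homog[OF pos \<kappa>] C_def B_def)
  have C0: "C > 0"
    unfolding C_def by (rule mult_pos_pos) (use \<kappa> pos neg in \<open>simp_all add: B_def\<close>)
  \<comment> \<open>Volume and constraint carry the same square root, so their product is a perfect
    square times \<open>- B\<close>.\<close>
  have V: "Vol \<beta> a v ?x * C = (sqrt 2 * a\<^sup>2 / sqrt \<kappa> * \<beta> * p)\<^sup>2 * - B" for v
  proof -
    define S where "S = sqrt (2 * \<beta> * p)"
    have S: "S * S = 2 * \<beta> * p"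
      using pos by (simp add: S_def)
    have "Vol \<beta> a v ?x * C = \<beta> * a ^ 4 * p * (S * S) / \<kappa> * - B"
      unfolding Vol_homog[OF pos] C_def S_def[symmetric] by (simp add: eval_nat_numeral)
    then show ?thesis
      unfolding S using \<kappa> by (simp add: power_mult_distrib power_divide) (simp add: eval_nat_numeral)
  qed
  have "Vol \<beta> a v ?x * C > 0" for v
    using C0 pos by (simp add: Vol_homog)
  then show "?x \<in> regular m \<kappa> a \<beta>"
    using C0 by (cases m) (auto simp: regular_def homog_nondeg[OF pos] C constr_tau_homog[OF pos])
  have dust: "H_cosm_dust 1 \<kappa> a \<beta> \<theta> p = C"
    unfolding H_cosm_dust_def C_def B_def bracket_def[symmetric] by simp
  have "sqrt \<bar>local_H m \<kappa> a \<beta> v ?x\<bar> = H_cosm m 1 \<kappa> a \<beta> \<theta> p" for v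
  proof (cases m)
    case Scalar
    have "sqrt \<bar>Vol \<beta> a v ?x * C\<bar> = (sqrt 2 * a\<^sup>2 / sqrt \<kappa> * \<beta> * p) * sqrt (- B)"
    proof -
      have "sqrt \<bar>X\<^sup>2 * y\<bar> = X * sqrt y" if "X > 0" "y > 0" for X y :: real
        using that by (simp add: real_sqrt_mult abs_mult)
      then show ?thesis
        unfolding V by this (use neg pos \<kappa> in \<open>simp_all add: B_def\<close>)
    qed
    then show ?thesis
      by (simp add: Scalar C H_cosm_scalar_def B_def bracket_def)
  qed (use C0 dust in \<open>simp_all add: C constr_tau_homog[OF pos]\<close>)
  then have "H_phys m \<kappa> a \<beta> ?x = n * H_cosm m 1 \<kappa> a \<beta> \<theta> p"
    by (simp add: H_phys_local n_def)
  then show "H_phys m \<kappa> a \<beta> ?x = H_cosm m (real CARD('l vertex)) \<kappa> a \<beta> \<theta> p"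
    unfolding n_def[symmetric] by (cases m) (simp_all add: H_cosm_dust_def H_cosm_scalar_def)
qed

theorem theorem6p2:
  fixes \<kappa> a \<beta> :: real
    and m :: model
    and H :: "'l::nontriv phase \<Rightarrow> real"
    and Hc :: "real \<Rightarrow> real \<Rightarrow> real"
    and N :: real
    and \<theta> p :: "real \<Rightarrow> real"
    and T :: "real set"
  assumes "\<kappa> > 0" and "a > 0" and "\<beta> > 0"
    and "H = H_phys m \<kappa> a \<beta>"
    and "N = real CARD('l vertex)"
    and "Hc = H_cosm m N \<kappa> a \<beta>"
    and "open T" and "is_interval T"
    and "\<forall>\<tau>\<in>T. \<theta> differentiable (at \<tau>)"
    and "\<forall>\<tau>\<in>T. p differentiable (at \<tau>)"
    and "\<forall>\<tau>\<in>T. p \<tau> > 0"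
    and "\<forall>\<tau>\<in>T. Hc (\<theta> \<tau>) (p \<tau>) > 0"
  shows "\<forall>\<tau>\<in>T. (lattice_evolution H \<kappa> a \<theta> p \<tau> \<longleftrightarrow> reduced_evolution Hc N \<kappa> a \<theta> p \<tau>)
               \<and> transversal_constraints H (\<theta> \<tau>) (p \<tau>)"
proof
  fix \<tau> assume "\<tau> \<in> T"
  define \<theta>0 p0 where "\<theta>0 = \<theta> \<tau>" and "p0 = p \<tau>"
  note ab = \<open>a > 0\<close> \<open>\<beta> > 0\<close>
  have p0: "p0 > 0"
    using assms(11) \<open>\<tau> \<in> T\<close> by (simp add: p0_def)
  have N: "N > 0"
    by (simp add: assms(5))
  have neg: "bracket \<beta> \<theta>0 < 0"
    using assms(12) \<open>\<tau> \<in> T\<close> H_cosm_pos_iff[OF \<open>\<kappa> > 0\<close> ab p0 N]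
    by (auto simp: assms(6) \<theta>0_def p0_def)
  have val: "H (homog u q) = Hc u q" if "bracket \<beta> u < 0" "q > 0" for u q
    unfolding assms(4,5,6) by (rule H_homog[OF \<open>\<kappa> > 0\<close> ab that(2,1)])
  \<comment> \<open>\<open>bracket\<close> vanishes at 0, so its negativity excludes \<theta> = 0,
    as the transversal angle derivatives require.\<close>
  have nz: "\<theta>0 \<noteq> 0"
    using neg by (auto simp: bracket_def)
  obtain c d where
    dp: "((\<lambda>q. H (homog \<theta>0 q)) has_real_derivative 3 * N * c) (at p0)"
    and dt: "((\<lambda>u. H (homog u p0)) has_real_derivative 3 * N * d) (at \<theta>0)"
    and pp: "\<And>e. has_partial_p_par H \<theta>0 p0 e c" and pt: "\<And>e. has_partial_theta_par H \<theta>0 p0 e d"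
    and perp: "\<And>v I b. b \<noteq> I \<Longrightarrow> has_partial_p_perp H \<theta>0 p0 (v, I) b 0"
      "\<And>v I b. b \<noteq> I \<Longrightarrow> \<theta>0 \<noteq> 0 \<Longrightarrow> has_partial_theta_perp H \<theta>0 p0 (v, I) b 0"
    using sym_fun_grad[OF sym_fun_H open_along_regular homog_regular[OF \<open>\<kappa> > 0\<close> ab p0 neg]]
    unfolding assms(4,5) by metis
  \<comment> \<open>The sign of \<open>bracket\<close> does not involve p, so the values agree for
    all positive \<open>q\<close>.\<close>
  have "((\<lambda>q. Hc \<theta>0 q) has_real_derivative 3 * N * c) (at p0)"
    by (rule has_real_derivative_cong_pos[OF dp p0]) (rule val[OF neg])
  from DERIV_cmult[OF this, of "1 / (3 * N)"]
  have rp: "((\<lambda>q. 1 / (3 * N) * Hc \<theta>0 q) has_real_derivative c) (at p0)"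
    using N by simp
  \<comment> \<open>The values agree only where \<open>bracket\<close> is negative; openness
    provides the neighbourhood on which the derivative in \<theta> is transferred.\<close>
  have "open {u. bracket \<beta> u < 0}"
    unfolding bracket_def by (intro open_Collect_less continuous_intros)
  then have "((\<lambda>u. Hc u p0) has_real_derivative 3 * N * d) (at \<theta>0)"
    using neg p0 by (intro has_field_derivative_transform_within_open[OF dt]) (auto simp: val)
  from DERIV_cmult[OF this, of "1 / (3 * N)"]
  have rt: "((\<lambda>u. 1 / (3 * N) * Hc u p0) has_real_derivative d) (at \<theta>0)"
    using N by simp
  \<comment> \<open>By uniqueness of derivatives the existential quantifiers in both evolution laws
    can only be met by \<open>c\<close> and \<open>d\<close>, so both laws reduce to this pair of
    equations.\<close>
  let ?E = "(\<theta> has_real_derivative - (\<kappa> / a\<^sup>2) * c) (at \<tau>) \<and> (p has_real_derivative \<kappa> / a\<^sup>2 * d) (at \<tau>)"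
  have "has_partial_p_par H \<theta>0 p0 e D \<longleftrightarrow> D = c" "has_partial_theta_par H \<theta>0 p0 e D \<longleftrightarrow> D = d" for e D
    using pp[of e] pt[of e] DERIV_unique unfolding has_partial_p_par_def has_partial_theta_par_def by blast+
  then have "lattice_evolution H \<kappa> a \<theta> p \<tau> \<longleftrightarrow> ?E"
    unfolding lattice_evolution_def \<theta>0_def[symmetric] p0_def[symmetric] by simp
  moreover have "reduced_evolution Hc N \<kappa> a \<theta> p \<tau> \<longleftrightarrow> ?E"
    unfolding reduced_evolution_def \<theta>0_def[symmetric] p0_def[symmetric]
    using rp rt DERIV_unique by blast
  moreover have "transversal_constraints H (\<theta> \<tau>) (p \<tau>)"
    unfolding transversal_constraints_def \<theta>0_def[symmetric] p0_def[symmetric]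
    using perp nz by blast
  ultimately show "(lattice_evolution H \<kappa> a \<theta> p \<tau> \<longleftrightarrow> reduced_evolution Hc N \<kappa> a \<theta> p \<tau>)
      \<and> transversal_constraints H (\<theta> \<tau>) (p \<tau>)"
    by blast
qed

end
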